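(* Let $\mathfrak m=\mathfrak m(V,W,\beta)$ be a complex extended translation algebra with $\dim V=2$. Then $N$ is even, $\mathfrak m$ is isomorphic to $\mathfrak n_{N/2}(\mathbb C)\oplus\mathfrak n_{N/2}(\mathbb C)$, and the maximal transitive prolongation of $\mathfrak m$ is $\mathfrak g=\mathfrak c_{N/2}(\mathbb C)\oplus\mathfrak c_{N/2}(\mathbb C)$.
   Context: Let $V\neq0$ be a finite-dimensional complex vector space with a nondegenerate symmetric bilinear form $(\cdot,\cdot)$. The Clifford algebra $C\!\ell(V)$ has product satisfying $vu+uv=-2(v,u)\mathbf 1$ for $v,u\in V$. Let $W\ne0$ be a finite-dimensional complex $C\!\ell(V)$-module, with action written $c\cdot s$. $N\ge1$ denotes the number of irreducible $C\!\ell(V)$-components of $W$, counted with multiplicity. The Lie algebra $\mathfrak{so}(V)$ acts on $V$ in the defining way and on $W$ by the spin representation, i.e. the endomorphism $w\mapsto (v,w)u-(u,w)v$ acts on $W$ as $\frac14(vu-uv)\in C\!\ell(V)$. Let $\beta$ be a nondegenerate bilinear form on $W$ such that: (B1) $\beta$ is $\mathfrak{so}(V)$-invariant; (B2) $\beta$ is symmetric (put $\epsilon=-1$) or skew-symmetric (put $\epsilon=1$); (B3) $\beta(v\cdot s,t)=\epsilon\beta(s,v\cdot t)$ for all $v\in V$, $s,t\in W$. The (complex) extended translation algebra $\mathfrak m=\mathfrak m(V,W,\beta)$ is the graded Lie algebra $\mathfrak m=\mathfrak m_{-2}+\mathfrak m_{-1}$, $\mathfrak m_{-2}=V$, $\mathfrak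 m_{-1}=W$, whose only nonzero bracket $W\times W\to V$ is given by $([s,t],v)=\beta(v\cdot s,t)$. The maximal transitive prolongation of $\mathfrak m$ is the (unique) complex graded Lie algebra $\mathfrak g=\sum_{p\in\mathbb Z}\mathfrak g_p$ such that (1) each $\mathfrak g_p$ is finite-dimensional; (2) the negatively graded part of $\mathfrak g$ is $\mathfrak m$ ($\mathfrak g_p=\mathfrak m_p$ for $p=-1,-2$ and $\mathfrak g_p=0$ for $p<-2$); (3) for all $p\ge0$, $X\in\mathfrak g_p$ with $[X,\mathfrak g_{-1}]=0$ implies $X=0$; (4) $\mathfrak g$ is maximal: any complex graded Lie algebra $\mathfrak g'$ satisfying (1)-(3) admits an injective graded Lie algebra homomorphism $\mathfrak g'\to\mathfrak g$. $\mathfrak c_\ell(\mathbb C)$ denotes the infinite-dimensional complex contact algebra in dimension $2\ell+1$: the graded Lie algebra of polynomial vector fields on $\mathbb C^{2\ell+1}$ (coordinates $x_i,y_i,z$, $1\le i\le\ell$) preserving the contact distribution $\ker(dz-\sum_i y_i\,dx_i)$, graded by giving $x_i,y_i$ weight $1$, $z$ weight $2$, $\partial_{x_i},\partial_{y_i}$ weight $-1$ and $\partial_z$ weight $-2$. $\mathfrak n_\ell(\mathbb C)$ denotes its negatively graded part (the Heisenberg algebra of dimension $2\ell+1$, with one-dimensional degree $-2$ part). Direct sums are direct sums of ideals, and equalities and isomorphisms are as graded Lie algebras. *)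

theory Defs
  imports
    Complex_Main
    "HOL-Library.Poly_Mapping"
    "HOL-Library.Product_Plus"
    "HOL-Algebra.QuotRing"
begin

section \<open>Complex vector spaces\<close>

text \<open>
  A complex vector space is a type of class \<open>ab_group_add\<close> with a scalar multiplication
  \<open>sc\<close> such that \<open>vector_space sc\<close>.
\<close>

definition fin_dim :: "(complex \<Rightarrow> 'a::ab_group_add \<Rightarrow> 'a) \<Rightarrow> 'a set \<Rightarrow> bool" where
  "fin_dim sc S \<longleftrightarrow> (\<exists>B. finite B \<and> S \<subseteq> module.span sc B)"

definition bilinear_form ::
    "(complex \<Rightarrow> 'a::ab_group_add \<Rightarrow> 'a) \<Rightarrow> ('a \<Rightarrow> 'a \<Rightarrow> complex) \<Rightarrow> bool" where
  "bilinear_form sc b \<longleftrightarrow>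
     (\<forall>x. Vector_Spaces.linear sc (*) (\<lambda>y. b x y)) \<and>
     (\<forall>y. Vector_Spaces.linear sc (*) (\<lambda>x. b x y))"

definition nondegenerate_form :: "('a::zero \<Rightarrow> 'a \<Rightarrow> complex) \<Rightarrow> bool" where
  "nondegenerate_form b \<longleftrightarrow>
     (\<forall>x. (\<forall>y. b x y = 0) \<longrightarrow> x = 0) \<and> (\<forall>y. (\<forall>x. b x y = 0) \<longrightarrow> y = 0)"

text \<open>
  \<open>U\<close> is the internal direct sum of the subspaces \<open>S i\<close>; for infinite \<open>I\<close> only finite sums occur.
\<close>

definition direct_sum_of :: "'i set \<Rightarrow> ('i \<Rightarrow> 'a::ab_group_add set) \<Rightarrow> 'a set \<Rightarrow> bool" where
  "direct_sum_of I S U \<longleftrightarrow>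
     U = {\<Sum>i\<in>J. x i | J x. finite J \<and> J \<subseteq> I \<and> (\<forall>i\<in>J. x i \<in> S i)} \<and>
     (\<forall>J x. finite J \<and> J \<subseteq> I \<and> (\<forall>i\<in>J. x i \<in> S i) \<and> (\<Sum>i\<in>J. x i) = 0 \<longrightarrow> (\<forall>i\<in>J. x i = 0))"


section \<open>The Clifford algebra\<close>

datatype 'a word = Word "'a list"

instantiation word :: (type) monoid_add
begin

definition zero_word :: "'a word" where
  "0 = Word []"

fun plus_word :: "'a word \<Rightarrow> 'a word \<Rightarrow> 'a word" where
  "Word xs + Word ys = Word (xs @ ys)"

instance
proof
  fix a b c :: "'a word"
  show "a + b + c = a + (b + c)" by (cases a; cases b; cases c) simp
  show "0 + a = a" by (cases a) (simp add: zero_word_def)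
  show "a + 0 = a" by (cases a) (simp add: zero_word_def)
qed

end

text \<open>
  The monoid algebra of the free monoid on the set \<open>V\<close>, i.e. noncommutative polynomials in the
  letters \<open>v \<in> V\<close>. Dividing out the first two kinds of relation below gives the tensor algebra
  of \<open>V\<close>, the third kind then gives the Clifford algebra.
\<close>

definition free_alg :: "('v word \<Rightarrow>\<^sub>0 complex) ring" where
  "free_alg = \<lparr>carrier = UNIV, mult = (*), one = 1, zero = 0, add = (+)\<rparr>"

abbreviation letter :: "'v \<Rightarrow> 'v word \<Rightarrow>\<^sub>0 complex" where
  "letter v \<equiv> Poly_Mapping.single (Word [v]) 1"

abbreviation scalar :: "complex \<Rightarrow> 'v word \<Rightarrow>\<^sub>0 complex" where
  "scalar c \<equiv> Poly_Mapping.single 0 c"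

definition clifford_relations ::
    "(complex \<Rightarrow> 'v::ab_group_add \<Rightarrow> 'v) \<Rightarrow> ('v \<Rightarrow> 'v \<Rightarrow> complex) \<Rightarrow> ('v word \<Rightarrow>\<^sub>0 complex) set" where
  "clifford_relations sc q =
     {letter (v + u) - letter v - letter u | v u. True} \<union>
     {letter (sc c v) - scalar c * letter v | c v. True} \<union>
     {letter v * letter u + letter u * letter v + scalar (2 * q v u) | v u. True}"

definition clifford_ideal ::
    "(complex \<Rightarrow> 'v::ab_group_add \<Rightarrow> 'v) \<Rightarrow> ('v \<Rightarrow> 'v \<Rightarrow> complex) \<Rightarrow> ('v word \<Rightarrow>\<^sub>0 complex) set" where
  "clifford_ideal sc q = genideal free_alg (clifford_relations sc q)"

type_synonym 'v cliff = "('v word \<Rightarrow>\<^sub>0 complex) set"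

definition clifford_algebra ::
    "(complex \<Rightarrow> 'v::ab_group_add \<Rightarrow> 'v) \<Rightarrow> ('v \<Rightarrow> 'v \<Rightarrow> complex) \<Rightarrow> 'v cliff ring" where
  "clifford_algebra sc q = free_alg Quot (clifford_ideal sc q)"

definition cl_vec ::
    "(complex \<Rightarrow> 'v::ab_group_add \<Rightarrow> 'v) \<Rightarrow> ('v \<Rightarrow> 'v \<Rightarrow> complex) \<Rightarrow> 'v \<Rightarrow> 'v cliff" where
  "cl_vec sc q v = clifford_ideal sc q +>\<^bsub>free_alg\<^esub> letter v"

definition cl_scalar ::
    "(complex \<Rightarrow> 'v::ab_group_add \<Rightarrow> 'v) \<Rightarrow> ('v \<Rightarrow> 'v \<Rightarrow> complex) \<Rightarrow> complex \<Rightarrow> 'v cliff" where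
  "cl_scalar sc q c = clifford_ideal sc q +>\<^bsub>free_alg\<^esub> scalar c"

text \<open>The element \<open>1/4 (vu - uv)\<close> of the Clifford algebra.\<close>

definition spin_element ::
    "(complex \<Rightarrow> 'v::ab_group_add \<Rightarrow> 'v) \<Rightarrow> ('v \<Rightarrow> 'v \<Rightarrow> complex) \<Rightarrow> 'v \<Rightarrow> 'v \<Rightarrow> 'v cliff" where
  "spin_element sc q v u =
     (let Cl = clifford_algebra sc q; v' = cl_vec sc q v; u' = cl_vec sc q u
      in cl_scalar sc q (1/4) \<otimes>\<^bsub>Cl\<^esub> ((v' \<otimes>\<^bsub>Cl\<^esub> u') \<ominus>\<^bsub>Cl\<^esub> (u' \<otimes>\<^bsub>Cl\<^esub> v')))"

definition so :: "(complex \<Rightarrow> 'v::ab_group_add \<Rightarrow> 'v) \<Rightarrow> ('v \<Rightarrow> 'v \<Rightarrow> complex) \<Rightarrow> ('v \<Rightarrow> 'v) set" where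
  "so sc q = {A. Vector_Spaces.linear sc sc A \<and> (\<forall>x y. q (A x) y + q x (A y) = 0)}"

definition wedge ::
    "(complex \<Rightarrow> 'v::ab_group_add \<Rightarrow> 'v) \<Rightarrow> ('v \<Rightarrow> 'v \<Rightarrow> complex) \<Rightarrow> 'v \<Rightarrow> 'v \<Rightarrow> 'v \<Rightarrow> 'v" where
  "wedge sc q v u = (\<lambda>w. sc (q v w) u - sc (q u w) v)"


section \<open>Clifford modules\<close>

locale quadratic_space = vector_space scV
  for scV :: "complex \<Rightarrow> 'v::ab_group_add \<Rightarrow> 'v" +
  fixes q :: "'v \<Rightarrow> 'v \<Rightarrow> complex"
  assumes fin_dim_V: "fin_dim scV UNIV"
    and V_nonzero: "\<exists>v::'v. v \<noteq> 0"
    and q_bilinear: "bilinear_form scV q"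
    and q_sym: "q v u = q u v"
    and q_nondeg: "nondegenerate_form q"

locale clifford_module = quadratic_space scV q + W: vector_space scW
  for scV :: "complex \<Rightarrow> 'v::ab_group_add \<Rightarrow> 'v"
    and q :: "'v \<Rightarrow> 'v \<Rightarrow> complex"
    and scW :: "complex \<Rightarrow> 'w::ab_group_add \<Rightarrow> 'w" +
  fixes act :: "'v cliff \<Rightarrow> 'w \<Rightarrow> 'w"
  assumes fin_dim_W: "fin_dim scW UNIV"
    and W_nonzero: "\<exists>s::'w. s \<noteq> 0"
    and act_linear: "a \<in> carrier (clifford_algebra scV q) \<Longrightarrow> Vector_Spaces.linear scW scW (act a)"
    and act_add: "\<lbrakk>a \<in> carrier (clifford_algebra scV q); b \<in> carrier (clifford_algebra scV q)\<rbrakk>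
          \<Longrightarrow> act (a \<oplus>\<^bsub>clifford_algebra scV q\<^esub> b) s = act a s + act b s"
    and act_mult: "\<lbrakk>a \<in> carrier (clifford_algebra scV q); b \<in> carrier (clifford_algebra scV q)\<rbrakk>
          \<Longrightarrow> act (a \<otimes>\<^bsub>clifford_algebra scV q\<^esub> b) s = act a (act b s)"
    and act_one: "act \<one>\<^bsub>clifford_algebra scV q\<^esub> s = s"
    and act_scalar: "act (cl_scalar scV q c) s = scW c s"

definition cl_submodule ::
    "(complex \<Rightarrow> 'v::ab_group_add \<Rightarrow> 'v) \<Rightarrow> ('v \<Rightarrow> 'v \<Rightarrow> complex) \<Rightarrow>
     (complex \<Rightarrow> 'w::ab_group_add \<Rightarrow> 'w) \<Rightarrow> ('v cliff \<Rightarrow> 'w \<Rightarrow> 'w) \<Rightarrow> 'w set \<Rightarrow> bool" where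
  "cl_submodule scV q scW act U \<longleftrightarrow>
     module.subspace scW U \<and> (\<forall>a\<in>carrier (clifford_algebra scV q). \<forall>s\<in>U. act a s \<in> U)"

definition irreducible_submodule ::
    "(complex \<Rightarrow> 'v::ab_group_add \<Rightarrow> 'v) \<Rightarrow> ('v \<Rightarrow> 'v \<Rightarrow> complex) \<Rightarrow>
     (complex \<Rightarrow> 'w::ab_group_add \<Rightarrow> 'w) \<Rightarrow> ('v cliff \<Rightarrow> 'w \<Rightarrow> 'w) \<Rightarrow> 'w set \<Rightarrow> bool" where
  "irreducible_submodule scV q scW act U \<longleftrightarrow>
     cl_submodule scV q scW act U \<and> U \<noteq> {0} \<and>
     (\<forall>T. cl_submodule scV q scW act T \<and> T \<subseteq> U \<longrightarrow> T = {0} \<or> T = U)"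

text \<open>
  The number of irreducible components of \<open>W\<close>, with multiplicity: the number of summands in a
  decomposition of \<open>W\<close> into irreducible submodules, which exists and is unique for a Clifford module.
\<close>

definition num_components ::
    "(complex \<Rightarrow> 'v::ab_group_add \<Rightarrow> 'v) \<Rightarrow> ('v \<Rightarrow> 'v \<Rightarrow> complex) \<Rightarrow>
     (complex \<Rightarrow> 'w::ab_group_add \<Rightarrow> 'w) \<Rightarrow> ('v cliff \<Rightarrow> 'w \<Rightarrow> 'w) \<Rightarrow> nat" where
  "num_components scV q scW act =
     (THE n. \<exists>S :: nat \<Rightarrow> 'w set. (\<forall>i<n. irreducible_submodule scV q scW act (S i)) \<and>
        direct_sum_of {..<n} S UNIV)"


section \<open>Graded Lie algebras\<close>

text \<open>
  The addition is that of the ambient type, and the algebra is the subspace \<open>carrier\<close> of it;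
  nothing is required of the bracket outside the carrier.
\<close>

record 'a graded_lie = "'a partial_object" +
  scal :: "complex \<Rightarrow> 'a \<Rightarrow> 'a"
  bracket :: "'a \<Rightarrow> 'a \<Rightarrow> 'a"
  piece :: "int \<Rightarrow> 'a set"

locale graded_lie_algebra = vector_space "scal G"
  for G :: "'a::ab_group_add graded_lie" (structure) +
  assumes carrier_subspace: "subspace (carrier G)"
    and bracket_closed: "\<lbrakk>x \<in> carrier G; y \<in> carrier G\<rbrakk> \<Longrightarrow> bracket G x y \<in> carrier G"
    and bracket_add_left: "\<lbrakk>x \<in> carrier G; y \<in> carrier G; z \<in> carrier G\<rbrakk>
          \<Longrightarrow> bracket G (x + y) z = bracket G x z + bracket G y z"
    and bracket_add_right: "\<lbrakk>x \<in> carrier G; y \<in> carrier G; z \<in> carrier G\<rbrakk>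
          \<Longrightarrow> bracket G x (y + z) = bracket G x y + bracket G x z"
    and bracket_scale_left: "\<lbrakk>x \<in> carrier G; y \<in> carrier G\<rbrakk>
          \<Longrightarrow> bracket G (scal G c x) y = scal G c (bracket G x y)"
    and bracket_scale_right: "\<lbrakk>x \<in> carrier G; y \<in> carrier G\<rbrakk>
          \<Longrightarrow> bracket G x (scal G c y) = scal G c (bracket G x y)"
    and bracket_self: "x \<in> carrier G \<Longrightarrow> bracket G x x = 0"
    and jacobi: "\<lbrakk>x \<in> carrier G; y \<in> carrier G; z \<in> carrier G\<rbrakk>
          \<Longrightarrow> bracket G x (bracket G y z) + bracket G y (bracket G z x) + bracket G z (bracket G x y) = 0"
    and piece_subspace: "subspace (piece G i)"
    and piece_direct_sum: "direct_sum_of UNIV (piece G) (carrier G)"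
    and piece_bracket: "\<lbrakk>x \<in> piece G i; y \<in> piece G j\<rbrakk> \<Longrightarrow> bracket G x y \<in> piece G (i + j)"

definition graded_hom ::
    "'a::ab_group_add graded_lie \<Rightarrow> 'b::ab_group_add graded_lie \<Rightarrow> ('a \<Rightarrow> 'b) \<Rightarrow> bool" where
  "graded_hom G H f \<longleftrightarrow>
     (\<forall>x\<in>carrier G. f x \<in> carrier H) \<and>
     (\<forall>x\<in>carrier G. \<forall>y\<in>carrier G. f (x + y) = f x + f y) \<and>
     (\<forall>c. \<forall>x\<in>carrier G. f (scal G c x) = scal H c (f x)) \<and>
     (\<forall>x\<in>carrier G. \<forall>y\<in>carrier G. f (bracket G x y) = bracket H (f x) (f y)) \<and>
     (\<forall>p. \<forall>x\<in>piece G p. f x \<in> piece H p)"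

definition graded_iso ::
    "'a::ab_group_add graded_lie \<Rightarrow> 'b::ab_group_add graded_lie \<Rightarrow> bool" where
  "graded_iso G H \<longleftrightarrow> graded_lie_algebra G \<and> graded_lie_algebra H \<and>
     (\<exists>f. graded_hom G H f \<and> bij_betw f (carrier G) (carrier H))"

definition negative_part :: "'a::ab_group_add graded_lie \<Rightarrow> 'a graded_lie" where
  "negative_part G =
     \<lparr>carrier = {\<Sum>p\<in>J. x p | J x. finite J \<and> J \<subseteq> {..<0} \<and> (\<forall>p\<in>J. x p \<in> piece G p)},
      scal = scal G,
      bracket = bracket G,
      piece = (\<lambda>p. if p < 0 then piece G p else {0})\<rparr>"

definition lie_direct_sum ::
    "'a::ab_group_add graded_lie \<Rightarrow> 'b::ab_group_add graded_lie \<Rightarrow> ('a \<times> 'b) graded_lie" where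
  "lie_direct_sum G H =
     \<lparr>carrier = carrier G \<times> carrier H,
      scal = (\<lambda>c (x, y). (scal G c x, scal H c y)),
      bracket = (\<lambda>(x, y) (x', y'). (bracket G x x', bracket H y y')),
      piece = (\<lambda>p. piece G p \<times> piece H p)\<rparr>"

text \<open>
  Equality of the negative part of \<open>G\<close> with \<open>M\<close> is equality as graded Lie algebras, i.e. up to
  isomorphism (the two live on different types).
\<close>

definition transitive_prolongation ::
    "'m::ab_group_add graded_lie \<Rightarrow> 'a::ab_group_add graded_lie \<Rightarrow> bool" where
  "transitive_prolongation M G \<longleftrightarrow>
     graded_lie_algebra G \<and>
     (\<forall>p. fin_dim (scal G) (piece G p)) \<and>
     graded_iso (negative_part G) M \<and>
     (\<forall>p\<ge>0. \<forall>X\<in>piece G p. (\<forall>Y\<in>piece G (-1). bracket G X Y = 0) \<longrightarrow> X = 0)"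

text \<open>
  Quantification over all graded Lie algebras is not possible inside a formula, so the maximality
  condition ranges over the graded Lie algebras on an arbitrary type \<open>'t\<close>; it is to be used with
  \<open>'t\<close> a free type variable of the theorem.
\<close>

definition maximal_transitive_prolongation ::
    "'t::ab_group_add itself \<Rightarrow> 'm::ab_group_add graded_lie \<Rightarrow> 'a::ab_group_add graded_lie \<Rightarrow> bool"
where
  "maximal_transitive_prolongation TT M G \<longleftrightarrow>
     transitive_prolongation M G \<and>
     (\<forall>G' :: 't graded_lie. transitive_prolongation M G' \<longrightarrow>
        (\<exists>f. graded_hom G' G f \<and> inj_on f (carrier G')))"


section \<open>Extended translation algebras\<close>

text \<open>
  \<open>spin\<close> is the action of \<open>so(V)\<close> on \<open>W\<close>; since the endomorphisms \<open>wedge v u\<close> span \<open>so(V)\<close>,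
  it is determined there by the assumptions.
\<close>

locale extended_translation_data = clifford_module scV q scW act
  for scV :: "complex \<Rightarrow> 'v::ab_group_add \<Rightarrow> 'v"
    and q :: "'v \<Rightarrow> 'v \<Rightarrow> complex"
    and scW :: "complex \<Rightarrow> 'w::ab_group_add \<Rightarrow> 'w"
    and act :: "'v cliff \<Rightarrow> 'w \<Rightarrow> 'w" +
  fixes spin :: "('v \<Rightarrow> 'v) \<Rightarrow> 'w \<Rightarrow> 'w"
    and \<beta> :: "'w \<Rightarrow> 'w \<Rightarrow> complex"
    and \<epsilon> :: complex
  assumes spin_add: "\<lbrakk>A \<in> so scV q; B \<in> so scV q\<rbrakk> \<Longrightarrow> spin (\<lambda>x. A x + B x) s = spin A s + spin B s"
    and spin_scale: "A \<in> so scV q \<Longrightarrow> spin (\<lambda>x. scV c (A x)) s = scW c (spin A s)"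
    and spin_wedge: "spin (wedge scV q v u) s = act (spin_element scV q v u) s"
    and \<beta>_bilinear: "bilinear_form scW \<beta>"
    and \<beta>_nondeg: "nondegenerate_form \<beta>"
    and B1: "A \<in> so scV q \<Longrightarrow> \<beta> (spin A s) t + \<beta> s (spin A t) = 0"
    and B2: "(\<epsilon> = -1 \<and> (\<forall>s t. \<beta> s t = \<beta> t s)) \<or> (\<epsilon> = 1 \<and> (\<forall>s t. \<beta> s t = - \<beta> t s))"
    and B3: "\<beta> (act (cl_vec scV q v) s) t = \<epsilon> * \<beta> s (act (cl_vec scV q v) t)"

definition translation_bracket ::
    "(complex \<Rightarrow> 'v::ab_group_add \<Rightarrow> 'v) \<Rightarrow> ('v \<Rightarrow> 'v \<Rightarrow> complex) \<Rightarrow> ('v cliff \<Rightarrow> 'w \<Rightarrow> 'w) \<Rightarrow>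
     ('w \<Rightarrow> 'w \<Rightarrow> complex) \<Rightarrow> 'w \<Rightarrow> 'w \<Rightarrow> 'v" where
  "translation_bracket scV q act \<beta> s t = (THE x. \<forall>v. q x v = \<beta> (act (cl_vec scV q v) s) t)"

definition extended_translation_algebra ::
    "(complex \<Rightarrow> 'v::ab_group_add \<Rightarrow> 'v) \<Rightarrow> ('v \<Rightarrow> 'v \<Rightarrow> complex) \<Rightarrow>
     (complex \<Rightarrow> 'w::ab_group_add \<Rightarrow> 'w) \<Rightarrow> ('v cliff \<Rightarrow> 'w \<Rightarrow> 'w) \<Rightarrow>
     ('w \<Rightarrow> 'w \<Rightarrow> complex) \<Rightarrow> ('w \<times> 'v) graded_lie" where
  "extended_translation_algebra scV q scW act \<beta> =
     \<lparr>carrier = UNIV,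
      scal = (\<lambda>c (s, v). (scW c s, scV c v)),
      bracket = (\<lambda>(s, v) (t, u). (0, translation_bracket scV q act \<beta> s t)),
      piece = (\<lambda>p. if p = -1 then UNIV \<times> {0} else if p = -2 then {0} \<times> UNIV else {0})\<rparr>"


section \<open>Contact algebras\<close>

text \<open>
  The coordinates \<open>x_i\<close>, \<open>y_i\<close>, \<open>z\<close>; the index \<open>i\<close> runs over \<open>{0..<l}\<close>. Polynomials are
  finitely supported functions on monomials, and a vector field is the finitely supported family
  of its components with respect to the coordinate fields.
\<close>

datatype coord = Xc nat | Yc nat | Zc

type_synonym cpoly = "(coord \<Rightarrow>\<^sub>0 nat) \<Rightarrow>\<^sub>0 complex"
type_synonym vfield = "coord \<Rightarrow>\<^sub>0 cpoly"

definition coords :: "nat \<Rightarrow> coord set" where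
  "coords l = Xc ` {..<l} \<union> Yc ` {..<l} \<union> {Zc}"

definition polys :: "nat \<Rightarrow> cpoly set" where
  "polys l = {f. \<forall>m\<in>Poly_Mapping.keys f. Poly_Mapping.keys m \<subseteq> coords l}"

definition vfields :: "nat \<Rightarrow> vfield set" where
  "vfields l = {X. Poly_Mapping.keys X \<subseteq> coords l \<and> (\<forall>u. Poly_Mapping.lookup X u \<in> polys l)}"

definition coord_poly :: "coord \<Rightarrow> cpoly" where
  "coord_poly u = Poly_Mapping.single (Poly_Mapping.single u 1) 1"

text \<open>
  The truncated subtraction of exponents is harmless: if \<open>u\<close> does not occur in \<open>m\<close>, the
  coefficient vanishes.
\<close>

definition partial_deriv :: "coord \<Rightarrow> cpoly \<Rightarrow> cpoly" where
  "partial_deriv u f =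
     (\<Sum>m\<in>Poly_Mapping.keys f.
        Poly_Mapping.single (m - Poly_Mapping.single u 1)
          (of_nat (Poly_Mapping.lookup m u) * Poly_Mapping.lookup f m))"

definition vf_apply :: "vfield \<Rightarrow> cpoly \<Rightarrow> cpoly" where
  "vf_apply X f = (\<Sum>u\<in>Poly_Mapping.keys X. Poly_Mapping.lookup X u * partial_deriv u f)"

definition vf_scale :: "complex \<Rightarrow> vfield \<Rightarrow> vfield" where
  "vf_scale c X = Poly_Mapping.map (\<lambda>f. Poly_Mapping.single 0 c * f) X"

definition vf_bracket :: "vfield \<Rightarrow> vfield \<Rightarrow> vfield" where
  "vf_bracket X Y =
     (\<Sum>u\<in>Poly_Mapping.keys X \<union> Poly_Mapping.keys Y.
        Poly_Mapping.single u
          (vf_apply X (Poly_Mapping.lookup Y u) - vf_apply Y (Poly_Mapping.lookup X u)))"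

text \<open>The value of the contact form \<open>dz - \<Sum> y_i dx_i\<close> on a vector field.\<close>

definition contact_form :: "nat \<Rightarrow> vfield \<Rightarrow> cpoly" where
  "contact_form l X =
     Poly_Mapping.lookup X Zc - (\<Sum>i<l. coord_poly (Yc i) * Poly_Mapping.lookup X (Xc i))"

definition contact_distribution :: "nat \<Rightarrow> vfield set" where
  "contact_distribution l = {Y \<in> vfields l. contact_form l Y = 0}"

definition contact_fields :: "nat \<Rightarrow> vfield set" where
  "contact_fields l =
     {X \<in> vfields l. \<forall>Y\<in>contact_distribution l. vf_bracket X Y \<in> contact_distribution l}"

fun coord_weight :: "coord \<Rightarrow> nat" where
  "coord_weight (Xc i) = 1"
| "coord_weight (Yc i) = 1"
| "coord_weight Zc = 2"

definition monom_weight :: "(coord \<Rightarrow>\<^sub>0 nat) \<Rightarrow> nat" where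
  "monom_weight m = (\<Sum>u\<in>Poly_Mapping.keys m. coord_weight u * Poly_Mapping.lookup m u)"

definition vf_homogeneous :: "int \<Rightarrow> vfield \<Rightarrow> bool" where
  "vf_homogeneous p X \<longleftrightarrow>
     (\<forall>u. \<forall>m\<in>Poly_Mapping.keys (Poly_Mapping.lookup X u).
        int (monom_weight m) - int (coord_weight u) = p)"

definition contact_algebra :: "nat \<Rightarrow> vfield graded_lie" where
  "contact_algebra l =
     \<lparr>carrier = contact_fields l,
      scal = vf_scale,
      bracket = vf_bracket,
      piece = (\<lambda>p. {X \<in> contact_fields l. vf_homogeneous p X})\<rparr>"

definition heisenberg_algebra :: "nat \<Rightarrow> vfield graded_lie" where
  "heisenberg_algebra l = negative_part (contact_algebra l)"

end

theory Submission
  imports Defs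
begin

text \<open>
  \<^bold>\<open>Splitting.\<close> A two-dimensional \<open>V\<close> has a basis of null vectors \<open>e1\<close>, \<open>e2\<close> with
  \<open>(e1, e2) = -1/2\<close> (\<open>null_basis_exists\<close>). Their Clifford actions satisfy
  \<open>e1\<^sup>2 = e2\<^sup>2 = 0\<close> and \<open>e1 e2 + e2 e1 = 1\<close>, so that \<open>W\<close> is the sum of \<open>ker e1\<close> and
  \<open>ker e2\<close>, which \<open>e1\<close> and \<open>e2\<close> exchange. On \<open>ker e2\<close> the form \<open>\<beta>(e1 s, t)\<close> is
  symplectic, whatever the symmetry of \<open>\<beta>\<close>, and likewise for \<open>\<beta>(e2 s, t)\<close> on \<open>ker e1\<close>; these
  two forms are the components of the bracket of \<open>W\<close>, and the brackets between the kernels vanish. So the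
  algebra is a sum of two Heisenberg algebras (\<open>M_double_heisenberg\<close>). An irreducible submodule meets
  \<open>ker e2\<close> in a line, hence \<open>N = dim (ker e2)\<close> (\<open>num_components_eq\<close>), and this is even because
  \<open>ker e2\<close> is symplectic.

  \<^bold>\<open>The contact algebra.\<close> A contact field is determined by the value of the contact form on it, its
  generating function, and every polynomial occurs (\<open>contact_fields_eq\<close>). The brackets with the fields
  generated by \<open>1\<close>, \<open>x\<^sub>i\<close>, \<open>y\<^sub>i\<close> act on generating functions as
  \<open>\<partial>\<^sub>z\<close>, \<open>\<partial>\<^sub>y + x \<partial>\<^sub>z\<close> and \<open>-\<partial>\<^sub>x\<close>, so that only
  constants are killed by all of them. For \<open>l > 0\<close> the first of these fields is a bracket of two others,
  and transitivity follows.

  \<^bold>\<open>Maximality.\<close> Let \<open>G\<close> be graded with the given negative part, and choose one of the two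
  summands with its symplectic basis. An embedding of \<open>G\<close> into contact fields has to intertwine brackets with
  this basis, which prescribes all partial derivatives of the generating function of \<open>X \<in> G\<close> in terms
  of those of elements of lower degree. The weighted Euler formula then turns into a recursive definition of
  this function (\<open>gen\<close>). By the Jacobi identity the prescribed derivatives form a closed form, so that the
  function does have them (\<open>partial_deriv_gen_fun\<close>), and induction on the degree shows that brackets go to
  brackets (\<open>lagrange_gen_fun\<close>). The two functions obtained from the two summands map \<open>G\<close> to the sum
  of two contact algebras; if both vanish on \<open>X\<close>, then they vanish on \<open>[X, W]\<close>, and transitivity of
  \<open>G\<close> gives \<open>X = 0\<close> by induction (\<open>gf_injective\<close>). The algebra itself, as an algebra with nothing in
  nonnegative degree, is mapped onto the negative part (\<open>graded_iso_double_heisenberg\<close>).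
\<close>

abbreviation "lookup \<equiv> Poly_Mapping.lookup"
abbreviation "single \<equiv> Poly_Mapping.single"
abbreviation "keys \<equiv> Poly_Mapping.keys"

section \<open>Polynomials with weighted variables\<close>

lemma sum_single_lookup: "finite A \<Longrightarrow> keys f \<subseteq> A \<Longrightarrow> (\<Sum>m\<in>A. single m (lookup f m)) = f"
proof (rule poly_mapping_eqI)
  fix k assume A: "finite A" "keys f \<subseteq> A"
  have "lookup (\<Sum>m\<in>A. single m (lookup f m)) k = (\<Sum>m\<in>A. if m = k then lookup f k else 0)"
    unfolding lookup_sum by (rule sum.cong) (auto simp: lookup_single when_def)
  also have "\<dots> = lookup f k"
    using A by (auto simp: in_keys_iff)
  finally show "lookup (\<Sum>m\<in>A. single m (lookup f m)) k = lookup f k" .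
qed

lemma poly_mapping_single_induct [case_names zero single add]:
  fixes f :: "'k \<Rightarrow>\<^sub>0 'b::comm_monoid_add"
  assumes "P 0" "\<And>m c. P (single m c)" "\<And>f g. P f \<Longrightarrow> P g \<Longrightarrow> P (f + g)"
  shows "P f"
proof -
  have "P (\<Sum>m\<in>A. single m (lookup f m))" if "finite A" for A
    using that by induction (auto intro: assms)
  from this[of "keys f"] show ?thesis by (simp add: sum_single_lookup)
qed

lemma add_single_minus_single:
  fixes m :: "coord \<Rightarrow>\<^sub>0 nat"
  shows "lookup m u > 0 \<Longrightarrow> m - single u 1 + single u 1 = m"
  by (rule poly_mapping_eqI) (auto simp: lookup_add lookup_minus lookup_single when_def)

text \<open>
  In this coefficientwise form linearity, commutation and homogeneity of derivatives are immediate, and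
  no truncated subtraction is left.
\<close>

lemma lookup_partial_deriv:
  "lookup (partial_deriv u f) m = of_nat (lookup m u + 1) * lookup f (m + single u 1)"
proof -
  have *: "m - single u 1 + single u 1 = m" if "lookup m u \<noteq> 0" for m :: "coord \<Rightarrow>\<^sub>0 nat"
    using add_single_minus_single that by simp
  have "lookup (partial_deriv u f) m
      = (\<Sum>k\<in>keys f. if k = m + single u 1 then of_nat (lookup k u) * lookup f k else 0)"
    unfolding partial_deriv_def lookup_sum
  proof (rule sum.cong)
    fix k assume "k \<in> keys f"
    show "lookup (single (k - single u 1) (of_nat (lookup k u) * lookup f k)) m
       = (if k = m + single u 1 then of_nat (lookup k u) * lookup f k else 0)"
      using *[of k] by (cases "lookup k u = 0") (auto simp: lookup_single when_def)
  qed simp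
  also have "\<dots> = of_nat (lookup m u + 1) * lookup f (m + single u 1)"
    by (auto simp: lookup_add in_keys_iff)
  finally show ?thesis .
qed

lemma partial_deriv_add: "partial_deriv u (f + g) = partial_deriv u f + partial_deriv u g"
  by (rule poly_mapping_eqI) (simp add: lookup_partial_deriv lookup_add algebra_simps)

lemma partial_deriv_zero [simp]: "partial_deriv u 0 = 0"
  by (simp add: partial_deriv_def)

lemma partial_deriv_uminus: "partial_deriv u (- f) = - partial_deriv u f"
  by (rule poly_mapping_eqI) (simp add: lookup_partial_deriv)

lemma partial_deriv_diff: "partial_deriv u (f - g) = partial_deriv u f - partial_deriv u g"
  using partial_deriv_add[of u f "- g"] by (simp add: partial_deriv_uminus)

lemma partial_deriv_sum: "partial_deriv u (sum f A) = (\<Sum>a\<in>A. partial_deriv u (f a))"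
  by (induction A rule: infinite_finite_induct) (simp_all add: partial_deriv_add)

lemma partial_deriv_single:
  "partial_deriv u (single m c) = single (m - single u 1) (of_nat (lookup m u) * c)"
  by (cases "c = 0") (simp_all add: partial_deriv_def)

lemma partial_deriv_const [simp]: "partial_deriv u (single 0 c) = 0"
  by (simp add: partial_deriv_single)

lemma partial_deriv_one [simp]: "partial_deriv u 1 = 0"
  using partial_deriv_const[of u 1] by simp

lemma partial_deriv_mult:
  "partial_deriv u (f * g) = partial_deriv u f * g + f * partial_deriv u g"
proof (induction f rule: poly_mapping_single_induct)
  case (single m c)
  show ?case
  proof (induction g rule: poly_mapping_single_induct)
    case (single n d)
    have 1: "(m - single u 1) + n = m + n - single u 1" if "lookup m u > 0"
      using that by (intro poly_mapping_eqI) (auto simp: lookup_add lookup_minus lookup_single when_def)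
    have 2: "m + (n - single u 1) = m + n - single u 1" if "lookup n u > 0"
      using that by (intro poly_mapping_eqI) (auto simp: lookup_add lookup_minus lookup_single when_def)
    show ?case
      using 1 2
      by (cases "lookup m u = 0"; cases "lookup n u = 0")
         (simp_all add: partial_deriv_single mult_single lookup_add single_add[symmetric] algebra_simps)
  qed (simp_all add: partial_deriv_add algebra_simps)
qed (simp_all add: partial_deriv_add algebra_simps)

lemma partial_deriv_const_mult: "partial_deriv u (single 0 c * f) = single 0 c * partial_deriv u f"
  by (simp add: partial_deriv_mult)

lemma partial_deriv_commute: "partial_deriv u (partial_deriv v f) = partial_deriv v (partial_deriv u f)"
  by (cases "u = v"; rule poly_mapping_eqI)
     (simp_all add: lookup_partial_deriv lookup_add lookup_single when_def algebra_simps)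

lemma partial_deriv_coord: "partial_deriv u (coord_poly v) = (if u = v then 1 else 0)"
  by (simp add: coord_poly_def partial_deriv_single lookup_single when_def)

lemma polys_0 [simp]: "0 \<in> polys l" by (simp add: polys_def)
lemma polys_const [simp]: "single 0 c \<in> polys l" by (simp add: polys_def)
lemma polys_1 [simp]: "1 \<in> polys l" by (simp add: polys_def)
lemma polys_add: "f \<in> polys l \<Longrightarrow> g \<in> polys l \<Longrightarrow> f + g \<in> polys l"
  unfolding polys_def mem_Collect_eq using keys_add[of f g] by blast
lemma polys_uminus: "f \<in> polys l \<Longrightarrow> - f \<in> polys l"
  by (auto simp: polys_def in_keys_iff)
lemma polys_diff: "f \<in> polys l \<Longrightarrow> g \<in> polys l \<Longrightarrow> f - g \<in> polys l"
  by (metis diff_conv_add_uminus polys_add polys_uminus)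
lemma polys_mult:
  assumes "f \<in> polys l" "g \<in> polys l"
  shows "f * g \<in> polys l"
  unfolding polys_def
proof (clarify)
  fix m x assume "m \<in> keys (f * g)" and x: "x \<in> keys m"
  then obtain a b where "m = a + b" "a \<in> keys f" "b \<in> keys g" using keys_mult by blast
  then show "x \<in> coords l" using assms x keys_add[of a b] unfolding polys_def by blast
qed
lemma polys_sum: "(\<And>a. a \<in> A \<Longrightarrow> f a \<in> polys l) \<Longrightarrow> sum f A \<in> polys l"
  by (induction A rule: infinite_finite_induct) (auto intro: polys_add)
lemma polys_coord: "u \<in> coords l \<Longrightarrow> coord_poly u \<in> polys l"
  by (simp add: polys_def coord_poly_def)
lemma polys_partial_deriv: "f \<in> polys l \<Longrightarrow> partial_deriv u f \<in> polys l"
  unfolding polys_def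
proof clarsimp
  fix m x assume f: "\<forall>m\<in>keys f. keys m \<subseteq> coords l"
    and m: "m \<in> keys (partial_deriv u f)" "x \<in> keys m"
  from m have "m + single u 1 \<in> keys f" by (simp add: in_keys_iff lookup_partial_deriv)
  moreover have "x \<in> keys (m + single u 1)" using m(2) by (simp add: in_keys_iff lookup_add)
  ultimately show "x \<in> coords l" using f by blast
qed

lemmas polys_intros = polys_0 polys_1 polys_const polys_add polys_uminus polys_diff polys_mult
  polys_sum polys_partial_deriv polys_coord

lemma finite_coords [simp]: "finite (coords l)" by (simp add: coords_def)

lemma coords_simps [simp]: "Xc i \<in> coords l \<longleftrightarrow> i < l" "Yc i \<in> coords l \<longleftrightarrow> i < l" "Zc \<in> coords l"
  by (auto simp: coords_def)

lemma sum_coords: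
  "(\<Sum>u\<in>coords l. F u) = (\<Sum>i<l. F (Xc i)) + (\<Sum>i<l. F (Yc i)) + (F Zc :: 'b::comm_monoid_add)"
proof -
  have "(\<Sum>u\<in>Xc ` {..<l} \<union> Yc ` {..<l} \<union> {Zc}. F u)
      = (\<Sum>u\<in>Xc ` {..<l}. F u) + (\<Sum>u\<in>Yc ` {..<l}. F u) + (\<Sum>u\<in>{Zc}. F u)"
    by (subst sum.union_disjoint, simp, simp, blast, subst sum.union_disjoint) auto
  then show ?thesis
    by (simp add: coords_def sum.reindex inj_on_def)
qed

lemma partial_deriv_outside: "f \<in> polys l \<Longrightarrow> u \<notin> coords l \<Longrightarrow> partial_deriv u f = 0"
  by (rule poly_mapping_eqI)
     (auto simp: lookup_partial_deriv polys_def in_keys_iff subset_iff lookup_add)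

lemma constant_if_partial_derivs_zero:
  assumes "f \<in> polys l" "\<And>u. u \<in> coords l \<Longrightarrow> partial_deriv u f = 0"
  shows "f = single 0 (lookup f 0)"
proof (rule poly_mapping_eqI)
  fix m
  show "lookup f m = lookup (single 0 (lookup f 0)) m"
  proof (cases "m = 0")
    case False
    then obtain u where u: "lookup m u \<noteq> 0" by (metis lookup_zero poly_mapping_eqI)
    have d: "partial_deriv u f = 0" using assms partial_deriv_outside by blast
    have m: "m - single u 1 + single u 1 = m" using u add_single_minus_single by simp
    have "lookup (partial_deriv u f) (m - single u 1) = of_nat (lookup (m - single u 1) u + 1) * lookup f m"
      by (simp only: lookup_partial_deriv m)
    with d have "lookup f m = 0"
      by (metis Suc_eq_plus1 lookup_zero mult_eq_0_iff of_nat_eq_0_iff nat.distinct(1))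
    with False show ?thesis by (simp add: lookup_single)
  qed simp
qed

subsection \<open>Weights\<close>

lemma monom_weight_superset:
  "finite A \<Longrightarrow> keys m \<subseteq> A \<Longrightarrow> monom_weight m = (\<Sum>u\<in>A. coord_weight u * lookup m u)"
  unfolding monom_weight_def by (rule sum.mono_neutral_left) (auto simp: in_keys_iff)

lemma monom_weight_add: "monom_weight (m + n) = monom_weight m + monom_weight n"
proof -
  let ?A = "keys m \<union> keys n"
  have "monom_weight (m + n) = (\<Sum>u\<in>?A. coord_weight u * lookup (m + n) u)"
    by (rule monom_weight_superset) (auto simp: keys_add)
  also have "\<dots> = (\<Sum>u\<in>?A. coord_weight u * lookup m u) + (\<Sum>u\<in>?A. coord_weight u * lookup n u)"
    by (simp add: lookup_add sum.distrib algebra_simps)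
  also have "\<dots> = monom_weight m + monom_weight n"
    using monom_weight_superset[of ?A m] monom_weight_superset[of ?A n] by simp
  finally show ?thesis .
qed

lemma monom_weight_zero [simp]: "monom_weight 0 = 0" by (simp add: monom_weight_def)
lemma monom_weight_single [simp]: "monom_weight (single u k) = coord_weight u * k"
  by (simp add: monom_weight_def)

lemma coord_weight_pos: "coord_weight u > 0" by (cases u) auto

lemma monom_weight_eq_0 [simp]: "monom_weight m = 0 \<longleftrightarrow> m = 0"
proof
  assume "monom_weight m = 0"
  then have "\<forall>u\<in>keys m. lookup m u = 0"
    unfolding monom_weight_def using coord_weight_pos by (simp add: neq0_conv[symmetric] del: neq0_conv)
  then show "m = 0" by (intro poly_mapping_eqI) (auto simp: in_keys_iff)
qed simp

text \<open>
  Degrees are integers so that the rule for derivatives needs no side condition: a polynomial that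
  is homogeneous of negative degree is zero.
\<close>

definition homog :: "int \<Rightarrow> cpoly \<Rightarrow> bool" where
  "homog w f \<longleftrightarrow> (\<forall>m\<in>keys f. int (monom_weight m) = w)"

lemma homog_0 [simp]: "homog w 0" by (simp add: homog_def)
lemma homog_const [simp]: "homog 0 (single 0 c)" by (simp add: homog_def)
lemma homog_1 [simp]: "homog 0 1" by (simp add: homog_def)
lemma homog_add: "homog w f \<Longrightarrow> homog w g \<Longrightarrow> homog w (f + g)"
  using keys_add[of f g] by (auto simp: homog_def)
lemma homog_uminus: "homog w f \<Longrightarrow> homog w (- f)"
  by (auto simp: homog_def in_keys_iff)
lemma homog_diff: "homog w f \<Longrightarrow> homog w g \<Longrightarrow> homog w (f - g)"
  by (metis diff_conv_add_uminus homog_add homog_uminus)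
lemma homog_mult: "homog w f \<Longrightarrow> homog v g \<Longrightarrow> homog (w + v) (f * g)"
  unfolding homog_def
proof
  fix m assume *: "\<forall>m\<in>keys f. int (monom_weight m) = w" "\<forall>m\<in>keys g. int (monom_weight m) = v"
    and "m \<in> keys (f * g)"
  then obtain a b where "m = a + b" "a \<in> keys f" "b \<in> keys g" using keys_mult by blast
  with * show "int (monom_weight m) = w + v" by (auto simp: monom_weight_add)
qed
lemma homog_sum: "(\<And>a. a \<in> A \<Longrightarrow> homog w (f a)) \<Longrightarrow> homog w (sum f A)"
  by (induction A rule: infinite_finite_induct) (auto intro: homog_add)
lemma homog_coord: "homog (int (coord_weight u)) (coord_poly u)"
  by (simp add: homog_def coord_poly_def)
lemma homog_partial_deriv: "homog w f \<Longrightarrow> homog (w - int (coord_weight u)) (partial_deriv u f)"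
  unfolding homog_def
proof
  fix m assume *: "\<forall>m\<in>keys f. int (monom_weight m) = w" and "m \<in> keys (partial_deriv u f)"
  then have "m + single u 1 \<in> keys f" by (simp add: in_keys_iff lookup_partial_deriv)
  with * have "int (monom_weight (m + single u 1)) = w" by blast
  then show "int (monom_weight m) = w - int (coord_weight u)" by (simp add: monom_weight_add)
qed
lemma homog_const_mult: "homog w f \<Longrightarrow> homog w (single 0 c * f)"
  using homog_mult[of 0 "single 0 c" w f] by simp

lemma homog_negative: "homog w f \<Longrightarrow> w < 0 \<Longrightarrow> f = 0"
  by (rule poly_mapping_eqI) (force simp: homog_def in_keys_iff)

lemma homog_degree_0: "homog 0 f \<Longrightarrow> f = single 0 (lookup f 0)"
  by (rule poly_mapping_eqI) (auto simp: homog_def in_keys_iff lookup_single when_def)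

lemma coord_mult_partial_deriv_single:
  "coord_poly u * partial_deriv u (single m c) = single m (of_nat (lookup m u) * c)"
proof (cases "lookup m u = 0")
  case False
  then have "single u 1 + (m - single u 1) = m"
    using add_single_minus_single[of m u] by (simp add: add.commute)
  then show ?thesis
    by (simp add: coord_poly_def partial_deriv_single mult_single)
qed (simp add: partial_deriv_single)

lemma of_nat_mult_single: "of_nat k * single m c = single m (of_nat k * c :: complex)"
  for m :: "'k::monoid_add"
  by (simp only: single_of_nat[symmetric] mult_single add_0)

lemma single_sum: "single m (sum f A) = (\<Sum>a\<in>A. single m (f a))"
  by (induction A rule: infinite_finite_induct) (simp_all add: single_add)

text \<open>
  On a monomial \<open>u \<partial>\<^sub>u\<close> multiplies by the exponent of \<open>u\<close>. This formula recovers a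
  homogeneous polynomial of nonzero degree from its partial derivatives.
\<close>

lemma weighted_euler:
  assumes "f \<in> polys l" "homog w f"
  shows "(\<Sum>u\<in>coords l. of_nat (coord_weight u) * (coord_poly u * partial_deriv u f)) = of_int w * f"
proof -
  let ?E = "\<lambda>f. \<Sum>u\<in>coords l. of_nat (coord_weight u) * (coord_poly u * partial_deriv u f)"
  have add: "?E (sum g A) = (\<Sum>a\<in>A. ?E (g a))" for g :: "'k \<Rightarrow> cpoly" and A
    unfolding partial_deriv_sum sum_distrib_left by (rule sum.swap)
  have s: "?E (single m c) = of_int w * single m c" if "keys m \<subseteq> coords l" "int (monom_weight m) = w" for m c
  proof -
    have "?E (single m c) = (\<Sum>u\<in>coords l. single m (of_nat (coord_weight u * lookup m u) * c))"
      by (rule sum.cong) (simp_all only: coord_mult_partial_deriv_single of_nat_mult_single of_nat_mult mult.assoc)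
    also have "\<dots> = single m ((\<Sum>u\<in>coords l. of_nat (coord_weight u * lookup m u)) * c)"
      by (simp only: single_sum sum_distrib_right)
    also have "(\<Sum>u\<in>coords l. of_nat (coord_weight u * lookup m u)) = (of_nat (monom_weight m) :: complex)"
      using monom_weight_superset[OF finite_coords that(1)] by simp
    also have "single m (of_nat (monom_weight m) * c) = of_int w * single m c"
      by (simp only: that(2)[symmetric] of_nat_mult_single of_int_of_nat_eq)
    finally show ?thesis .
  qed
  have "?E f = ?E (\<Sum>m\<in>keys f. single m (lookup f m))" by (simp add: sum_single_lookup)
  also have "\<dots> = (\<Sum>m\<in>keys f. ?E (single m (lookup f m)))" by (rule add)
  also have "\<dots> = (\<Sum>m\<in>keys f. of_int w * single m (lookup f m))"
    using assms by (intro sum.cong refl s) (auto simp: polys_def homog_def)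
  also have "\<dots> = of_int w * f" by (simp add: sum_distrib_left[symmetric] sum_single_lookup)
  finally show ?thesis .
qed

section \<open>Polynomial vector fields\<close>

lemma vf_apply_superset:
  "finite A \<Longrightarrow> keys X \<subseteq> A \<Longrightarrow> vf_apply X f = (\<Sum>u\<in>A. lookup X u * partial_deriv u f)"
  unfolding vf_apply_def by (rule sum.mono_neutral_left) (auto simp: in_keys_iff)

lemma vf_apply_add: "vf_apply X (f + g) = vf_apply X f + vf_apply X g"
  by (simp add: vf_apply_def partial_deriv_add distrib_left sum.distrib)

lemma vf_apply_zero [simp]: "vf_apply X 0 = 0"
  by (simp add: vf_apply_def)

lemma vf_apply_uminus: "vf_apply X (- f) = - vf_apply X f"
  by (simp add: vf_apply_def partial_deriv_uminus sum_negf)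

lemma vf_apply_diff: "vf_apply X (f - g) = vf_apply X f - vf_apply X g"
  by (simp add: vf_apply_def partial_deriv_diff right_diff_distrib sum_subtractf)

lemma vf_apply_sum: "vf_apply X (sum f A) = (\<Sum>a\<in>A. vf_apply X (f a))"
  by (induction A rule: infinite_finite_induct) (simp_all add: vf_apply_add)

lemma vf_apply_const [simp]: "vf_apply X (single 0 c) = 0"
  by (simp add: vf_apply_def)

lemma vf_apply_mult: "vf_apply X (f * g) = vf_apply X f * g + f * vf_apply X g"
  unfolding vf_apply_def sum_distrib_left sum_distrib_right sum.distrib[symmetric]
  by (rule sum.cong) (simp_all add: partial_deriv_mult distrib_left mult_ac)

lemma vf_apply_const_mult: "vf_apply X (single 0 c * f) = single 0 c * vf_apply X f"
  by (simp add: vf_apply_mult)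

lemma vf_apply_coord: "vf_apply X (coord_poly u) = lookup X u"
proof -
  have "vf_apply X (coord_poly u) = (\<Sum>v\<in>keys X. if v = u then lookup X u else 0)"
    unfolding vf_apply_def by (rule sum.cong) (auto simp: partial_deriv_coord)
  then show ?thesis by (auto simp: in_keys_iff)
qed

lemma vf_apply_add_field: "vf_apply (X + Y) f = vf_apply X f + vf_apply Y f"
proof -
  let ?A = "keys X \<union> keys Y"
  have "vf_apply (X + Y) f = (\<Sum>u\<in>?A. lookup (X + Y) u * partial_deriv u f)"
    by (rule vf_apply_superset) (auto simp: keys_add)
  also have "\<dots> = vf_apply X f + vf_apply Y f"
    using vf_apply_superset[of ?A X f] vf_apply_superset[of ?A Y f]
    by (simp add: lookup_add distrib_right sum.distrib)
  finally show ?thesis .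
qed

lemma lookup_vf_scale: "lookup (vf_scale c X) u = single 0 c * lookup X u"
  by (auto simp: vf_scale_def Poly_Mapping.map.rep_eq when_def)

lemma vf_apply_scale_field: "vf_apply (vf_scale c X) f = single 0 c * vf_apply X f"
proof -
  have "vf_apply (vf_scale c X) f = (\<Sum>u\<in>keys X. lookup (vf_scale c X) u * partial_deriv u f)"
    by (rule vf_apply_superset) (auto simp: lookup_vf_scale in_keys_iff)
  then show ?thesis by (simp add: lookup_vf_scale vf_apply_def sum_distrib_left mult.assoc)
qed

lemma lookup_vf_bracket:
  "lookup (vf_bracket X Y) u = vf_apply X (lookup Y u) - vf_apply Y (lookup X u)"
proof -
  have "lookup (vf_bracket X Y) u = (\<Sum>v\<in>keys X \<union> keys Y.
     if v = u then vf_apply X (lookup Y u) - vf_apply Y (lookup X u) else 0)"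
    unfolding vf_bracket_def lookup_sum by (rule sum.cong) (auto simp: lookup_single when_def)
  then show ?thesis by (auto simp: in_keys_iff)
qed

text \<open>
  The bracket is the commutator of derivations; a vector field is determined by its values on the
  coordinates, so this gives the Jacobi identity.
\<close>

lemma vf_apply_bracket:
  "vf_apply (vf_bracket X Y) f = vf_apply X (vf_apply Y f) - vf_apply Y (vf_apply X f)"
proof -
  let ?A = "keys X \<union> keys Y"
  let ?s = "\<lambda>X Y. \<Sum>u\<in>?A. \<Sum>v\<in>?A. lookup X u * (lookup Y v * partial_deriv u (partial_deriv v f))"
  have K: "keys (vf_bracket X Y) \<subseteq> ?A"
    by (auto simp: in_keys_iff lookup_vf_bracket)
  have comp: "vf_apply X (vf_apply Y f) =
      (\<Sum>v\<in>?A. vf_apply X (lookup Y v) * partial_deriv v f) + ?s X Y"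
    if "keys X \<subseteq> ?A" "keys Y \<subseteq> ?A" for X Y
  proof -
    have "vf_apply X (vf_apply Y f) = (\<Sum>v\<in>?A. vf_apply X (lookup Y v * partial_deriv v f))"
      using that by (simp add: vf_apply_superset[of ?A Y f] vf_apply_sum)
    also have "\<dots> = (\<Sum>v\<in>?A. vf_apply X (lookup Y v) * partial_deriv v f)
        + (\<Sum>v\<in>?A. lookup Y v * vf_apply X (partial_deriv v f))"
      by (simp add: vf_apply_mult sum.distrib)
    also have "(\<Sum>v\<in>?A. lookup Y v * vf_apply X (partial_deriv v f)) = ?s X Y"
      by (subst sum.swap)
         (use that in \<open>simp add: vf_apply_superset[of ?A X] sum_distrib_left mult.left_commute\<close>)
    finally show ?thesis .
  qed
  have sym: "?s X Y = ?s Y X"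
    by (subst sum.swap) (simp add: mult.left_commute partial_deriv_commute[of _ _ f])
  have "vf_apply (vf_bracket X Y) f = (\<Sum>u\<in>?A. lookup (vf_bracket X Y) u * partial_deriv u f)"
    using K by (intro vf_apply_superset) auto
  also have "\<dots> = (\<Sum>v\<in>?A. vf_apply X (lookup Y v) * partial_deriv v f)
      - (\<Sum>v\<in>?A. vf_apply Y (lookup X v) * partial_deriv v f)"
    by (simp add: lookup_vf_bracket left_diff_distrib sum_subtractf)
  also have "\<dots> = vf_apply X (vf_apply Y f) - vf_apply Y (vf_apply X f)"
    using comp[of X Y] comp[of Y X] sym by simp
  finally show ?thesis .
qed

lemma vf_bracket_add_left: "vf_bracket (X + Y) Z = vf_bracket X Z + vf_bracket Y Z"
  by (rule poly_mapping_eqI) (simp add: lookup_vf_bracket lookup_add vf_apply_add vf_apply_add_field)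

lemma vf_bracket_add_right: "vf_bracket X (Y + Z) = vf_bracket X Y + vf_bracket X Z"
  by (rule poly_mapping_eqI) (simp add: lookup_vf_bracket lookup_add vf_apply_add vf_apply_add_field)

lemma vf_bracket_scale_left: "vf_bracket (vf_scale c X) Y = vf_scale c (vf_bracket X Y)"
  by (rule poly_mapping_eqI)
     (simp add: lookup_vf_bracket lookup_vf_scale vf_apply_const_mult vf_apply_scale_field right_diff_distrib)

lemma vf_bracket_scale_right: "vf_bracket X (vf_scale c Y) = vf_scale c (vf_bracket X Y)"
  by (rule poly_mapping_eqI)
     (simp add: lookup_vf_bracket lookup_vf_scale vf_apply_const_mult vf_apply_scale_field right_diff_distrib)

lemma vf_bracket_self: "vf_bracket X X = 0"
  by (rule poly_mapping_eqI) (simp add: lookup_vf_bracket)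

lemma vf_jacobi:
  "vf_bracket X (vf_bracket Y Z) + vf_bracket Y (vf_bracket Z X) + vf_bracket Z (vf_bracket X Y) = 0"
  by (rule poly_mapping_eqI)
     (simp add: lookup_vf_bracket lookup_add vf_apply_bracket vf_apply_diff)

lemma vf_derivation:
  "vf_bracket (vf_bracket X Y) Z = vf_bracket X (vf_bracket Y Z) - vf_bracket Y (vf_bracket X Z)"
  by (rule poly_mapping_eqI)
     (simp add: lookup_vf_bracket lookup_minus vf_apply_bracket vf_apply_diff)

lemma polys_vf_apply: "X \<in> vfields l \<Longrightarrow> f \<in> polys l \<Longrightarrow> vf_apply X f \<in> polys l"
  unfolding vf_apply_def vfields_def by (intro polys_sum polys_mult polys_partial_deriv) auto

lemma vf_apply_coords:
  "X \<in> vfields l \<Longrightarrow> vf_apply X f = (\<Sum>u\<in>coords l. lookup X u * partial_deriv u f)"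
  by (rule vf_apply_superset) (auto simp: vfields_def)

lemma vfieldsI:
  "(\<And>u. u \<notin> coords l \<Longrightarrow> lookup X u = 0) \<Longrightarrow> (\<And>u. u \<in> coords l \<Longrightarrow> lookup X u \<in> polys l) \<Longrightarrow> X \<in> vfields l"
  by (fastforce simp: vfields_def in_keys_iff)

lemma vfields_lookup: "X \<in> vfields l \<Longrightarrow> lookup X u \<in> polys l"
  by (simp add: vfields_def)

lemma vfields_outside: "X \<in> vfields l \<Longrightarrow> u \<notin> coords l \<Longrightarrow> lookup X u = 0"
  by (auto simp: vfields_def in_keys_iff)

lemma vfields_bracket: "X \<in> vfields l \<Longrightarrow> Y \<in> vfields l \<Longrightarrow> vf_bracket X Y \<in> vfields l"
  by (rule vfieldsI)
     (simp_all add: lookup_vf_bracket vfields_outside polys_diff polys_vf_apply vfields_lookup)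

lemma vfields_diff: "X \<in> vfields l \<Longrightarrow> Y \<in> vfields l \<Longrightarrow> X - Y \<in> vfields l"
  by (rule vfieldsI) (simp_all add: lookup_minus vfields_outside polys_diff vfields_lookup)

lemma vector_space_vf_scale: "vector_space vf_scale"
proof
  show "vf_scale a (x + y) = vf_scale a x + vf_scale a y" for a x y
    by (rule poly_mapping_eqI) (simp add: lookup_vf_scale lookup_add distrib_left)
  show "vf_scale (a + b) x = vf_scale a x + vf_scale b x" for a b x
    by (rule poly_mapping_eqI) (simp add: lookup_vf_scale lookup_add single_add distrib_right)
  show "vf_scale a (vf_scale b x) = vf_scale (a * b) x" for a b x
    by (rule poly_mapping_eqI) (simp add: lookup_vf_scale mult.assoc[symmetric] mult_single)
  show "vf_scale 1 x = x" for x
    by (rule poly_mapping_eqI) (simp add: lookup_vf_scale)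
qed

section \<open>Contact vector fields and their generating functions\<close>

lemma contact_form_add: "contact_form l (X + Y) = contact_form l X + contact_form l Y"
  by (simp add: contact_form_def lookup_add distrib_left sum.distrib)

lemma contact_form_diff: "contact_form l (X - Y) = contact_form l X - contact_form l Y"
  by (simp add: contact_form_def lookup_minus right_diff_distrib sum_subtractf)

lemma contact_form_scale: "contact_form l (vf_scale c X) = single 0 c * contact_form l X"
  by (simp add: contact_form_def lookup_vf_scale right_diff_distrib sum_distrib_left mult.left_commute)

lemma contact_form_polys: "X \<in> vfields l \<Longrightarrow> contact_form l X \<in> polys l"
  unfolding contact_form_def
  by (intro polys_diff polys_sum polys_mult polys_coord) (auto simp: vfields_lookup)

text \<open>
  With \<open>\<alpha> = dz - \<Sum> y\<^sub>i dx\<^sub>i\<close>, this is the solution \<open>X\<close> of \<open>\<alpha>(X) = f\<close> and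
  \<open>L\<^sub>X \<alpha> = (\<partial>\<^sub>z f) \<alpha>\<close>.
\<close>

definition ham :: "nat \<Rightarrow> cpoly \<Rightarrow> vfield" where
  "ham l f = (\<Sum>i<l. single (Xc i) (- partial_deriv (Yc i) f))
     + (\<Sum>i<l. single (Yc i) (partial_deriv (Xc i) f + coord_poly (Yc i) * partial_deriv Zc f))
     + single Zc (f - (\<Sum>i<l. coord_poly (Yc i) * partial_deriv (Yc i) f))"

lemma lookup_ham:
  "lookup (ham l f) (Xc i) = (if i < l then - partial_deriv (Yc i) f else 0)"
  "lookup (ham l f) (Yc i) =
     (if i < l then partial_deriv (Xc i) f + coord_poly (Yc i) * partial_deriv Zc f else 0)"
  "lookup (ham l f) Zc = f - (\<Sum>i<l. coord_poly (Yc i) * partial_deriv (Yc i) f)"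
  unfolding ham_def lookup_add lookup_sum by (simp_all add: lookup_single when_def)

lemma ham_vfields: "f \<in> polys l \<Longrightarrow> ham l f \<in> vfields l"
proof (rule vfieldsI)
  fix u assume f: "f \<in> polys l" and "u \<in> coords l"
  then show "lookup (ham l f) u \<in> polys l"
    by (cases u) (auto simp: lookup_ham intro!: polys_intros)
next
  fix u assume "u \<notin> coords l"
  then show "lookup (ham l f) u = 0"
    by (cases u) (auto simp: lookup_ham)
qed

lemma contact_form_ham [simp]: "contact_form l (ham l f) = f"
  by (simp add: contact_form_def lookup_ham sum_negf)

lemma ham_add: "ham l (f + g) = ham l f + ham l g"
proof (rule poly_mapping_eqI)
  fix u show "lookup (ham l (f + g)) u = lookup (ham l f + ham l g) u"
    by (cases u) (simp_all add: lookup_ham lookup_add partial_deriv_add distrib_left sum.distrib)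
qed

lemma ham_scale: "ham l (single 0 c * f) = vf_scale c (ham l f)"
proof (rule poly_mapping_eqI)
  fix u show "lookup (ham l (single 0 c * f)) u = lookup (vf_scale c (ham l f)) u"
    by (cases u) (simp_all add: lookup_ham lookup_vf_scale partial_deriv_const_mult
      distrib_left right_diff_distrib sum_distrib_left mult.left_commute)
qed

lemma ham_zero [simp]: "ham l 0 = 0"
  by (simp add: ham_def)

lemma ham_sum: "ham l (sum f A) = (\<Sum>a\<in>A. ham l (f a))"
  by (induction A rule: infinite_finite_induct) (simp_all add: ham_add)

lemma contact_form_bracket:
  "contact_form l (vf_bracket X Y) =
     vf_apply X (lookup Y Zc) - vf_apply Y (lookup X Zc)
     - (\<Sum>j<l. coord_poly (Yc j) * (vf_apply X (lookup Y (Xc j)) - vf_apply Y (lookup X (Xc j))))"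
  by (simp add: contact_form_def lookup_vf_bracket)

text \<open>
  This is the identity \<open>L\<^sub>X \<alpha> = (\<partial>\<^sub>z f) \<alpha>\<close>, evaluated on fields \<open>Y\<close> in the kernel of
  \<open>\<alpha>\<close>: there it reads \<open>\<alpha>([X, Y]) = 0\<close>.
\<close>

lemma ham_contact:
  assumes f: "f \<in> polys l"
  shows "ham l f \<in> contact_fields l"
proof -
  have "vf_bracket (ham l f) Y \<in> contact_distribution l" if Y: "Y \<in> contact_distribution l" for Y
  proof -
    let ?X = "ham l f" and ?y = "\<lambda>j. coord_poly (Yc j)"
    from Y have Yv: "Y \<in> vfields l" and Z: "lookup Y Zc = (\<Sum>j<l. ?y j * lookup Y (Xc j))"
      by (auto simp: contact_distribution_def contact_form_def)
    have 1: "vf_apply ?X (lookup Y Zc) = (\<Sum>j<l. lookup ?X (Yc j) * lookup Y (Xc j))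
        + (\<Sum>j<l. ?y j * vf_apply ?X (lookup Y (Xc j)))"
      by (simp add: Z vf_apply_sum vf_apply_mult vf_apply_coord sum.distrib)
    have 2: "vf_apply Y (lookup ?X Zc) = vf_apply Y f
        - (\<Sum>j<l. lookup Y (Yc j) * partial_deriv (Yc j) f)
        + (\<Sum>j<l. ?y j * vf_apply Y (lookup ?X (Xc j)))"
      by (simp add: lookup_ham vf_apply_diff vf_apply_sum vf_apply_mult vf_apply_coord
          vf_apply_uminus sum.distrib sum_negf)
    have 3: "vf_apply Y f = (\<Sum>j<l. lookup Y (Xc j) * partial_deriv (Xc j) f)
        + (\<Sum>j<l. lookup Y (Yc j) * partial_deriv (Yc j) f)
        + (\<Sum>j<l. ?y j * lookup Y (Xc j)) * partial_deriv Zc f"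
      by (simp add: vf_apply_coords[OF Yv] sum_coords Z)
    have 4: "(\<Sum>j<l. lookup ?X (Yc j) * lookup Y (Xc j)) =
        (\<Sum>j<l. lookup Y (Xc j) * partial_deriv (Xc j) f)
        + (\<Sum>j<l. ?y j * lookup Y (Xc j)) * partial_deriv Zc f"
      unfolding sum_distrib_right sum.distrib[symmetric]
      by (rule sum.cong) (simp_all add: lookup_ham algebra_simps)
    have "contact_form l (vf_bracket ?X Y) = 0"
      unfolding contact_form_bracket right_diff_distrib sum_subtractf 1 2 3 4 by simp
    with Yv f show ?thesis
      by (simp add: contact_distribution_def vfields_bracket ham_vfields)
  qed
  with f show ?thesis by (simp add: contact_fields_def ham_vfields)
qed

text \<open>
  Testing against the two families \<open>\<partial>\<^sub>y\<close> and \<open>\<partial>\<^sub>x + y\<partial>\<^sub>z\<close> of sections of the contact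
  distribution recovers all components of a contact field from the value of the contact form on it.
\<close>

lemma contact_field_eq_ham:
  assumes X: "X \<in> contact_fields l"
  shows "X = ham l (contact_form l X)"
proof -
  from X have Xv: "X \<in> vfields l"
    and inv: "\<And>Y. Y \<in> contact_distribution l \<Longrightarrow> contact_form l (vf_bracket X Y) = 0"
    by (auto simp: contact_fields_def contact_distribution_def)
  let ?f = "contact_form l X" and ?y = "\<lambda>j. coord_poly (Yc j)"
  have A: "lookup X (Xc i) = - partial_deriv (Yc i) ?f" if i: "i < l" for i
  proof -
    let ?Y = "single (Yc i) 1 :: vfield"
    have Y: "?Y \<in> contact_distribution l"
      using i by (auto simp: contact_distribution_def contact_form_def lookup_single when_def
        intro!: vfieldsI)
    have ap: "vf_apply ?Y g = partial_deriv (Yc i) g" for g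
      by (simp add: vf_apply_def)
    have "(\<Sum>j<l. partial_deriv (Yc i) (?y j) * lookup X (Xc j)) = (\<Sum>j<l. if i = j then lookup X (Xc j) else 0)"
      by (rule sum.cong) (simp_all add: partial_deriv_coord)
    then have "(\<Sum>j<l. partial_deriv (Yc i) (?y j) * lookup X (Xc j)) = lookup X (Xc i)"
      using i by simp
    moreover have "vf_apply X (lookup ?Y u) = 0" for u
      by (cases "u = Yc i") (simp_all add: lookup_single vf_apply_def)
    ultimately show ?thesis
      using inv[OF Y, unfolded contact_form_bracket ap]
      by (simp add: contact_form_def partial_deriv_diff partial_deriv_sum
          partial_deriv_mult sum.distrib sum_negf algebra_simps)
  qed
  have B: "lookup X (Yc i) = partial_deriv (Xc i) ?f + ?y i * partial_deriv Zc ?f" if i: "i < l" for i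
  proof -
    let ?Y = "single (Xc i) 1 + single Zc (?y i) :: vfield"
    let ?D = "\<lambda>g. partial_deriv (Xc i) g + ?y i * partial_deriv Zc g"
    have Y: "?Y \<in> contact_distribution l"
    proof -
      have "(\<Sum>j<l. ?y j * lookup ?Y (Xc j)) = (\<Sum>j<l. if j = i then ?y i else 0)"
        by (rule sum.cong) (auto simp: lookup_add lookup_single)
      then show ?thesis using i
        by (auto simp: contact_distribution_def contact_form_def lookup_add lookup_single when_def
          intro!: vfieldsI polys_intros)
    qed
    have ap: "vf_apply ?Y g = ?D g" for g
      by (simp add: vf_apply_add_field) (simp add: vf_apply_def)
    have D: "?D (?y j * g) = ?y j * ?D g" for j g
      by (simp add: partial_deriv_mult partial_deriv_coord algebra_simps)
    have D_sum: "?D (sum g A) = (\<Sum>a\<in>A. ?D (g a))" for g :: "nat \<Rightarrow> cpoly" and A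
      by (simp add: partial_deriv_sum sum.distrib sum_distrib_left)
    have XY: "vf_apply X (lookup ?Y (Xc j)) = 0" "vf_apply X (lookup ?Y Zc) = lookup X (Yc i)" for j
      by (simp_all add: lookup_add lookup_single vf_apply_coord when_def) (simp_all add: vf_apply_def)
    have "?D ?f = ?D (lookup X Zc) - (\<Sum>j<l. ?D (?y j * lookup X (Xc j)))"
      unfolding contact_form_def D_sum[symmetric]
      by (simp add: partial_deriv_diff algebra_simps)
    then have "?D ?f = ?D (lookup X Zc) - (\<Sum>j<l. ?y j * ?D (lookup X (Xc j)))"
      unfolding D .
    moreover have "contact_form l (vf_bracket X ?Y)
       = lookup X (Yc i) - ?D (lookup X Zc) + (\<Sum>j<l. ?y j * ?D (lookup X (Xc j)))"
      unfolding contact_form_bracket XY ap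
      by (simp add: right_diff_distrib distrib_left sum_subtractf sum.distrib sum_negf)
    ultimately show ?thesis using inv[OF Y] by (simp add: algebra_simps)
  qed
  show ?thesis
  proof (rule poly_mapping_eqI)
    fix u
    show "lookup X u = lookup (ham l ?f) u"
    proof (cases u)
      case (Xc i)
      then show ?thesis using A vfields_outside[OF Xv] by (simp add: lookup_ham)
    next
      case (Yc i)
      then show ?thesis using B vfields_outside[OF Xv] by (simp add: lookup_ham)
    next
      case Zc
      have "lookup X Zc = ?f + (\<Sum>j<l. ?y j * lookup X (Xc j))" by (simp add: contact_form_def)
      then show ?thesis using A Zc by (simp add: lookup_ham sum_negf)
    qed
  qed
qed

lemma contact_fields_eq: "contact_fields l = ham l ` polys l"
proof
  show "contact_fields l \<subseteq> ham l ` polys l"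
  proof
    fix X assume X: "X \<in> contact_fields l"
    then have "contact_form l X \<in> polys l" by (simp add: contact_fields_def contact_form_polys)
    with contact_field_eq_ham[OF X] show "X \<in> ham l ` polys l" by blast
  qed
qed (auto intro: ham_contact)

lemma ham_eq_iff [simp]: "ham l f = ham l g \<longleftrightarrow> f = g"
  by (metis contact_form_ham)

lemma ham_eq_0_iff [simp]: "ham l f = 0 \<longleftrightarrow> f = 0"
  using ham_eq_iff[of l f 0] by (simp del: ham_eq_iff)

text \<open>
  By the Jacobi identity the fields whose bracket preserves a given space of fields form a Lie algebra.
\<close>

lemma contact_fields_bracket:
  assumes X: "X \<in> contact_fields l" and Y: "Y \<in> contact_fields l"
  shows "vf_bracket X Y \<in> contact_fields l"
proof -
  have "vf_bracket (vf_bracket X Y) Z \<in> contact_distribution l" if "Z \<in> contact_distribution l" for Z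
    unfolding vf_derivation using X Y that
    by (auto simp: contact_fields_def contact_distribution_def contact_form_diff vfields_diff)
  with X Y show ?thesis by (auto simp: contact_fields_def vfields_bracket)
qed

text \<open>
  The bracket of generating functions; \<open>lagrange_alt\<close> is its classical formula.
\<close>

definition lagrange :: "nat \<Rightarrow> cpoly \<Rightarrow> cpoly \<Rightarrow> cpoly" where
  "lagrange l f g = contact_form l (vf_bracket (ham l f) (ham l g))"

lemma bracket_ham:
  "f \<in> polys l \<Longrightarrow> g \<in> polys l \<Longrightarrow> vf_bracket (ham l f) (ham l g) = ham l (lagrange l f g)"
  unfolding lagrange_def by (rule contact_field_eq_ham) (intro contact_fields_bracket ham_contact)

lemma lagrange_polys: "f \<in> polys l \<Longrightarrow> g \<in> polys l \<Longrightarrow> lagrange l f g \<in> polys l"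
  unfolding lagrange_def by (intro contact_form_polys vfields_bracket ham_vfields)

lemma lagrange_alt:
  assumes f: "f \<in> polys l" and g: "g \<in> polys l"
  shows "lagrange l f g = vf_apply (ham l f) g - g * partial_deriv Zc f"
proof -
  let ?y = "\<lambda>j. coord_poly (Yc j)"
  have ap: "vf_apply (ham l g) f = (\<Sum>j<l. - (partial_deriv (Yc j) g * partial_deriv (Xc j) f))
     + (\<Sum>j<l. (partial_deriv (Xc j) g + ?y j * partial_deriv Zc g) * partial_deriv (Yc j) f)
     + (g - (\<Sum>j<l. ?y j * partial_deriv (Yc j) g)) * partial_deriv Zc f"
    if "g \<in> polys l" for f g :: cpoly
    by (simp add: vf_apply_coords[OF ham_vfields[OF that]] sum_coords lookup_ham)
  have c: "vf_apply (ham l f) (lookup (ham l g) Zc) = vf_apply (ham l f) g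
     - (\<Sum>j<l. lookup (ham l f) (Yc j) * partial_deriv (Yc j) g)
     + (\<Sum>j<l. ?y j * vf_apply (ham l f) (lookup (ham l g) (Xc j)))" for f g
    by (simp add: lookup_ham vf_apply_diff vf_apply_sum vf_apply_mult vf_apply_coord
        vf_apply_uminus sum.distrib sum_negf)
  have b: "(\<Sum>j<l. lookup (ham l f) (Yc j) * partial_deriv (Yc j) g)
     = (\<Sum>j<l. (partial_deriv (Xc j) f + ?y j * partial_deriv Zc f) * partial_deriv (Yc j) g)" for f g
    by (simp add: lookup_ham)
  show ?thesis
    unfolding lagrange_def contact_form_bracket c b right_diff_distrib sum_subtractf ap[OF f] ap[OF g]
    by (simp add: algebra_simps sum.distrib sum_negf sum_distrib_left)
qed

section \<open>Graded Lie algebras\<close>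

context graded_lie_algebra
begin

lemma piece_carrier: "x \<in> piece G p \<Longrightarrow> x \<in> carrier G"
proof -
  assume x: "x \<in> piece G p"
  have "\<exists>J y. x = (\<Sum>i\<in>J. y i) \<and> finite J \<and> J \<subseteq> UNIV \<and> (\<forall>i\<in>J. y i \<in> piece G i)"
    by (rule exI[of _ "{p}"], rule exI[of _ "\<lambda>_. x"]) (use x in auto)
  with piece_direct_sum show ?thesis unfolding direct_sum_of_def by blast
qed

lemmas carrier_closed = subspace_0[OF carrier_subspace] subspace_add[OF carrier_subspace]
  subspace_diff[OF carrier_subspace] subspace_scale[OF carrier_subspace]
  subspace_neg[OF carrier_subspace] subspace_sum[OF carrier_subspace] bracket_closed

lemmas piece_closed = subspace_0[OF piece_subspace] subspace_add[OF piece_subspace]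
  subspace_diff[OF piece_subspace] subspace_scale[OF piece_subspace]
  subspace_neg[OF piece_subspace] subspace_sum[OF piece_subspace]

lemma bracket_zero_left: "x \<in> carrier G \<Longrightarrow> bracket G 0 x = 0"
  using bracket_add_left[of 0 0 x] carrier_closed(1) by simp

lemma bracket_zero_right: "x \<in> carrier G \<Longrightarrow> bracket G x 0 = 0"
  using bracket_add_right[of x 0 0] carrier_closed(1) by simp

lemma bracket_anti: "x \<in> carrier G \<Longrightarrow> y \<in> carrier G \<Longrightarrow> bracket G x y = - bracket G y x"
  using bracket_self[of "x + y"] bracket_self[of x] bracket_self[of y] carrier_closed(2)[of x y]
  by (simp add: bracket_add_left bracket_add_right eq_neg_iff_add_eq_0 add.commute)

lemma bracket_uminus_right: "x \<in> carrier G \<Longrightarrow> y \<in> carrier G \<Longrightarrow> bracket G x (- y) = - bracket G x y"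
  using bracket_add_right[of x y "- y"]
  by (simp add: carrier_closed bracket_zero_right eq_neg_iff_add_eq_0 add.commute)

lemma bracket_sum_left:
  "(\<And>a. a \<in> A \<Longrightarrow> f a \<in> carrier G) \<Longrightarrow> y \<in> carrier G \<Longrightarrow>
    bracket G (sum f A) y = (\<Sum>a\<in>A. bracket G (f a) y)"
  by (induction A rule: infinite_finite_induct)
     (simp_all add: bracket_zero_left bracket_add_left carrier_closed)

lemma bracket_sum_right:
  "(\<And>a. a \<in> A \<Longrightarrow> f a \<in> carrier G) \<Longrightarrow> y \<in> carrier G \<Longrightarrow>
    bracket G y (sum f A) = (\<Sum>a\<in>A. bracket G y (f a))"
  by (induction A rule: infinite_finite_induct)
     (simp_all add: bracket_zero_right bracket_add_right carrier_closed)

lemma bracket_derivation: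
  assumes "x \<in> carrier G" "y \<in> carrier G" "z \<in> carrier G"
  shows "bracket G x (bracket G y z) = bracket G (bracket G x y) z + bracket G y (bracket G x z)"
proof -
  have "bracket G y (bracket G z x) = - bracket G y (bracket G x z)"
    using assms bracket_anti[of z x] by (simp add: bracket_uminus_right carrier_closed)
  moreover have "bracket G z (bracket G x y) = - bracket G (bracket G x y) z"
    using assms bracket_anti[of z "bracket G x y"] by (simp add: carrier_closed)
  ultimately show ?thesis using jacobi[OF assms] by (simp add: algebra_simps)
qed

lemma bracket_piece: "x \<in> piece G i \<Longrightarrow> y \<in> piece G j \<Longrightarrow> k = i + j \<Longrightarrow> bracket G x y \<in> piece G k"
  using piece_bracket by simp

lemma pieces_independent:
  assumes "finite J" "\<And>p. p \<in> J \<Longrightarrow> x p \<in> piece G p" "(\<Sum>p\<in>J. x p) = 0" "p \<in> J"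
  shows "x p = 0"
  using piece_direct_sum assms unfolding direct_sum_of_def by blast

end

text \<open>
  A decomposition is a function on all degrees with finite support. This makes it unique, and the family of
  homogeneous components becomes a function of the element.
\<close>

definition is_decomp :: "'a::ab_group_add graded_lie \<Rightarrow> 'a \<Rightarrow> (int \<Rightarrow> 'a) \<Rightarrow> bool" where
  "is_decomp G x c \<longleftrightarrow> finite {p. c p \<noteq> 0} \<and> (\<forall>p. c p \<in> piece G p) \<and> x = (\<Sum>p | c p \<noteq> 0. c p)"

definition component :: "'a::ab_group_add graded_lie \<Rightarrow> 'a \<Rightarrow> int \<Rightarrow> 'a" where
  "component G x = (SOME c. is_decomp G x c)"

lemma sum_support: "finite J \<Longrightarrow> {p. c p \<noteq> 0} \<subseteq> J \<Longrightarrow> (\<Sum>p\<in>J. c p) = (\<Sum>p | c p \<noteq> 0. c p)"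
  by (rule sum.mono_neutral_right) auto

context graded_lie_algebra
begin

lemma is_decompI:
  assumes "finite J" "\<And>p. p \<in> J \<Longrightarrow> x p \<in> piece G p"
  shows "is_decomp G (\<Sum>p\<in>J. x p) (\<lambda>p. if p \<in> J then x p else 0)"
proof -
  let ?c = "\<lambda>p. if p \<in> J then x p else 0"
  have "{p. ?c p \<noteq> 0} \<subseteq> J" by auto
  moreover have "(\<Sum>p\<in>J. x p) = (\<Sum>p\<in>J. ?c p)" by (rule sum.cong) auto
  ultimately show ?thesis
    using assms sum_support[of J ?c] finite_subset[of "{p. ?c p \<noteq> 0}" J]
    by (auto simp: is_decomp_def piece_closed)
qed

lemma is_decomp_unique:
  assumes c: "is_decomp G x c" and d: "is_decomp G x d"
  shows "c = d"
proof
  fix p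
  let ?J = "insert p ({p. c p \<noteq> 0} \<union> {p. d p \<noteq> 0})"
  have fin: "finite ?J" using c d by (simp add: is_decomp_def)
  have "(\<Sum>p\<in>?J. c p) = x" "(\<Sum>p\<in>?J. d p) = x"
    using sum_support[OF fin, of c] sum_support[OF fin, of d] c d unfolding is_decomp_def by auto
  then have "(\<Sum>p\<in>?J. c p - d p) = 0" by (simp add: sum_subtractf)
  moreover have "\<And>p. c p - d p \<in> piece G p" using c d by (simp add: is_decomp_def piece_closed)
  ultimately have "c p - d p = 0" using pieces_independent[OF fin, of "\<lambda>p. c p - d p" p] by simp
  then show "c p = d p" by simp
qed

lemma is_decomp_component: "x \<in> carrier G \<Longrightarrow> is_decomp G x (component G x)"
proof -
  assume "x \<in> carrier G"
  then obtain J y where "x = (\<Sum>p\<in>J. y p)" "finite J" "\<forall>p\<in>J. y p \<in> piece G p"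
    using piece_direct_sum unfolding direct_sum_of_def by blast
  then have "\<exists>c. is_decomp G x c" using is_decompI[of J y] by blast
  then show ?thesis unfolding component_def by (rule someI_ex)
qed

lemma component_eqI: "x \<in> carrier G \<Longrightarrow> is_decomp G x c \<Longrightarrow> component G x = c"
  using is_decomp_unique is_decomp_component by blast

lemma component_piece: "x \<in> carrier G \<Longrightarrow> component G x p \<in> piece G p"
  using is_decomp_component by (simp add: is_decomp_def)

lemma finite_component: "x \<in> carrier G \<Longrightarrow> finite {p. component G x p \<noteq> 0}"
  using is_decomp_component by (simp add: is_decomp_def)

lemma sum_component:
  "x \<in> carrier G \<Longrightarrow> finite J \<Longrightarrow> {p. component G x p \<noteq> 0} \<subseteq> J \<Longrightarrow> (\<Sum>p\<in>J. component G x p) = x"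
  using sum_support[of J "component G x"] is_decomp_component[of x] by (simp add: is_decomp_def)

lemma component_of_piece:
  assumes "x \<in> piece G p"
  shows "component G x = (\<lambda>r. if r = p then x else 0)"
  using component_eqI[OF piece_carrier[OF assms]] is_decompI[of "{p}" "\<lambda>_. x"] assms by simp

lemma component_zero [simp]: "component G 0 p = 0"
  using component_of_piece[OF piece_closed(1)[of 0]] by simp

lemma is_decompI':
  assumes "finite J" "\<And>p. c p \<in> piece G p" "\<And>p. p \<notin> J \<Longrightarrow> c p = 0" "x = (\<Sum>p\<in>J. c p)"
  shows "is_decomp G x c"
proof -
  have "(\<lambda>p. if p \<in> J then c p else 0) = c" using assms(3) by auto
  with is_decompI[of J c] assms show ?thesis by simp
qed

lemma component_add:
  assumes x: "x \<in> carrier G" and y: "y \<in> carrier G"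
  shows "component G (x + y) p = component G x p + component G y p"
proof -
  let ?J = "{p. component G x p \<noteq> 0} \<union> {p. component G y p \<noteq> 0}"
  have fin: "finite ?J" using assms finite_component by simp
  have "is_decomp G (x + y) (\<lambda>p. component G x p + component G y p)"
    by (rule is_decompI'[OF fin])
       (use assms sum_component[OF x fin] sum_component[OF y fin] in
        \<open>auto simp: sum.distrib piece_closed component_piece\<close>)
  then show ?thesis using component_eqI[of "x + y"] assms carrier_closed by simp
qed

lemma component_scale:
  assumes x: "x \<in> carrier G"
  shows "component G (scal G a x) p = scal G a (component G x p)"
proof -
  let ?J = "{p. component G x p \<noteq> 0}"
  have "is_decomp G (scal G a x) (\<lambda>p. scal G a (component G x p))"
    by (rule is_decompI'[OF finite_component[OF x]])
       (use assms sum_component[OF x finite_component[OF x]] in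
        \<open>auto simp: scale_sum_right[symmetric] piece_closed component_piece\<close>)
  then show ?thesis using component_eqI[of "scal G a x"] assms carrier_closed by simp
qed

lemma negative_part_carrier:
  "carrier (negative_part G) = {x \<in> carrier G. \<forall>p\<ge>0. component G x p = 0}"
proof
  show "carrier (negative_part G) \<subseteq> {x \<in> carrier G. \<forall>p\<ge>0. component G x p = 0}"
  proof
    fix x assume "x \<in> carrier (negative_part G)"
    then obtain J y where x: "x = (\<Sum>p\<in>J. y p)" "finite J" "J \<subseteq> {..<0}" "\<forall>p\<in>J. y p \<in> piece G p"
      unfolding negative_part_def by auto
    have c: "x \<in> carrier G" unfolding x(1) by (rule carrier_closed(6)) (use x in \<open>auto intro: piece_carrier\<close>)
    from x have "component G x = (\<lambda>p. if p \<in> J then y p else 0)"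
      using component_eqI[OF c] is_decompI[of J y] by simp
    with x c show "x \<in> {x \<in> carrier G. \<forall>p\<ge>0. component G x p = 0}" by auto
  qed
next
  show "{x \<in> carrier G. \<forall>p\<ge>0. component G x p = 0} \<subseteq> carrier (negative_part G)"
  proof clarify
    fix x assume x: "x \<in> carrier G" "\<forall>p\<ge>0. component G x p = 0"
    let ?J = "{p. component G x p \<noteq> 0}"
    have "x = (\<Sum>p\<in>?J. component G x p)" "finite ?J" "?J \<subseteq> {..<0}" "\<forall>p\<in>?J. component G x p \<in> piece G p"
      using x sum_component[of x ?J] finite_component[of x] component_piece by (auto simp: not_less[symmetric])
    then show "x \<in> carrier (negative_part G)" unfolding negative_part_def by simp blast
  qed
qed

lemma negative_part_simps:
  "scal (negative_part G) = scal G" "bracket (negative_part G) = bracket G"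
  "piece (negative_part G) p = (if p < 0 then piece G p else {0})"
  by (simp_all add: negative_part_def)

lemma negative_part_graded_lie: "graded_lie_algebra (negative_part G)"
proof -
  let ?N = "negative_part G"
  interpret N: vector_space "scal ?N" unfolding negative_part_simps by (rule vector_space_axioms)
  have sub: "subspace (carrier ?N)"
    unfolding negative_part_carrier
    by (rule subspaceI) (auto simp: carrier_closed component_add component_scale)
  have inc: "x \<in> carrier ?N \<Longrightarrow> x \<in> carrier G" for x by (simp add: negative_part_carrier)
  have piece_neg: "x \<in> carrier ?N" if "x \<in> piece G p" "p < 0" for x p
    using that piece_carrier by (auto simp: negative_part_carrier component_of_piece)
  show ?thesis
  proof (intro graded_lie_algebra.intro graded_lie_algebra_axioms.intro)
    show "vector_space (scal ?N)" by (rule N.vector_space_axioms)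
    show "N.subspace (carrier ?N)" using sub by (simp add: negative_part_simps)
    show "N.subspace (piece ?N i)" for i
      by (simp add: negative_part_simps piece_subspace)
    show "bracket ?N x y \<in> carrier ?N" if xy: "x \<in> carrier ?N" "y \<in> carrier ?N" for x y
    proof -
      let ?I = "{p. component G x p \<noteq> 0}" and ?J = "{p. component G y p \<noteq> 0}"
      have x: "x = (\<Sum>p\<in>?I. component G x p)" and y: "y = (\<Sum>p\<in>?J. component G y p)"
        using sum_component[of x ?I] sum_component[of y ?J] xy finite_component inc by auto
      have c: "component G x p \<in> carrier G" "component G y p \<in> carrier G" for p
        by (rule piece_carrier[OF component_piece[OF inc[OF xy(1)]]],
            rule piece_carrier[OF component_piece[OF inc[OF xy(2)]]])
      have "bracket G x y = bracket G (\<Sum>p\<in>?I. component G x p) (\<Sum>p\<in>?J. component G y p)"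
        using x y by simp
      also have "\<dots> = (\<Sum>p\<in>?I. \<Sum>r\<in>?J. bracket G (component G x p) (component G y r))"
        by (simp add: bracket_sum_left bracket_sum_right c carrier_closed) (rule sum.swap)
      also have "\<dots> \<in> carrier ?N"
      proof (intro subspace_sum[OF sub])
        fix p r assume "p \<in> ?I" "r \<in> ?J"
        then have "p < 0" "r < 0" using xy by (auto simp: negative_part_carrier not_less[symmetric])
        then show "bracket G (component G x p) (component G y r) \<in> carrier ?N"
          using piece_neg[of _ "p + r"] piece_bracket component_piece xy inc by simp
      qed
      finally show ?thesis by (simp add: negative_part_simps)
    qed
    show "direct_sum_of UNIV (piece ?N) (carrier ?N)"
      unfolding direct_sum_of_def
    proof (intro conjI allI impI ballI subset_antisym subsetI)
      fix x assume x: "x \<in> carrier ?N"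
      let ?I = "{p. component G x p \<noteq> 0}"
      have "x = (\<Sum>p\<in>?I. component G x p) \<and> finite ?I \<and> ?I \<subseteq> UNIV \<and> (\<forall>p\<in>?I. component G x p \<in> piece ?N p)"
        using x inc[OF x] sum_component[of x ?I] finite_component component_piece
        by (auto simp: negative_part_simps negative_part_carrier)
      then show "x \<in> {\<Sum>i\<in>J. y i |J y. finite J \<and> J \<subseteq> UNIV \<and> (\<forall>i\<in>J. y i \<in> piece ?N i)}" by blast
    next
      fix x assume "x \<in> {\<Sum>i\<in>J. y i |J y. finite J \<and> J \<subseteq> UNIV \<and> (\<forall>i\<in>J. y i \<in> piece ?N i)}"
      then obtain J y where x: "x = (\<Sum>i\<in>J. y i)" and y: "\<forall>i\<in>J. y i \<in> piece ?N i" by blast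
      have "y i \<in> carrier ?N" if "i \<in> J" for i
        using y that piece_neg[of "y i" i] subspace_0[OF sub] by (auto simp: negative_part_simps split: if_splits)
      then show "x \<in> carrier ?N" unfolding x by (rule subspace_sum[OF sub])
    next
      fix J x i assume "finite J \<and> J \<subseteq> UNIV \<and> (\<forall>i\<in>J. x i \<in> piece ?N i) \<and> (\<Sum>i\<in>J. x i) = 0" "i \<in> J"
      then show "x i = 0"
        using pieces_independent[of J x i] piece_closed(1)
        by (fastforce simp: negative_part_simps split: if_splits)
    qed
    show "bracket ?N x y \<in> piece ?N (i + j)" if xy: "x \<in> piece ?N i" "y \<in> piece ?N j" for x y i j
    proof (cases "i < 0 \<and> j < 0")
      case True
      with xy show ?thesis by (simp add: negative_part_simps piece_bracket)
    next
      case False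
      with xy have "bracket G x y = 0"
        using bracket_zero_left bracket_zero_right piece_carrier piece_closed(1)
        by (auto simp: negative_part_simps split: if_splits)
      then show ?thesis by (simp add: negative_part_simps piece_closed)
    qed
  qed (auto simp: negative_part_simps inc bracket_add_left bracket_add_right bracket_scale_left
       bracket_scale_right bracket_self jacobi)
qed

end

subsection \<open>Direct sums\<close>

lemma lie_direct_sum_simps:
  "carrier (lie_direct_sum G H) = carrier G \<times> carrier H"
  "scal (lie_direct_sum G H) c x = (scal G c (fst x), scal H c (snd x))"
  "bracket (lie_direct_sum G H) x y = (bracket G (fst x) (fst y), bracket H (snd x) (snd y))"
  "piece (lie_direct_sum G H) p = piece G p \<times> piece H p"
  by (simp_all add: lie_direct_sum_def case_prod_unfold)

lemma lie_direct_sum_graded_lie: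
  assumes "graded_lie_algebra G" "graded_lie_algebra H"
  shows "graded_lie_algebra (lie_direct_sum G H)"
proof -
  interpret G: graded_lie_algebra G by fact
  interpret H: graded_lie_algebra H by fact
  let ?S = "lie_direct_sum G H"
  interpret S: vector_space "scal ?S"
    by unfold_locales (simp_all add: lie_direct_sum_simps G.scale_right_distrib G.scale_left_distrib
        H.scale_right_distrib H.scale_left_distrib)
  have sub: "S.subspace (A \<times> B)" if "G.subspace A" "H.subspace B" for A B
    by (rule S.subspaceI) (use that in \<open>auto simp: zero_prod_def lie_direct_sum_simps
      G.subspace_0 H.subspace_0 G.subspace_add H.subspace_add G.subspace_scale H.subspace_scale\<close>)
  show ?thesis
  proof (intro graded_lie_algebra.intro graded_lie_algebra_axioms.intro)
    show "vector_space (scal ?S)" by (rule S.vector_space_axioms)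
    show "S.subspace (carrier ?S)"
      using sub G.carrier_subspace H.carrier_subspace by (simp add: lie_direct_sum_simps)
    show "S.subspace (piece ?S i)" for i
      using sub G.piece_subspace H.piece_subspace by (simp add: lie_direct_sum_simps)
    show "direct_sum_of UNIV (piece ?S) (carrier ?S)"
      unfolding direct_sum_of_def
    proof (intro conjI allI impI ballI subset_antisym subsetI)
      fix x assume x: "x \<in> carrier ?S"
      obtain a b where ab: "x = (a, b)" by fastforce
      then have a: "a \<in> carrier G" and b: "b \<in> carrier H" using x by (auto simp: lie_direct_sum_simps)
      let ?J = "{p. component G a p \<noteq> 0} \<union> {p. component H b p \<noteq> 0}"
      let ?y = "\<lambda>p. (component G a p, component H b p)"
      have "finite ?J" using a b G.finite_component H.finite_component by simp
      moreover from this have "x = (\<Sum>p\<in>?J. ?y p)"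
        using G.sum_component[OF a, of ?J] H.sum_component[OF b, of ?J] ab
        by (auto simp: prod_eq_iff fst_sum snd_sum)
      ultimately have "x = (\<Sum>p\<in>?J. ?y p) \<and> finite ?J \<and> ?J \<subseteq> UNIV \<and> (\<forall>p\<in>?J. ?y p \<in> piece ?S p)"
        using a b by (auto simp: lie_direct_sum_simps G.component_piece H.component_piece)
      then show "x \<in> {\<Sum>i\<in>J. y i |J y. finite J \<and> J \<subseteq> UNIV \<and> (\<forall>i\<in>J. y i \<in> piece ?S i)}"
        by (intro CollectI exI)
    next
      fix x assume "x \<in> {\<Sum>i\<in>J. y i |J y. finite J \<and> J \<subseteq> UNIV \<and> (\<forall>i\<in>J. y i \<in> piece ?S i)}"
      then obtain J y where x: "x = (\<Sum>i\<in>J. y i)" and y: "\<forall>i\<in>J. y i \<in> piece ?S i" by blast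
      then have "fst x \<in> carrier G" "snd x \<in> carrier H"
        unfolding x fst_sum snd_sum
        by (intro G.carrier_closed(6) H.carrier_closed(6);
            auto simp: lie_direct_sum_simps mem_Times_iff intro: G.piece_carrier H.piece_carrier)+
      then show "x \<in> carrier ?S"
        by (simp add: lie_direct_sum_simps mem_Times_iff)
    next
      fix J x i assume *: "finite J \<and> J \<subseteq> UNIV \<and> (\<forall>i\<in>J. x i \<in> piece ?S i) \<and> (\<Sum>i\<in>J. x i) = 0" "i \<in> J"
      then have "(\<Sum>i\<in>J. fst (x i)) = 0" "(\<Sum>i\<in>J. snd (x i)) = 0"
        by (metis fst_sum fst_zero, metis snd_sum snd_zero)
      then show "x i = 0"
        using * G.pieces_independent[of J "fst \<circ> x" i] H.pieces_independent[of J "snd \<circ> x" i]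
        by (auto simp: lie_direct_sum_simps prod_eq_iff mem_Times_iff)
    qed
  qed (auto simp: lie_direct_sum_simps zero_prod_def G.carrier_closed H.carrier_closed
      G.bracket_add_left G.bracket_add_right G.bracket_scale_left G.bracket_scale_right
      H.bracket_add_left H.bracket_add_right H.bracket_scale_left H.bracket_scale_right
      G.bracket_self H.bracket_self G.jacobi H.jacobi G.piece_bracket H.piece_bracket)
qed

lemma negative_part_direct_sum:
  assumes "graded_lie_algebra G" "graded_lie_algebra H"
  shows "negative_part (lie_direct_sum G H) = lie_direct_sum (negative_part G) (negative_part H)"
proof -
  interpret G: graded_lie_algebra G by fact
  interpret H: graded_lie_algebra H by fact
  let ?S = "lie_direct_sum G H"
  interpret S: graded_lie_algebra ?S by (rule lie_direct_sum_graded_lie) fact+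
  have comp: "component ?S x p = (component G (fst x) p, component H (snd x) p)" if x: "x \<in> carrier ?S" for x p
  proof -
    have a: "fst x \<in> carrier G" and b: "snd x \<in> carrier H" using x by (auto simp: lie_direct_sum_simps)
    let ?J = "{p. component G (fst x) p \<noteq> 0} \<union> {p. component H (snd x) p \<noteq> 0}"
    have fin: "finite ?J" using a b G.finite_component H.finite_component by simp
    have "is_decomp ?S x (\<lambda>p. (component G (fst x) p, component H (snd x) p))"
      by (rule S.is_decompI'[OF fin])
         (use a b fin G.sum_component[OF a fin] H.sum_component[OF b fin] in
          \<open>auto simp: lie_direct_sum_simps G.component_piece H.component_piece prod_eq_iff fst_sum snd_sum\<close>)
    then show ?thesis using S.component_eqI[OF x] by simp
  qed
  have "carrier (negative_part ?S) = carrier (negative_part G) \<times> carrier (negative_part H)"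
    unfolding S.negative_part_carrier G.negative_part_carrier H.negative_part_carrier
    using comp by (auto simp: lie_direct_sum_simps zero_prod_def)
  moreover have "piece (negative_part ?S) = (\<lambda>p. piece (negative_part G) p \<times> piece (negative_part H) p)"
    by (rule ext) (simp add: S.negative_part_simps G.negative_part_simps H.negative_part_simps
        lie_direct_sum_simps zero_prod_def)
  ultimately show ?thesis
    by (simp add: lie_direct_sum_def) (simp add: negative_part_def)
qed

subsection \<open>Homomorphisms\<close>

lemma graded_homD:
  assumes "graded_hom G H f"
  shows "x \<in> carrier G \<Longrightarrow> f x \<in> carrier H"
    "x \<in> carrier G \<Longrightarrow> y \<in> carrier G \<Longrightarrow> f (x + y) = f x + f y"
    "x \<in> carrier G \<Longrightarrow> f (scal G c x) = scal H c (f x)"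
    "x \<in> carrier G \<Longrightarrow> y \<in> carrier G \<Longrightarrow> f (bracket G x y) = bracket H (f x) (f y)"
    "x \<in> piece G p \<Longrightarrow> f x \<in> piece H p"
  using assms by (auto simp: graded_hom_def)

lemma graded_hom_zero: "graded_lie_algebra G \<Longrightarrow> graded_hom G H f \<Longrightarrow> f 0 = 0"
  using graded_homD(2)[of G H f 0 0] graded_lie_algebra.carrier_closed(1)[of G] by simp

lemma graded_hom_sum:
  assumes G: "graded_lie_algebra G" and f: "graded_hom G H f" and "\<And>a. a \<in> A \<Longrightarrow> g a \<in> carrier G"
  shows "f (sum g A) = (\<Sum>a\<in>A. f (g a))"
  using assms(3)
proof (induction A rule: infinite_finite_induct)
  case (insert x F)
  then have "sum g F \<in> carrier G"
    by (intro graded_lie_algebra.carrier_closed(6)[OF G]) auto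
  with insert show ?case by (simp add: graded_homD(2)[OF f])
qed (simp_all add: graded_hom_zero[OF G f])

lemma graded_hom_component:
  assumes G: "graded_lie_algebra G" and H: "graded_lie_algebra H" and f: "graded_hom G H f"
    and x: "x \<in> carrier G"
  shows "component H (f x) p = f (component G x p)"
proof -
  interpret G: graded_lie_algebra G by fact
  interpret H: graded_lie_algebra H by fact
  let ?J = "{p. component G x p \<noteq> 0}"
  have fin: "finite ?J" using G.finite_component[OF x] .
  have "component G x p \<in> carrier G" for p
    using G.component_piece[OF x] G.piece_carrier by blast
  then have "f x = (\<Sum>p\<in>?J. f (component G x p))"
    using graded_hom_sum[OF G f, of ?J "component G x"] G.sum_component[OF x fin] by simp
  then have "is_decomp H (f x) (\<lambda>p. f (component G x p))"
    by (intro H.is_decompI'[OF fin])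
       (auto simp: graded_homD(5)[OF f] G.component_piece[OF x] graded_hom_zero[OF G f])
  then show ?thesis using H.component_eqI graded_homD(1)[OF f x] by simp
qed

text \<open>
  A bijective homomorphism commutes with taking components, so that the preimage of a homogeneous element has
  a single nonzero component. This gives the condition on the pieces, which bijectivity on the carriers
  does not contain by itself.
\<close>

lemma graded_hom_inverse:
  assumes G: "graded_lie_algebra G" and H: "graded_lie_algebra H" and f: "graded_hom G H f"
    and bij: "bij_betw f (carrier G) (carrier H)"
  shows "graded_hom H G (inv_into (carrier G) f)"
proof -
  interpret G: graded_lie_algebra G by fact
  interpret H: graded_lie_algebra H by fact
  let ?g = "inv_into (carrier G) f"
  have gc: "?g y \<in> carrier G" and fg: "f (?g y) = y" if "y \<in> carrier H" for y
    using that bij by (auto simp: bij_betw_def inv_into_into f_inv_into_f)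
  have inj: "inj_on f (carrier G)" using bij by (simp add: bij_betw_def)
  have eq: "?g y = x" if "x \<in> carrier G" "f x = y" for x y
    using that inj by auto
  show ?thesis
    unfolding graded_hom_def
  proof (intro conjI ballI allI)
    fix p y assume y: "y \<in> piece H p"
    then have yc: "y \<in> carrier H" by (rule H.piece_carrier)
    have "component G (?g y) p = ?g y"
    proof (rule inj_onD[OF inj])
      have "f (component G (?g y) p) = component H (f (?g y)) p"
        using graded_hom_component[OF G H f gc[OF yc]] by simp
      also have "\<dots> = f (?g y)" using H.component_of_piece[OF y] fg[OF yc] by simp
      finally show "f (component G (?g y) p) = f (?g y)" .
    qed (use gc[OF yc] G.component_piece G.piece_carrier in auto)
    with G.component_piece[OF gc[OF yc], of p] show "?g y \<in> piece G p" by simp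
  qed (auto simp: gc fg graded_homD[OF f] G.carrier_closed H.carrier_closed intro!: eq)
qed

lemma graded_iso_sym: "graded_iso G H \<Longrightarrow> graded_iso H G"
  unfolding graded_iso_def using graded_hom_inverse bij_betw_inv_into by blast

text \<open>
  A family of linear maps on the pieces that respects brackets of homogeneous elements extends to
  the whole algebra, and the extension is injective if the family is.
\<close>

lemma graded_hom_from_pieces:
  fixes G :: "'a::ab_group_add graded_lie" and H :: "'b::ab_group_add graded_lie"
  assumes G: "graded_lie_algebra G" and H: "graded_lie_algebra H"
    and piece: "\<And>p x. x \<in> piece G p \<Longrightarrow> \<phi> p x \<in> piece H p"
    and add: "\<And>p x y. x \<in> piece G p \<Longrightarrow> y \<in> piece G p \<Longrightarrow> \<phi> p (x + y) = \<phi> p x + \<phi> p y"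
    and scale: "\<And>p c x. x \<in> piece G p \<Longrightarrow> \<phi> p (scal G c x) = scal H c (\<phi> p x)"
    and bracket: "\<And>p r x y. x \<in> piece G p \<Longrightarrow> y \<in> piece G r \<Longrightarrow>
       \<phi> (p + r) (bracket G x y) = bracket H (\<phi> p x) (\<phi> r y)"
    and inj: "\<And>p x. x \<in> piece G p \<Longrightarrow> \<phi> p x = 0 \<Longrightarrow> x = 0"
  shows "\<exists>f. graded_hom G H f \<and> inj_on f (carrier G) \<and> (\<forall>p. \<forall>x\<in>piece G p. f x = \<phi> p x)"
proof -
  interpret G: graded_lie_algebra G by fact
  interpret H: graded_lie_algebra H by fact
  have zero: "\<phi> p 0 = 0" for p using add[of 0 p 0] G.piece_closed(1) by simp
  define f where "f x = (\<Sum>p | component G x p \<noteq> 0. \<phi> p (component G x p))" for x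
  have f_sum: "f x = (\<Sum>p\<in>J. \<phi> p (component G x p))"
    if "finite J" "{p. component G x p \<noteq> 0} \<subseteq> J" for x J
    unfolding f_def by (rule sum.mono_neutral_left) (use that zero in auto)
  have f_piece: "f x = \<phi> p x" if "x \<in> piece G p" for x p
  proof -
    have "{r. component G x r \<noteq> 0} \<subseteq> {p}" using G.component_of_piece[OF that] by auto
    then show ?thesis using f_sum[of "{p}" x] G.component_of_piece[OF that] by simp
  qed
  have f_add: "f (x + y) = f x + f y" if x: "x \<in> carrier G" and y: "y \<in> carrier G" for x y
  proof -
    let ?J = "{p. component G x p \<noteq> 0} \<union> {p. component G y p \<noteq> 0}"
    have fin: "finite ?J" using x y G.finite_component by simp
    have "f (x + y) = (\<Sum>p\<in>?J. \<phi> p (component G (x + y) p))"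
      by (rule f_sum[OF fin]) (auto simp: G.component_add x y)
    also have "\<dots> = (\<Sum>p\<in>?J. \<phi> p (component G x p)) + (\<Sum>p\<in>?J. \<phi> p (component G y p))"
      by (simp add: G.component_add x y add G.component_piece sum.distrib)
    also have "\<dots> = f x + f y" using f_sum[OF fin, of x] f_sum[OF fin, of y] by auto
    finally show ?thesis .
  qed
  have f_scale: "f (scal G c x) = scal H c (f x)" if x: "x \<in> carrier G" for x c
  proof -
    let ?J = "{p. component G x p \<noteq> 0}"
    have fin: "finite ?J" using x G.finite_component by simp
    have "f (scal G c x) = (\<Sum>p\<in>?J. \<phi> p (component G (scal G c x) p))"
      by (rule f_sum[OF fin]) (auto simp: G.component_scale x)
    also have "\<dots> = scal H c (f x)"
      by (simp add: G.component_scale x scale G.component_piece f_def H.scale_sum_right)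
    finally show ?thesis .
  qed
  have f_carrier: "f x \<in> carrier H" if "x \<in> carrier G" for x
    unfolding f_def using that
    by (intro H.carrier_closed(6)) (auto intro!: H.piece_carrier piece G.component_piece)
  have f_setsum: "f (sum g A) = (\<Sum>a\<in>A. f (g a))" if "\<And>a. a \<in> A \<Longrightarrow> g a \<in> carrier G" for g :: "int \<Rightarrow> 'a" and A
    using that by (induction A rule: infinite_finite_induct)
      (simp_all add: f_add G.carrier_closed f_piece[OF G.piece_closed(1)[of 0]] zero)
  have f_bracket: "f (bracket G x y) = bracket H (f x) (f y)"
    if x: "x \<in> carrier G" and y: "y \<in> carrier G" for x y
  proof -
    let ?I = "{p. component G x p \<noteq> 0}" and ?J = "{p. component G y p \<noteq> 0}"
    let ?x = "component G x" and ?y = "component G y"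
    have xy: "x = (\<Sum>p\<in>?I. ?x p)" "y = (\<Sum>p\<in>?J. ?y p)"
      using G.sum_component[of x ?I] G.sum_component[of y ?J] G.finite_component x y by auto
    have c: "?x p \<in> carrier G" "?y p \<in> carrier G" for p
      using G.component_piece[OF x] G.component_piece[OF y] G.piece_carrier by auto
    have d: "\<phi> p (?x p) \<in> carrier H" "\<phi> p (?y p) \<in> carrier H" for p
      by (rule H.piece_carrier[OF piece[OF G.component_piece[OF x]]],
          rule H.piece_carrier[OF piece[OF G.component_piece[OF y]]])
    have "bracket G x y = bracket G (\<Sum>p\<in>?I. ?x p) (\<Sum>p\<in>?J. ?y p)"
      using xy by simp
    also have "\<dots> = (\<Sum>p\<in>?I. \<Sum>r\<in>?J. bracket G (?x p) (?y r))"
      by (simp add: G.bracket_sum_left G.bracket_sum_right c G.carrier_closed) (rule sum.swap)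
    also have "f \<dots> = (\<Sum>p\<in>?I. \<Sum>r\<in>?J. f (bracket G (?x p) (?y r)))"
      by (simp add: f_setsum c G.carrier_closed)
    also have "\<dots> = (\<Sum>p\<in>?I. \<Sum>r\<in>?J. bracket H (\<phi> p (?x p)) (\<phi> r (?y r)))"
      by (intro sum.cong refl)
         (simp add: f_piece[OF G.piece_bracket[OF G.component_piece[OF x] G.component_piece[OF y]]]
           bracket[OF G.component_piece[OF x] G.component_piece[OF y]])
    also have "\<dots> = bracket H (f x) (f y)"
      unfolding f_def by (simp add: H.bracket_sum_left H.bracket_sum_right d H.carrier_closed) (rule sum.swap)
    finally show ?thesis .
  qed
  have hom: "graded_hom G H f"
    unfolding graded_hom_def using f_carrier f_add f_scale f_bracket f_piece piece by auto
  have "x = y" if x: "x \<in> carrier G" and y: "y \<in> carrier G" and e: "f x = f y" for x y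
  proof -
    have "component G x p = component G y p" for p
    proof -
      have "f (component G x p) = f (component G y p)"
        using graded_hom_component[OF G H hom x, of p] graded_hom_component[OF G H hom y, of p] e by simp
      moreover have cp: "component G x p \<in> piece G p" "component G y p \<in> piece G p"
        using x y G.component_piece by auto
      ultimately have "\<phi> p (component G x p) = \<phi> p (component G y p)" by (simp add: f_piece)
      moreover have "\<phi> p (component G x p) = \<phi> p (component G x p - component G y p) + \<phi> p (component G y p)"
        using add[of "component G x p - component G y p" p "component G y p"] cp G.piece_closed(3) by simp
      ultimately show ?thesis
        using inj[of "component G x p - component G y p" p] cp G.piece_closed(3) by simp
    qed
    then have "component G x = component G y" by auto
    then show "x = y"
      using G.is_decomp_component[OF x] G.is_decomp_component[OF y] by (simp add: is_decomp_def)
  qed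
  then have "inj_on f (carrier G)" by (rule inj_onI)
  with hom f_piece show ?thesis by blast
qed

section \<open>The contact algebra\<close>

text \<open>
  The next three lemmas describe the action of the negative part of the contact algebra on generating functions.
\<close>

lemma lagrange_one: "g \<in> polys l \<Longrightarrow> lagrange l 1 g = partial_deriv Zc g"
proof -
  assume g: "g \<in> polys l"
  have "vf_apply (ham l 1) g = partial_deriv Zc g"
    unfolding vf_apply_coords[OF ham_vfields[OF polys_1]] sum_coords by (simp add: lookup_ham)
  with g show ?thesis by (simp add: lagrange_alt)
qed

lemma lagrange_Xc:
  assumes i: "i < l" and g: "g \<in> polys l"
  shows "lagrange l (coord_poly (Xc i)) g
    = partial_deriv (Yc i) g + coord_poly (Xc i) * partial_deriv Zc g"
proof -
  have x: "coord_poly (Xc i) \<in> polys l" using i by (simp add: polys_coord)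
  have "(\<Sum>j<l. lookup (ham l (coord_poly (Xc i))) (Yc j) * partial_deriv (Yc j) g)
     = (\<Sum>j<l. if j = i then partial_deriv (Yc i) g else 0)"
    by (rule sum.cong) (auto simp: lookup_ham partial_deriv_coord)
  then have "vf_apply (ham l (coord_poly (Xc i))) g
    = partial_deriv (Yc i) g + coord_poly (Xc i) * partial_deriv Zc g"
    unfolding vf_apply_coords[OF ham_vfields[OF x]] sum_coords
    using i by (simp add: lookup_ham partial_deriv_coord)
  with g x show ?thesis by (simp add: lagrange_alt partial_deriv_coord)
qed

lemma lagrange_Yc:
  assumes i: "i < l" and g: "g \<in> polys l"
  shows "lagrange l (coord_poly (Yc i)) g = - partial_deriv (Xc i) g"
proof -
  have y: "coord_poly (Yc i) \<in> polys l" using i by (simp add: polys_coord)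
  have 1: "(\<Sum>j<l. lookup (ham l (coord_poly (Yc i))) (Xc j) * partial_deriv (Xc j) g)
     = (\<Sum>j<l. if j = i then - partial_deriv (Xc i) g else 0)"
    by (rule sum.cong) (auto simp: lookup_ham partial_deriv_coord)
  have 2: "(\<Sum>j<l. coord_poly (Yc j) * partial_deriv (Yc j) (coord_poly (Yc i)))
     = (\<Sum>j<l. if j = i then coord_poly (Yc i) else 0)"
    by (rule sum.cong) (auto simp: partial_deriv_coord)
  have "vf_apply (ham l (coord_poly (Yc i))) g = - partial_deriv (Xc i) g"
    unfolding vf_apply_coords[OF ham_vfields[OF y]] sum_coords 1
    using i 2 by (simp add: lookup_ham partial_deriv_coord)
  with g y show ?thesis by (simp add: lagrange_alt partial_deriv_coord)
qed

lemma lagrange_add_right: "lagrange l f (g + h) = lagrange l f g + lagrange l f h"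
  by (simp add: lagrange_def ham_add vf_bracket_add_right contact_form_add)

lemma lagrange_const_mult_right: "lagrange l f (single 0 c * g) = single 0 c * lagrange l f g"
  by (simp add: lagrange_def ham_scale vf_bracket_scale_right contact_form_scale)

lemma lagrange_zero_right [simp]: "lagrange l f 0 = 0"
  using lagrange_const_mult_right[of l f 0 0] by simp

lemma lagrange_diff_right: "lagrange l f (g - h) = lagrange l f g - lagrange l f h"
  using lagrange_add_right[of l f "g - h" h] by (simp add: algebra_simps)

lemma lagrange_anti: "lagrange l f g = - lagrange l g f"
proof -
  have "vf_bracket (ham l f) (ham l g) = 0 - vf_bracket (ham l g) (ham l f)"
    by (rule poly_mapping_eqI) (simp add: lookup_vf_bracket lookup_minus)
  then have "lagrange l f g = contact_form l 0 - lagrange l g f"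
    unfolding lagrange_def by (simp only: contact_form_diff)
  then show ?thesis by (simp add: contact_form_def)
qed

lemma lagrange_zero_left [simp]: "lagrange l 0 f = 0"
  using lagrange_anti[of l 0 f] by simp

lemma lagrange_derivation:
  assumes "f \<in> polys l" "g \<in> polys l" "h \<in> polys l"
  shows "lagrange l f (lagrange l g h) = lagrange l (lagrange l f g) h + lagrange l g (lagrange l f h)"
proof -
  have "vf_bracket (ham l f) (vf_bracket (ham l g) (ham l h))
     = vf_bracket (vf_bracket (ham l f) (ham l g)) (ham l h)
     + vf_bracket (ham l g) (vf_bracket (ham l f) (ham l h))"
    by (simp add: vf_derivation)
  then have "contact_form l (vf_bracket (ham l f) (ham l (lagrange l g h)))
     = contact_form l (vf_bracket (ham l (lagrange l f g)) (ham l h)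
        + vf_bracket (ham l g) (ham l (lagrange l f h)))"
    using assms by (simp add: bracket_ham)
  then show ?thesis by (simp only: lagrange_def contact_form_add)
qed

lemma homog_lookup_ham:
  assumes f: "homog w f"
  shows "homog (w - 2 + int (coord_weight u)) (lookup (ham l f) u)"
proof (cases u)
  case (Xc i)
  then show ?thesis
    using homog_uminus[OF homog_partial_deriv[OF f, of "Yc i"]] by (simp add: lookup_ham)
next
  case (Yc i)
  have "homog (1 + (w - 2)) (coord_poly (Yc i) * partial_deriv Zc f)"
    using homog_mult[OF homog_coord[of "Yc i"] homog_partial_deriv[OF f, of Zc]] by simp
  then show ?thesis
    using homog_add[OF homog_partial_deriv[OF f, of "Xc i"], of "coord_poly (Yc i) * partial_deriv Zc f"] Yc
    by (simp add: lookup_ham)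
next
  case Zc
  have "homog (1 + (w - 1)) (coord_poly (Yc j) * partial_deriv (Yc j) f)" for j
    using homog_mult[OF homog_coord[of "Yc j"] homog_partial_deriv[OF f, of "Yc j"]] by simp
  then show ?thesis using Zc f by (simp add: lookup_ham homog_diff homog_sum)
qed

lemma vf_homogeneous_iff: "vf_homogeneous p X \<longleftrightarrow> (\<forall>u. homog (p + int (coord_weight u)) (lookup X u))"
  unfolding vf_homogeneous_def homog_def by (simp add: diff_eq_eq)

lemma vf_homogeneous_ham: "homog (p + 2) f \<Longrightarrow> vf_homogeneous p (ham l f)"
  using homog_lookup_ham[of "p + 2" f] by (simp add: vf_homogeneous_iff)

lemma homog_vf_apply:
  assumes X: "vf_homogeneous p X" and f: "homog w f"
  shows "homog (p + w) (vf_apply X f)"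
  unfolding vf_apply_def
proof (rule homog_sum)
  fix u
  show "homog (p + w) (lookup X u * partial_deriv u f)"
    using homog_mult[OF _ homog_partial_deriv[OF f, of u], of "p + int (coord_weight u)" "lookup X u"] X
    by (simp add: vf_homogeneous_iff)
qed

lemma vf_homogeneous_bracket:
  assumes X: "vf_homogeneous p X" and Y: "vf_homogeneous r Y"
  shows "vf_homogeneous (p + r) (vf_bracket X Y)"
  unfolding vf_homogeneous_iff lookup_vf_bracket
proof
  fix u
  show "homog (p + r + int (coord_weight u)) (vf_apply X (lookup Y u) - vf_apply Y (lookup X u))"
    using homog_vf_apply[OF X, of "r + int (coord_weight u)" "lookup Y u"]
      homog_vf_apply[OF Y, of "p + int (coord_weight u)" "lookup X u"] X Y
    by (intro homog_diff) (simp_all add: vf_homogeneous_iff ac_simps)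
qed

lemma homog_contact_form: 
  assumes X: "vf_homogeneous p X"
  shows "homog (p + 2) (contact_form l X)"
proof -
  have X': "homog (p + int (coord_weight u)) (lookup X u)" for u
    using X by (simp add: vf_homogeneous_iff)
  have "homog (1 + (p + 1)) (coord_poly (Yc j) * lookup X (Xc j))" for j
    using homog_mult[OF homog_coord[of "Yc j"] X'[of "Xc j"]] by simp
  then show ?thesis unfolding contact_form_def
    using X'[of Zc] by (intro homog_diff homog_sum) (simp_all add: ac_simps)
qed

lemma homog_lagrange:
  "homog w f \<Longrightarrow> homog v g \<Longrightarrow> homog (w + v - 2) (lagrange l f g)"
proof -
  assume "homog w f" "homog v g"
  then have "vf_homogeneous (w - 2 + (v - 2)) (vf_bracket (ham l f) (ham l g))"
    by (intro vf_homogeneous_bracket vf_homogeneous_ham) simp_all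
  from homog_contact_form[OF this, of l] show ?thesis by (simp add: lagrange_def algebra_simps)
qed

lemma contact_algebra_simps:
  "carrier (contact_algebra l) = ham l ` polys l"
  "scal (contact_algebra l) = vf_scale" "bracket (contact_algebra l) = vf_bracket"
  by (simp_all add: contact_algebra_def contact_fields_eq)

lemma contact_piece:
  "piece (contact_algebra l) p = ham l ` {f \<in> polys l. homog (p + 2) f}"
proof -
  have "homog (p + 2) f \<longleftrightarrow> vf_homogeneous p (ham l f)" for f
    using homog_contact_form[of p "ham l f" l] vf_homogeneous_ham by auto
  then show ?thesis by (auto simp: contact_algebra_def contact_fields_eq)
qed

lemma homog_sum_unique:
  assumes "finite J" "\<And>p. p \<in> J \<Longrightarrow> homog (p + d) (f p)" "(\<Sum>p\<in>J. f p) = 0" "p \<in> J"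
  shows "f p = 0"
proof (rule poly_mapping_eqI)
  fix m
  show "lookup (f p) m = lookup 0 m"
  proof (cases "int (monom_weight m) = p + d")
    case True
    have "0 = (\<Sum>r\<in>J. lookup (f r) m)" using assms(3) by (metis lookup_sum lookup_zero)
    also have "\<dots> = (\<Sum>r\<in>J. if r = p then lookup (f p) m else 0)"
    proof (rule sum.cong)
      fix r assume "r \<in> J"
      then have "lookup (f r) m = 0" if "r \<noteq> p"
        using assms(2)[of r] True that by (metis add_right_cancel homog_def in_keys_iff)
      then show "lookup (f r) m = (if r = p then lookup (f p) m else 0)" by auto
    qed simp
    also have "\<dots> = lookup (f p) m" using assms(1,4) by simp
    finally show ?thesis by simp
  next
    case False
    then show ?thesis using assms(2)[OF assms(4)] by (auto simp: homog_def in_keys_iff)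
  qed
qed

interpretation VF: vector_space vf_scale by (rule vector_space_vf_scale)

text \<open>
  The homogeneous components of a contact field are the fields generated by the weight components of its
  generating function. They are contact fields because every polynomial generates one.
\<close>

lemma contact_graded_lie: "graded_lie_algebra (contact_algebra l)"
proof -
  let ?C = "contact_algebra l"
  have sub: "VF.subspace (ham l ` {f \<in> polys l. P f})"
    if "P 0" "\<And>f g. P f \<Longrightarrow> P g \<Longrightarrow> P (f + g)" "\<And>c f. P f \<Longrightarrow> P (single 0 c * f)" for P
  proof (rule VF.subspaceI)
    show "0 \<in> ham l ` {f \<in> polys l. P f}" by (rule image_eqI[of _ _ 0]) (simp_all add: that)
    show "x + y \<in> ham l ` {f \<in> polys l. P f}"
      if "x \<in> ham l ` {f \<in> polys l. P f}" "y \<in> ham l ` {f \<in> polys l. P f}" for x y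
      using that \<open>\<And>f g. P f \<Longrightarrow> P g \<Longrightarrow> P (f + g)\<close>
      by (auto simp: ham_add[symmetric] intro!: imageI polys_add)
    show "vf_scale c x \<in> ham l ` {f \<in> polys l. P f}"
      if "x \<in> ham l ` {f \<in> polys l. P f}" for c x
      using that \<open>\<And>c f. P f \<Longrightarrow> P (single 0 c * f)\<close>
      by (auto simp: ham_scale[symmetric] intro!: imageI polys_mult)
  qed
  show ?thesis
  proof (intro graded_lie_algebra.intro graded_lie_algebra_axioms.intro)
    show "vector_space (scal ?C)" by (simp add: contact_algebra_simps vector_space_vf_scale)
    show "module.subspace (scal ?C) (carrier ?C)"
      using sub[of "\<lambda>_. True"] by (simp add: contact_algebra_simps)
    show "module.subspace (scal ?C) (piece ?C p)" for p
      unfolding contact_piece contact_algebra_simps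
      by (rule sub) (auto intro: homog_add homog_const_mult)
    show "bracket ?C x y \<in> carrier ?C" if "x \<in> carrier ?C" "y \<in> carrier ?C" for x y
      using that contact_fields_bracket by (simp add: contact_algebra_simps contact_fields_eq)
    show "bracket ?C x y \<in> piece ?C (i + j)" if "x \<in> piece ?C i" "y \<in> piece ?C j" for x y i j
      using that contact_fields_bracket vf_homogeneous_bracket by (auto simp: contact_algebra_def)
    show "direct_sum_of UNIV (piece ?C) (carrier ?C)"
      unfolding direct_sum_of_def
    proof (intro conjI allI impI ballI subset_antisym subsetI)
      fix x assume "x \<in> carrier ?C"
      then obtain f where x: "x = ham l f" and f: "f \<in> polys l" by (auto simp: contact_algebra_simps)
      let ?d = "\<lambda>m. int (monom_weight m) - 2"
      let ?J = "?d ` keys f"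
      let ?f = "\<lambda>p. \<Sum>m | m \<in> keys f \<and> ?d m = p. single m (lookup f m)"
      have "f = (\<Sum>m\<in>keys f. single m (lookup f m))" by (simp add: sum_single_lookup)
      also have "\<dots> = (\<Sum>p\<in>?J. ?f p)" by (rule sum.image_gen) simp
      finally have "ham l f = (\<Sum>p\<in>?J. ham l (?f p))" by (metis (no_types) ham_sum)
      moreover have "ham l (?f p) \<in> piece ?C p" for p
        unfolding contact_piece
        by (intro imageI CollectI conjI polys_sum homog_sum)
           (use f in \<open>auto simp: polys_def homog_def\<close>)
      ultimately have "x = (\<Sum>p\<in>?J. ham l (?f p)) \<and> finite ?J \<and> ?J \<subseteq> UNIV \<and> (\<forall>p\<in>?J. ham l (?f p) \<in> piece ?C p)"
        unfolding x by simp
      then show "x \<in> {\<Sum>i\<in>J. y i |J y. finite J \<and> J \<subseteq> UNIV \<and> (\<forall>i\<in>J. y i \<in> piece ?C i)}"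
        by (intro CollectI exI)
    next
      fix x assume "x \<in> {\<Sum>i\<in>J. y i |J y. finite J \<and> J \<subseteq> UNIV \<and> (\<forall>i\<in>J. y i \<in> piece ?C i)}"
      then obtain J y where x: "x = (\<Sum>i\<in>J. y i)" and "\<forall>i\<in>J. y i \<in> piece ?C i" by blast
      then have "y i \<in> carrier ?C" if "i \<in> J" for i
        using that by (auto simp: contact_piece contact_algebra_simps)
      then show "x \<in> carrier ?C"
        unfolding x using sub[of "\<lambda>_. True"] by (intro VF.subspace_sum) (simp_all add: contact_algebra_simps)
    next
      fix J x i assume *: "finite J \<and> J \<subseteq> UNIV \<and> (\<forall>i\<in>J. x i \<in> piece ?C i) \<and> (\<Sum>i\<in>J. x i) = 0" "i \<in> J"
      have x: "x p = ham l (contact_form l (x p))" and h: "homog (p + 2) (contact_form l (x p))"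
        if "p \<in> J" for p
        using * that by (auto simp: contact_piece)
      have "(\<Sum>p\<in>J. ham l (contact_form l (x p))) = 0"
        using * x by (metis (no_types, lifting) sum.cong)
      then have "(\<Sum>p\<in>J. contact_form l (x p)) = 0" by (simp add: ham_sum[symmetric])
      then have "contact_form l (x i) = 0"
        using homog_sum_unique[of J 2 "\<lambda>p. contact_form l (x p)" i] * h by simp
      with x[of i] * show "x i = 0" by simp
    qed
  qed (auto simp: contact_algebra_simps vf_bracket_add_left vf_bracket_add_right
      vf_bracket_scale_left vf_bracket_scale_right vf_bracket_self vf_jacobi)
qed

lemma finite_monomials: "finite {m. keys m \<subseteq> coords l \<and> int (monom_weight m) = w}"
proof -
  let ?S = "{m. keys m \<subseteq> coords l \<and> int (monom_weight m) = w}"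
  let ?T = "{h. \<forall>u. (u \<in> coords l \<longrightarrow> h u \<in> {..nat w}) \<and> (u \<notin> coords l \<longrightarrow> h u = 0)}"
  have T: "lookup m \<in> ?T" if m: "m \<in> ?S" for m
  proof (rule CollectI, intro allI conjI impI)
    fix u
    have "coord_weight u * lookup m u \<le> monom_weight m"
    proof (cases "u \<in> keys m")
      case True
      then show ?thesis unfolding monom_weight_def by (intro member_le_sum) auto
    qed (simp add: in_keys_iff)
    moreover have "lookup m u \<le> coord_weight u * lookup m u" using coord_weight_pos[of u] by simp
    ultimately have "lookup m u \<le> monom_weight m" by linarith
    moreover from m have "int (monom_weight m) = w" by blast
    then have "nat w = monom_weight m" by (metis nat_int)
    ultimately show "lookup m u \<in> {..nat w}" by simp
    assume "u \<notin> coords l"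
    moreover from m have "keys m \<subseteq> coords l" by blast
    ultimately show "lookup m u = 0" by (auto simp only: in_keys_iff)
  qed
  have "lookup ` ?S \<subseteq> ?T" by (rule image_subsetI) (rule T)
  moreover have "finite ?T" by (rule finite_set_of_finite_funs) simp_all
  ultimately have "finite (lookup ` ?S)" by (rule finite_subset)
  then show ?thesis by (rule finite_imageD) (simp add: inj_on_def)
qed

lemma contact_fin_dim: "fin_dim (scal (contact_algebra l)) (piece (contact_algebra l) p)"
  unfolding fin_dim_def contact_algebra_simps
proof (intro exI conjI subsetI)
  let ?S = "{m. keys m \<subseteq> coords l \<and> int (monom_weight m) = p + 2}"
  let ?B = "(\<lambda>m. ham l (single m 1)) ` ?S"
  show "finite ?B" by (intro finite_imageI finite_monomials)
  fix X assume "X \<in> piece (contact_algebra l) p"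
  then obtain f where X: "X = ham l f" and f: "f \<in> polys l" "homog (p + 2) f"
    by (auto simp: contact_piece)
  have "f = (\<Sum>m\<in>keys f. single 0 (lookup f m) * single m 1)"
    by (simp add: mult_single sum_single_lookup)
  then have "X = (\<Sum>m\<in>keys f. vf_scale (lookup f m) (ham l (single m 1)))"
    unfolding X by (metis (no_types, lifting) ham_scale ham_sum sum.cong)
  also have "\<dots> \<in> VF.span ?B"
    using f by (intro VF.span_sum VF.span_scale VF.span_base imageI)
      (auto simp: polys_def homog_def)
  finally show "X \<in> VF.span ?B" .
qed

text \<open>
  For \<open>l > 0\<close> the part of degree \<open>-1\<close> generates \<open>\<partial>\<^sub>z\<close>, so that a field
  commuting with that part has a constant generating function.
\<close>

lemma constant_if_commutes:
  assumes l: "l > 0" and f: "f \<in> polys l"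
    and X: "\<And>i. i < l \<Longrightarrow> lagrange l (coord_poly (Xc i)) f = 0"
    and Y: "\<And>i. i < l \<Longrightarrow> lagrange l (coord_poly (Yc i)) f = 0"
  shows "f = single 0 (lookup f 0)"
proof -
  have x: "coord_poly (Xc 0) \<in> polys l" "coord_poly (Yc 0) \<in> polys l" using l by (simp_all add: polys_coord)
  have one: "lagrange l (coord_poly (Xc 0)) (coord_poly (Yc 0)) = 1"
    using l x by (simp add: lagrange_Xc partial_deriv_coord)
  have "lagrange l (coord_poly (Xc 0)) (lagrange l (coord_poly (Yc 0)) f)
    = lagrange l 1 f + lagrange l (coord_poly (Yc 0)) (lagrange l (coord_poly (Xc 0)) f)"
    using lagrange_derivation[OF x f] by (simp only: one)
  then have Z: "partial_deriv Zc f = 0" using X Y l f by (simp add: lagrange_one)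
  show ?thesis
  proof (rule constant_if_partial_derivs_zero[OF f])
    fix u assume "u \<in> coords l"
    then show "partial_deriv u f = 0"
      using X Y f Z by (cases u) (auto simp: lagrange_Xc lagrange_Yc)
  qed
qed

lemma contact_transitive:
  assumes l: "l > 0" and p: "p \<ge> 0" and X: "X \<in> piece (contact_algebra l) p"
    and comm: "\<And>Y. Y \<in> piece (contact_algebra l) (-1) \<Longrightarrow> vf_bracket X Y = 0"
  shows "X = 0"
proof -
  obtain f where X: "X = ham l f" and f: "f \<in> polys l" "homog (p + 2) f"
    using X by (auto simp: contact_piece)
  have z: "lagrange l (coord_poly u) f = 0" if u: "u \<in> coords l" "coord_weight u = 1" for u
  proof -
    have up: "coord_poly u \<in> polys l" using u by (simp add: polys_coord)
    moreover have "homog 1 (coord_poly u)" using homog_coord[of u] u by simp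
    ultimately have "ham l (coord_poly u) \<in> piece (contact_algebra l) (-1)"
      by (auto simp: contact_piece)
    with comm have "vf_bracket (ham l f) (ham l (coord_poly u)) = 0" unfolding X by simp
    then have "lagrange l f (coord_poly u) = 0"
      using bracket_ham[OF f(1) up] by simp
    then show ?thesis using lagrange_anti[of l f "coord_poly u"] by simp
  qed
  have "f = single 0 (lookup f 0)"
    by (rule constant_if_commutes[OF l f(1)]) (simp_all add: z)
  moreover have "lookup f 0 = 0"
  proof (rule ccontr)
    assume "lookup f 0 \<noteq> 0"
    then have "0 \<in> keys f" by (simp add: in_keys_iff)
    with f(2) have "int (monom_weight 0) = p + 2" unfolding homog_def by blast
    with p show False by simp
  qed
  ultimately have "f = 0" by simp
  then show ?thesis by (simp add: X)
qed

lemma fin_dim_direct_sum: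
  assumes G: "vector_space (scal G)" and H: "vector_space (scal H)"
    and A: "fin_dim (scal G) A" and B: "fin_dim (scal H) B"
  shows "fin_dim (scal (lie_direct_sum G H)) (A \<times> B)"
proof -
  interpret G: vector_space "scal G" by fact
  interpret H: vector_space "scal H" by fact
  let ?S = "lie_direct_sum G H"
  interpret S: vector_space "scal ?S"
    by unfold_locales (simp_all add: lie_direct_sum_simps G.scale_right_distrib G.scale_left_distrib
        H.scale_right_distrib H.scale_left_distrib)
  obtain C D where C: "finite C" "A \<subseteq> G.span C" and D: "finite D" "B \<subseteq> H.span D"
    using A B by (auto simp: fin_dim_def)
  let ?E = "C \<times> {0} \<union> {0} \<times> D"
  have 1: "(x, 0) \<in> S.span ?E" if "x \<in> G.span C" for x
    using that
  proof (induction rule: G.span_induct_alt)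
    case base
    then show ?case using S.span_zero[of ?E] by (simp add: zero_prod_def)
  next
    case (step c x y)
    have "(scal G c x + y, 0) = scal ?S c (x, 0) + (y, 0)"
      by (simp add: lie_direct_sum_simps)
    with step show ?case by (simp add: S.span_add S.span_scale S.span_base)
  qed
  have 2: "(0, x) \<in> S.span ?E" if "x \<in> H.span D" for x
    using that
  proof (induction rule: H.span_induct_alt)
    case base
    then show ?case using S.span_zero[of ?E] by (simp add: zero_prod_def)
  next
    case (step c x y)
    have "(0, scal H c x + y) = scal ?S c (0, x) + (0, y)"
      by (simp add: lie_direct_sum_simps)
    with step show ?case by (simp add: S.span_add S.span_scale S.span_base)
  qed
  have "A \<times> B \<subseteq> S.span ?E"
  proof clarify
    fix a b assume "a \<in> A" "b \<in> B"
    then have "(a, 0) + (0, b) \<in> S.span ?E" using 1 2 C D by (intro S.span_add) auto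
    then show "(a, b) \<in> S.span ?E" by simp
  qed
  then show ?thesis unfolding fin_dim_def using C D by (intro exI[of _ ?E]) auto
qed

lemma double_contact_transitive_prolongation:
  assumes l: "l > 0"
    and iso: "graded_iso M (lie_direct_sum (heisenberg_algebra l) (heisenberg_algebra l))"
  shows "transitive_prolongation M (lie_direct_sum (contact_algebra l) (contact_algebra l))"
proof -
  let ?C = "contact_algebra l"
  let ?S = "lie_direct_sum ?C ?C"
  have C: "graded_lie_algebra ?C" by (rule contact_graded_lie)
  interpret S: graded_lie_algebra ?S by (rule lie_direct_sum_graded_lie[OF C C])
  have neg: "negative_part ?S = lie_direct_sum (heisenberg_algebra l) (heisenberg_algebra l)"
    by (simp add: negative_part_direct_sum[OF C C] heisenberg_algebra_def)
  show ?thesis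
    unfolding transitive_prolongation_def
  proof (intro conjI allI impI ballI)
    show "graded_lie_algebra ?S" by (rule S.graded_lie_algebra_axioms)
    show "graded_iso (negative_part ?S) M" unfolding neg by (rule graded_iso_sym[OF iso])
    show "fin_dim (scal ?S) (piece ?S p)" for p
      unfolding lie_direct_sum_simps(4)
      by (intro fin_dim_direct_sum contact_fin_dim)
         (simp_all add: contact_algebra_simps vector_space_vf_scale)
    fix p :: int and X assume p: "0 \<le> p" and X: "X \<in> piece ?S p"
      and comm: "\<forall>Y\<in>piece ?S (-1). bracket ?S X Y = 0"
    have 0: "0 \<in> piece ?C (-1)" by (auto simp: contact_piece intro!: image_eqI[of _ _ 0])
    obtain a b where ab: "X = (a, b)" "a \<in> piece ?C p" "b \<in> piece ?C p"
      using X by (auto simp: lie_direct_sum_simps)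
    have "vf_bracket a Y = 0 \<and> vf_bracket b Y = 0" if "Y \<in> piece ?C (-1)" for Y
      using bspec[OF comm, of "(Y, Y)"] that ab
      by (simp add: lie_direct_sum_simps contact_algebra_simps zero_prod_def)
    then show "X = 0" using contact_transitive[OF l p] ab by (simp add: zero_prod_def)
  qed
qed

section \<open>Generating functions attached to a Heisenberg frame\<close>

text \<open>
  The elements \<open>e\<close> are a symplectic basis of a Heisenberg algebra in the negative part of \<open>G\<close>, and
  \<open>lam\<close> is a coordinate on degree \<open>-2\<close> with value \<open>1\<close> on the center of this Heisenberg algebra.
  Degree \<open>-2\<close> may be larger than this center: \<open>lam_bracket\<close> says that \<open>lam\<close> sees of a bracket only
  the components along the symplectic basis, and \<open>lam_degree_0\<close> says that the kernel of \<open>lam\<close> is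
  preserved by degree \<open>0\<close>.
\<close>

locale heisenberg_frame = graded_lie_algebra G for G :: "'a::ab_group_add graded_lie" (structure) +
  fixes l :: nat and e :: "coord \<Rightarrow> 'a" and lam :: "'a \<Rightarrow> complex"
  assumes depth: "p < -2 \<Longrightarrow> piece G p = {0}"
    and e_X: "i < l \<Longrightarrow> e (Xc i) \<in> piece G (-1)"
    and e_Y: "i < l \<Longrightarrow> e (Yc i) \<in> piece G (-1)"
    and e_Z: "e Zc \<in> piece G (-2)"
    and XX: "i < l \<Longrightarrow> j < l \<Longrightarrow> bracket G (e (Xc i)) (e (Xc j)) = 0"
    and YY: "i < l \<Longrightarrow> j < l \<Longrightarrow> bracket G (e (Yc i)) (e (Yc j)) = 0"
    and XY: "i < l \<Longrightarrow> j < l \<Longrightarrow> bracket G (e (Xc i)) (e (Yc j)) = (if i = j then e Zc else 0)"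
    and lam_add: "x \<in> piece G (-2) \<Longrightarrow> y \<in> piece G (-2) \<Longrightarrow> lam (x + y) = lam x + lam y"
    and lam_scale: "x \<in> piece G (-2) \<Longrightarrow> lam (scal G c x) = c * lam x"
    and lam_Z: "lam (e Zc) = 1"
    and lam_bracket: "s \<in> piece G (-1) \<Longrightarrow> t \<in> piece G (-1) \<Longrightarrow> lam (bracket G s t) =
        (\<Sum>i<l. lam (bracket G s (e (Yc i))) * lam (bracket G (e (Xc i)) t)
             - lam (bracket G s (e (Xc i))) * lam (bracket G (e (Yc i)) t))"
    and lam_degree_0: "x \<in> piece G 0 \<Longrightarrow> y \<in> piece G (-2) \<Longrightarrow>
        lam (bracket G x y) = lam (bracket G x (e Zc)) * lam y"
begin

text \<open>
  The generating function of an element of degree \<open>n - 2\<close>, homogeneous of degree \<open>n\<close>. It is defined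
  by the weighted Euler formula from the partial derivatives that it must have: bracketing with \<open>x\<^sub>i\<close>,
  \<open>y\<^sub>i\<close>, \<open>1\<close> has to become \<open>\<partial>\<^sub>y + x \<partial>\<^sub>z\<close>, \<open>-\<partial>\<^sub>x\<close>,
  \<open>\<partial>\<^sub>z\<close>. In degree \<open>1\<close> the terms with \<open>\<partial>\<^sub>z\<close> are absent because they would have negative
  degree.
\<close>

fun gen :: "nat \<Rightarrow> 'a \<Rightarrow> cpoly" where
  "gen 0 x = single 0 (lam x)"
| "gen (Suc 0) x = (\<Sum>i<l. coord_poly (Xc i) * (- gen 0 (bracket G (e (Yc i)) x)))
     + (\<Sum>i<l. coord_poly (Yc i) * gen 0 (bracket G (e (Xc i)) x))"
| "gen (Suc (Suc n)) x = single 0 (1 / of_nat (Suc (Suc n))) *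
     ((\<Sum>i<l. coord_poly (Xc i) * (- gen (Suc n) (bracket G (e (Yc i)) x)))
      + (\<Sum>i<l. coord_poly (Yc i) *
          (gen (Suc n) (bracket G (e (Xc i)) x) - coord_poly (Xc i) * gen n (bracket G (e Zc) x)))
      + 2 * (coord_poly Zc * gen n (bracket G (e Zc) x)))"

text \<open>
  Zero in negative degree is consistent with the pieces below \<open>-2\<close> being zero, and removes the special cases
  for small degrees from the inductions below.
\<close>

definition gen_fun :: "int \<Rightarrow> 'a \<Rightarrow> cpoly" where
  "gen_fun w x = (if w < 0 then 0 else gen (nat w) x)"

text \<open>
  The prescribed partial derivatives, obtained by solving the three conditions above for
  \<open>\<partial>\<^sub>x\<close>, \<open>\<partial>\<^sub>y\<close>, \<open>\<partial>\<^sub>z\<close>.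
\<close>

fun gen_fun_deriv :: "int \<Rightarrow> coord \<Rightarrow> 'a \<Rightarrow> cpoly" where
  "gen_fun_deriv w (Xc i) x = - gen_fun (w - 1) (bracket G (e (Yc i)) x)"
| "gen_fun_deriv w (Yc i) x = gen_fun (w - 1) (bracket G (e (Xc i)) x)
     - coord_poly (Xc i) * gen_fun (w - 2) (bracket G (e Zc) x)"
| "gen_fun_deriv w Zc x = gen_fun (w - 2) (bracket G (e Zc) x)"

lemma gen_fun_negative: "w < 0 \<Longrightarrow> gen_fun w x = 0" by (simp add: gen_fun_def)

lemma gen_fun_0: "gen_fun 0 x = single 0 (lam x)" by (simp add: gen_fun_def)

lemma gen_fun_euler:
  assumes "w > 0"
  shows "gen_fun w x = single 0 (1 / of_int w) *
    (\<Sum>u\<in>coords l. of_nat (coord_weight u) * (coord_poly u * gen_fun_deriv w u x))"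
proof (cases "w = 1")
  case True
  then show ?thesis by (simp add: sum_coords gen_fun_def)
next
  case False
  define n where "n = nat (w - 2)"
  have w: "w = int (Suc (Suc n))" using assms False by (simp add: n_def)
  have n: "nat (int (Suc (Suc n)) - 1) = Suc n" "nat (int (Suc (Suc n)) - 2) = n" by auto
  have one: "of_nat (Suc 0) = (1 :: cpoly)" by simp
  show ?thesis unfolding w by (simp add: sum_coords gen_fun_def n one del: of_nat_Suc)
qed

text \<open>
  Strong induction on an integer degree. For \<open>w \<le> 0\<close> there is no induction hypothesis, since the
  functions are given explicitly there.
\<close>

lemma weight_induct:
  assumes "\<And>w :: int. (\<And>v. 0 < w \<Longrightarrow> v < w \<Longrightarrow> P v) \<Longrightarrow> P w"
  shows "P w"
proof (induction w rule: measure_induct_rule[of "\<lambda>w. nat (w + 1)"])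
  case (less w)
  show ?case by (rule assms) (rule less, simp)
qed

lemma e_carrier: "u \<in> coords l \<Longrightarrow> e u \<in> carrier G"
  by (cases u) (auto intro: piece_carrier e_X e_Y e_Z)

lemma bracket_e_piece:
  "i < l \<Longrightarrow> x \<in> piece G p \<Longrightarrow> r = p - 1 \<Longrightarrow> bracket G (e (Xc i)) x \<in> piece G r"
  "i < l \<Longrightarrow> x \<in> piece G p \<Longrightarrow> r = p - 1 \<Longrightarrow> bracket G (e (Yc i)) x \<in> piece G r"
  "x \<in> piece G p \<Longrightarrow> r = p - 2 \<Longrightarrow> bracket G (e Zc) x \<in> piece G r"
  using bracket_piece[OF e_X] bracket_piece[OF e_Y] bracket_piece[OF e_Z] by simp_all

lemma gen_fun_add:
  "x \<in> piece G (w - 2) \<Longrightarrow> y \<in> piece G (w - 2) \<Longrightarrow> gen_fun w (x + y) = gen_fun w x + gen_fun w y"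
proof (induction w arbitrary: x y rule: weight_induct)
  case (1 w)
  consider "w < 0" | "w = 0" | "w > 0" by linarith
  then show ?case
  proof cases
    case 1
    then show ?thesis by (simp add: gen_fun_negative)
  next
    case 2
    then show ?thesis using 1 by (simp add: gen_fun_0 lam_add single_add)
  next
    case 3
    have "gen_fun_deriv w u (x + y) = gen_fun_deriv w u x + gen_fun_deriv w u y" if u: "u \<in> coords l" for u
      using u 1(2,3) e_carrier
      by (cases u)
         (simp_all add: bracket_add_right piece_carrier 1(1)[OF 3] bracket_e_piece algebra_simps)
    then show ?thesis
      by (simp add: gen_fun_euler[OF 3] distrib_left sum.distrib)
  qed
qed

lemma gen_fun_scale:
  "x \<in> piece G (w - 2) \<Longrightarrow> gen_fun w (scal G c x) = single 0 c * gen_fun w x"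
proof (induction w arbitrary: x rule: weight_induct)
  case (1 w)
  consider "w < 0" | "w = 0" | "w > 0" by linarith
  then show ?case
  proof cases
    case 1
    then show ?thesis by (simp add: gen_fun_negative)
  next
    case 2
    then show ?thesis using 1 by (simp add: gen_fun_0 lam_scale mult_single)
  next
    case 3
    have "gen_fun_deriv w u (scal G c x) = single 0 c * gen_fun_deriv w u x" if u: "u \<in> coords l" for u
      using u 1(2) e_carrier
      by (cases u)
         (simp_all add: bracket_scale_right piece_carrier 1(1)[OF 3] bracket_e_piece algebra_simps)
    then show ?thesis
      by (simp add: gen_fun_euler[OF 3] sum_distrib_left mult.left_commute)
  qed
qed

lemma gen_fun_zero [simp]: "gen_fun w 0 = 0"
  using gen_fun_add[of 0 w 0] piece_closed(1) by simp

lemma gen_fun_uminus: "x \<in> piece G (w - 2) \<Longrightarrow> gen_fun w (- x) = - gen_fun w x"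
  using gen_fun_add[of x w "- x"] piece_closed(5) by (simp add: eq_neg_iff_add_eq_0 add.commute)

lemma gen_fun_sum:
  "(\<And>a. a \<in> A \<Longrightarrow> f a \<in> piece G (w - 2)) \<Longrightarrow> gen_fun w (sum f A) = (\<Sum>a\<in>A. gen_fun w (f a))"
  by (induction A rule: infinite_finite_induct) (simp_all add: gen_fun_add piece_closed)

lemma gen_fun_polys: "gen_fun w x \<in> polys l"
proof (induction w arbitrary: x rule: weight_induct)
  case (1 w)
  consider "w < 0" | "w = 0" | "w > 0" by linarith
  then show ?case
  proof cases
    case 3
    have "gen_fun_deriv w u x \<in> polys l" if u: "u \<in> coords l" for u
      using u by (cases u) (auto intro!: polys_intros 1[OF 3])
    then show ?thesis unfolding gen_fun_euler[OF 3] single_of_nat[symmetric]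
      by (intro polys_mult polys_sum polys_const polys_coord)
  qed (simp_all add: gen_fun_negative gen_fun_0)
qed

lemma gen_fun_deriv_polys: "u \<in> coords l \<Longrightarrow> gen_fun_deriv w u x \<in> polys l"
  by (cases u) (auto intro!: polys_intros gen_fun_polys)

lemma gen_fun_deriv_homog_aux:
  assumes "\<And>x. homog (w - 1) (gen_fun (w - 1) x)" "\<And>x. homog (w - 2) (gen_fun (w - 2) x)"
  shows "homog (w - int (coord_weight u)) (gen_fun_deriv w u x)"
proof (cases u)
  case (Yc i)
  have "homog (1 + (w - 2)) (coord_poly (Xc i) * gen_fun (w - 2) (bracket G (e Zc) x))"
    using homog_mult[OF homog_coord[of "Xc i"] assms(2)] by simp
  then show ?thesis using Yc assms by (simp add: homog_diff)
qed (use assms in \<open>simp_all add: homog_uminus\<close>)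

lemma gen_fun_homog: "homog w (gen_fun w x)"
proof (induction w arbitrary: x rule: weight_induct)
  case (1 w)
  consider "w < 0" | "w = 0" | "w > 0" by linarith
  then show ?case
  proof cases
    case 3
    have "homog (w - int (coord_weight u)) (gen_fun_deriv w u x)" for u
      by (rule gen_fun_deriv_homog_aux) (simp_all add: 1[OF 3])
    then have "homog w (coord_poly u * gen_fun_deriv w u x)" for u
      using homog_mult[OF homog_coord[of u], of "w - int (coord_weight u)" "gen_fun_deriv w u x"] by simp
    then show ?thesis unfolding gen_fun_euler[OF 3] single_of_nat[symmetric]
      by (intro homog_const_mult homog_sum)
  qed (simp_all add: gen_fun_negative gen_fun_0)
qed

lemma gen_fun_deriv_homog: "homog (w - int (coord_weight u)) (gen_fun_deriv w u x)"
  by (rule gen_fun_deriv_homog_aux) (rule gen_fun_homog)+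

lemma bracket_swap:
  assumes "x \<in> carrier G" "u \<in> coords l" "v \<in> coords l"
  shows "bracket G (e u) (bracket G (e v) x)
    = bracket G (e v) (bracket G (e u) x) + bracket G (bracket G (e u) (e v)) x"
  using bracket_derivation[OF e_carrier[OF assms(2)] e_carrier[OF assms(3)] assms(1)] by simp

lemma e_Z_central: "u \<in> coords l \<Longrightarrow> bracket G (e Zc) (e u) = 0"
  using bracket_piece[OF e_Z e_X, of _ "-3"] bracket_piece[OF e_Z e_Y, of _ "-3"]
    bracket_self[OF e_carrier[of Zc]] depth[of "-3"]
  by (cases u) auto

text \<open>
  The prescribed derivatives form a closed one-form. A second derivative is the function of a double bracket with
  frame elements, and by the Jacobi identity exchanging these two elements costs the bracket with their commutator.
  The only nonzero commutator \<open>[x\<^sub>i, y\<^sub>i]\<close> is matched by the derivative of the coefficient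
  \<open>x\<^sub>i\<close> in \<open>\<partial>\<^sub>y + x \<partial>\<^sub>z\<close>.
\<close>

lemma gen_fun_deriv_closed:
  assumes w: "w > 0" and x: "x \<in> piece G (w - 2)" and u: "u \<in> coords l" and v: "v \<in> coords l"
    and IH: "\<And>r y u. r < w \<Longrightarrow> y \<in> piece G (r - 2) \<Longrightarrow> u \<in> coords l \<Longrightarrow>
       partial_deriv u (gen_fun r y) = gen_fun_deriv r u y"
  shows "partial_deriv v (gen_fun_deriv w u x) = partial_deriv u (gen_fun_deriv w v x)"
proof -
  have xc: "x \<in> carrier G" using x by (rule piece_carrier)
  note d = IH[of "w - 1"] IH[of "w - 2"]
  have dX: "partial_deriv v (gen_fun (w - 1) (bracket G (e (Xc i)) x)) = gen_fun_deriv (w - 1) v (bracket G (e (Xc i)) x)"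
    and dY: "partial_deriv v (gen_fun (w - 1) (bracket G (e (Yc i)) x)) = gen_fun_deriv (w - 1) v (bracket G (e (Yc i)) x)"
    if "i < l" "v \<in> coords l" for i v
    using that by (auto intro!: d bracket_e_piece(1,2)[OF _ x] bracket_e_piece(3)[OF x])
  have dZ: "partial_deriv v (gen_fun (w - 2) (bracket G (e Zc) x)) = gen_fun_deriv (w - 2) v (bracket G (e Zc) x)"
    if "v \<in> coords l" for v
    using that by (auto intro!: d bracket_e_piece(3)[OF x])
  have sXX: "bracket G (e (Xc i)) (bracket G (e (Xc j)) x) = bracket G (e (Xc j)) (bracket G (e (Xc i)) x)"
    and sYY: "bracket G (e (Yc i)) (bracket G (e (Yc j)) x) = bracket G (e (Yc j)) (bracket G (e (Yc i)) x)"
    if "i < l" "j < l" for i j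
    using bracket_swap[OF xc, of "Xc i" "Xc j"] bracket_swap[OF xc, of "Yc i" "Yc j"] that
    by (simp_all add: XX YY bracket_zero_left xc)
  have sZ: "bracket G (e Zc) (bracket G (e u) x) = bracket G (e u) (bracket G (e Zc) x)"
    if "u \<in> coords l" for u
    using bracket_swap[OF xc, of Zc u] that by (simp add: e_Z_central bracket_zero_left xc)
  have sXY: "gen_fun (w - 2) (bracket G (e (Xc j)) (bracket G (e (Yc i)) x))
     = gen_fun (w - 2) (bracket G (e (Yc i)) (bracket G (e (Xc j)) x))
       + (if i = j then gen_fun (w - 2) (bracket G (e Zc) x) else 0)" if "i < l" "j < l" for i j
  proof -
    have "bracket G (e (Yc i)) (bracket G (e (Xc j)) x) \<in> piece G (w - 2 - 2)"
      using that x by (intro bracket_e_piece(2)[OF _ bracket_e_piece(1)]) auto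
    then show ?thesis
      using bracket_swap[OF xc, of "Xc j" "Yc i"] that bracket_e_piece(3)[OF x, of "w - 2 - 2"]
      by (auto simp: XY gen_fun_add bracket_zero_left xc)
  qed
  note pd = partial_deriv_uminus partial_deriv_diff partial_deriv_mult partial_deriv_coord dX dY dZ
  have cXX: "partial_deriv (Xc j) (gen_fun_deriv w (Xc i) x) = partial_deriv (Xc i) (gen_fun_deriv w (Xc j) x)"
    if "i < l" "j < l" for i j
    using that by (simp add: pd sYY[of i j])
  have cXY: "partial_deriv (Yc j) (gen_fun_deriv w (Xc i) x) = partial_deriv (Xc i) (gen_fun_deriv w (Yc j) x)"
    if "i < l" "j < l" for i j
    using that by (simp add: pd sXY sZ)
  have cXZ: "partial_deriv Zc (gen_fun_deriv w (Xc i) x) = partial_deriv (Xc i) (gen_fun_deriv w Zc x)"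
    if "i < l" for i
    using that by (simp add: pd sZ)
  have cYY: "partial_deriv (Yc j) (gen_fun_deriv w (Yc i) x) = partial_deriv (Yc i) (gen_fun_deriv w (Yc j) x)"
    if "i < l" "j < l" for i j
    using that by (simp add: pd sXX[of j i] sZ[of "Xc i"] sZ[of "Xc j"]) (simp add: algebra_simps)
  have cYZ: "partial_deriv Zc (gen_fun_deriv w (Yc i) x) = partial_deriv (Yc i) (gen_fun_deriv w Zc x)"
    if "i < l" for i
    using that by (simp add: pd sZ[of "Xc i"])
  show ?thesis
    using u v
    by (cases u; cases v) (simp_all only: coords_simps cXX cXY cXZ cYY cYZ)
qed

text \<open>
  The Poincare lemma for homogeneous forms: differentiating the Euler formula at \<open>u\<close> gives the weight of
  \<open>u\<close> times the prescribed derivative, plus a sum that by closedness is again an Euler sum, for this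
  derivative. The two contributions add up to the degree of the function.
\<close>

lemma partial_deriv_gen_fun:
  "x \<in> piece G (w - 2) \<Longrightarrow> u \<in> coords l \<Longrightarrow> partial_deriv u (gen_fun w x) = gen_fun_deriv w u x"
proof (induction w arbitrary: x u rule: weight_induct)
  case (1 w)
  consider "w < 0" | "w = 0" | "w > 0" by linarith
  then show ?case
  proof cases
    case 1
    then show ?thesis by (cases u) (simp_all add: gen_fun_negative)
  next
    case 2
    then show ?thesis by (cases u) (simp_all add: gen_fun_0 gen_fun_negative)
  next
    case 3
    note v = \<open>u \<in> coords l\<close>
    let ?S = "\<Sum>v\<in>coords l. of_nat (coord_weight v) * (coord_poly v * gen_fun_deriv w v x)"
    have "partial_deriv u ?S
       = (\<Sum>v\<in>coords l. of_nat (coord_weight v) * ((if u = v then 1 else 0) * gen_fun_deriv w v x))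
       + (\<Sum>v\<in>coords l. of_nat (coord_weight v) * (coord_poly v * partial_deriv u (gen_fun_deriv w v x)))"
      by (simp add: partial_deriv_sum partial_deriv_mult partial_deriv_coord distrib_left
          sum.distrib single_of_nat[symmetric] del: single_of_nat)
    also have "(\<Sum>v\<in>coords l. of_nat (coord_weight v) * ((if u = v then 1 else 0) * gen_fun_deriv w v x))
       = (\<Sum>v\<in>coords l. if u = v then of_nat (coord_weight u) * gen_fun_deriv w u x else 0)"
      by (rule sum.cong) auto
    also have "\<dots> = of_nat (coord_weight u) * gen_fun_deriv w u x" using v by simp
    also have "(\<Sum>v\<in>coords l. of_nat (coord_weight v) * (coord_poly v * partial_deriv u (gen_fun_deriv w v x)))
       = (\<Sum>v\<in>coords l. of_nat (coord_weight v) * (coord_poly v * partial_deriv v (gen_fun_deriv w u x)))"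
      using gen_fun_deriv_closed[OF 3 1(2) _ v 1(1)[OF 3]] by (intro sum.cong) auto
    also have "\<dots> = of_int (w - int (coord_weight u)) * gen_fun_deriv w u x"
      by (rule weighted_euler[OF gen_fun_deriv_polys[OF v] gen_fun_deriv_homog])
    finally have "partial_deriv u ?S = of_int w * gen_fun_deriv w u x"
      by (simp add: algebra_simps)
    then have "partial_deriv u (gen_fun w x) = single 0 (1 / of_int w) * (single 0 (of_int w) * gen_fun_deriv w u x)"
      by (simp add: gen_fun_euler[OF 3] partial_deriv_const_mult)
    also have "\<dots> = gen_fun_deriv w u x"
      using 3 by (simp add: mult.assoc[symmetric] mult_single del: single_of_int)
    finally show ?thesis .
  qed
qed

lemma lagrange_coord_gen_fun:
  assumes x: "x \<in> piece G (w - 2)"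
  shows "i < l \<Longrightarrow> lagrange l (coord_poly (Xc i)) (gen_fun w x) = gen_fun (w - 1) (bracket G (e (Xc i)) x)"
    and "i < l \<Longrightarrow> lagrange l (coord_poly (Yc i)) (gen_fun w x) = gen_fun (w - 1) (bracket G (e (Yc i)) x)"
    and "lagrange l 1 (gen_fun w x) = gen_fun (w - 2) (bracket G (e Zc) x)"
  using x by (simp_all add: lagrange_Xc lagrange_Yc lagrange_one gen_fun_polys partial_deriv_gen_fun)

text \<open>
  Here both sides are constants, which the partial derivatives do not determine. The degrees of \<open>x\<close> and
  \<open>y\<close> are \<open>-1\<close> and \<open>-1\<close>, where the assertion is the assumption \<open>lam_bracket\<close>, or \<open>0\<close> and
  \<open>-2\<close>, where it is \<open>lam_degree_0\<close>.
\<close>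

lemma lagrange_gen_fun_base:
  assumes "w + v = 2" and x: "x \<in> piece G (w - 2)" and y: "y \<in> piece G (v - 2)"
  shows "lagrange l (gen_fun w x) (gen_fun v y) = gen_fun 0 (bracket G x y)"
proof -
  have zero_two: "lagrange l (gen_fun 0 x) (gen_fun 2 y) = gen_fun 0 (bracket G x y)"
    if x: "x \<in> piece G (-2)" and y: "y \<in> piece G 0" for x y
  proof -
    have "lagrange l (gen_fun 2 y) (single 0 (lam x) * 1) = single 0 (lam x) * lagrange l (gen_fun 2 y) 1"
      by (rule lagrange_const_mult_right)
    then have "lagrange l (gen_fun 0 x) (gen_fun 2 y) = single 0 (lam x) * lagrange l 1 (gen_fun 2 y)"
      using lagrange_anti[of l "gen_fun 2 y" 1] lagrange_anti[of l "gen_fun 0 x" "gen_fun 2 y"]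
      by (simp add: gen_fun_0)
    also have "\<dots> = single 0 (lam x * lam (bracket G (e Zc) y))"
      using lagrange_coord_gen_fun(3)[of y 2] y by (simp add: gen_fun_0 mult_single)
    also have "lam x * lam (bracket G (e Zc) y) = lam (bracket G x y)"
    proof -
      have m: "lam (bracket G a y) = - lam (bracket G y a)" if a: "a \<in> piece G (-2)" for a
        using bracket_anti[of a y] lam_scale[of "bracket G y a" "-1"] bracket_piece[OF y a, of "-2"]
          a y by (simp add: piece_carrier)
      show ?thesis using lam_degree_0[OF y x] m[OF x] m[OF e_Z] by simp
    qed
    finally show ?thesis by (simp add: gen_fun_0)
  qed
  consider "w < 0" | "v < 0" | "w = 0" "v = 2" | "w = 2" "v = 0" | "w = 1" "v = 1"
    using assms(1) by linarith
  then show ?thesis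
  proof cases
    case 1
    then have "x = 0" using depth[of "w - 2"] x by simp
    then show ?thesis using y by (simp add: bracket_zero_left piece_carrier)
  next
    case 2
    then have "y = 0" using depth[of "v - 2"] y by simp
    then show ?thesis using x by (simp add: bracket_zero_right piece_carrier)
  next
    case 3
    then show ?thesis using zero_two[of x y] x y by simp
  next
    case 4
    have "gen_fun 0 (bracket G x y) = - gen_fun 0 (bracket G y x)"
      using bracket_anti[of x y] gen_fun_uminus[of "bracket G y x" 0] x y 4
        bracket_piece[of y "-2" x 0 "-2"] by (simp add: piece_carrier)
    then show ?thesis
      using zero_two[of y x] x y 4 lagrange_anti[of l "gen_fun 2 x" "gen_fun 0 y"] by simp
  next
    case 5
    let ?a = "\<lambda>i. lam (bracket G (e (Xc i)) x)" and ?b = "\<lambda>i. lam (bracket G (e (Yc i)) x)"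
    let ?c = "\<lambda>i. lam (bracket G (e (Xc i)) y)" and ?d = "\<lambda>i. lam (bracket G (e (Yc i)) y)"
    have xy: "x \<in> piece G (-1)" "y \<in> piece G (-1)" using x y 5 by simp_all
    have g: "gen_fun 1 x = (\<Sum>i<l. single 0 (- ?b i) * coord_poly (Xc i))
        + (\<Sum>i<l. single 0 (?a i) * coord_poly (Yc i))"
      by (simp add: gen_fun_euler sum_coords gen_fun_0 gen_fun_negative mult.commute single_uminus)
    have lsum: "lagrange l f (\<Sum>i<l. single 0 (c i) * h i) = (\<Sum>i<l. single 0 (c i) * lagrange l f (h i))"
      for f h and c :: "nat \<Rightarrow> complex"
    proof -
      have "lagrange l f (\<Sum>i\<in>A. single 0 (c i) * h i) = (\<Sum>i\<in>A. single 0 (c i) * lagrange l f (h i))"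
        for A :: "nat set"
        by (induction A rule: infinite_finite_induct)
           (simp_all add: lagrange_add_right lagrange_const_mult_right)
      then show ?thesis .
    qed
    have c: "lagrange l (gen_fun 1 y) (coord_poly (Xc i)) = single 0 (- ?c i)"
      "lagrange l (gen_fun 1 y) (coord_poly (Yc i)) = single 0 (- ?d i)" if "i < l" for i
      using lagrange_coord_gen_fun(1,2)[of y 1 i] xy that
        lagrange_anti[of l "gen_fun 1 y" "coord_poly (Xc i)"]
        lagrange_anti[of l "gen_fun 1 y" "coord_poly (Yc i)"]
      by (simp_all add: gen_fun_0 single_uminus)
    have "lagrange l (gen_fun 1 x) (gen_fun 1 y) = - lagrange l (gen_fun 1 y) (gen_fun 1 x)"
      by (rule lagrange_anti)
    also have "\<dots> = - ((\<Sum>i<l. single 0 (?b i * ?c i)) + (\<Sum>i<l. single 0 (- (?a i * ?d i))))"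
      unfolding g lagrange_add_right lsum by (simp add: c mult_single)
    also have "\<dots> = single 0 (\<Sum>i<l. (- ?b i) * ?c i - (- ?a i) * ?d i)"
      by (simp add: single_sum single_uminus single_add single_diff sum.distrib sum_negf sum_subtractf)
    also have "(\<Sum>i<l. (- ?b i) * ?c i - (- ?a i) * ?d i) = lam (bracket G x y)"
    proof -
      have m: "lam (bracket G x a) = - lam (bracket G a x)" if a: "a \<in> piece G (-1)" for a
        using bracket_anti[of x a] lam_scale[of "bracket G a x" "-1"] bracket_piece[OF a xy(1), of "-2"]
          a xy by (simp add: piece_carrier)
      show ?thesis unfolding lam_bracket[OF xy]
        by (rule sum.cong) (simp_all add: m e_X e_Y)
    qed
    finally show ?thesis using 5 by (simp add: gen_fun_0)
  qed
qed

text \<open>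
  Both sides have the same derivatives along the contact fields with generating functions
  \<open>x\<^sub>i\<close>, \<open>y\<^sub>i\<close> and \<open>1\<close>, by induction and the Jacobi identity, so they differ by
  a constant; only in total weight zero can this constant be nonzero.
\<close>

lemma lagrange_gen_fun:
  assumes "x \<in> piece G (w - 2)" "y \<in> piece G (v - 2)"
  shows "lagrange l (gen_fun w x) (gen_fun v y) = gen_fun (w + v - 2) (bracket G x y)"
proof -
  have "\<And>w v x y. w + v - 2 < int n \<Longrightarrow> x \<in> piece G (w - 2) \<Longrightarrow> y \<in> piece G (v - 2) \<Longrightarrow>
      lagrange l (gen_fun w x) (gen_fun v y) = gen_fun (w + v - 2) (bracket G x y)" for n
  proof (induction n)
    case 0
    then show ?case
      using homog_negative[OF homog_lagrange[OF gen_fun_homog[of w x] gen_fun_homog[of v y]]]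
      by (simp add: gen_fun_negative)
  next
    case (Suc n)
    note x = \<open>x \<in> piece G (w - 2)\<close> and y = \<open>y \<in> piece G (v - 2)\<close>
    have xy: "x \<in> carrier G" "y \<in> carrier G" using x y by (auto intro: piece_carrier)
    let ?D = "gen_fun (w + v - 2) (bracket G x y) - lagrange l (gen_fun w x) (gen_fun v y)"
    have bxy: "bracket G x y \<in> piece G (w + v - 2 - 2)"
      by (rule bracket_piece[OF x y]) simp
    have D: "?D \<in> polys l" by (intro polys_diff gen_fun_polys lagrange_polys)
    have hD: "homog (w + v - 2) ?D" by (intro homog_diff gen_fun_homog homog_lagrange)
    show ?case
    proof (cases "w + v = 2")
      case True
      then show ?thesis using lagrange_gen_fun_base[OF True x y] by simp
    next
      case False
      have step: "lagrange l f ?D = 0"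
        if f: "f \<in> polys l" and k: "k > 0"
          and a: "a \<in> piece G (- k)"
          and f_gen_fun: "\<And>w x. x \<in> piece G (w - 2) \<Longrightarrow> lagrange l f (gen_fun w x) = gen_fun (w - k) (bracket G a x)"
        for f k a
      proof -
        have ac: "a \<in> carrier G" using a by (rule piece_carrier)
        have ax: "bracket G a x \<in> piece G (w - k - 2)" and ay: "bracket G a y \<in> piece G (v - k - 2)"
          by (simp_all add: bracket_piece[OF a x] bracket_piece[OF a y])
        have "lagrange l f (lagrange l (gen_fun w x) (gen_fun v y))
          = lagrange l (gen_fun (w - k) (bracket G a x)) (gen_fun v y)
          + lagrange l (gen_fun w x) (gen_fun (v - k) (bracket G a y))"
          by (simp add: lagrange_derivation f gen_fun_polys f_gen_fun x y)
        also have "\<dots> = gen_fun (w - k + v - 2) (bracket G (bracket G a x) y)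
          + gen_fun (w + (v - k) - 2) (bracket G x (bracket G a y))"
          using k Suc.prems(1) by (simp add: Suc.IH ax ay x y)
        also have "\<dots> = gen_fun (w + v - 2 - k) (bracket G (bracket G a x) y + bracket G x (bracket G a y))"
          using bracket_piece[OF ax y, of "w + v - 2 - k - 2"] bracket_piece[OF x ay, of "w + v - 2 - k - 2"]
          by (simp add: gen_fun_add algebra_simps)
        also have "\<dots> = gen_fun (w + v - 2 - k) (bracket G a (bracket G x y))"
          by (simp only: bracket_derivation[OF ac xy])
        also have "\<dots> = lagrange l f (gen_fun (w + v - 2) (bracket G x y))"
          by (rule f_gen_fun[OF bxy, symmetric])
        finally show ?thesis by (simp add: lagrange_diff_right)
      qed
      have Z: "partial_deriv Zc ?D = 0"
        using step[of 1 2 "e Zc"] lagrange_coord_gen_fun(3) e_Z D by (simp add: lagrange_one)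
      have "?D = single 0 (lookup ?D 0)"
      proof (rule constant_if_partial_derivs_zero[OF D])
        fix u assume u: "u \<in> coords l"
        show "partial_deriv u ?D = 0"
        proof (cases u)
          case (Xc i)
          then show ?thesis
            using u step[of "coord_poly (Yc i)" 1 "e (Yc i)"] lagrange_coord_gen_fun(2) e_Y D
            by (simp add: lagrange_Yc polys_coord)
        next
          case (Yc i)
          then show ?thesis
            using u step[of "coord_poly (Xc i)" 1 "e (Xc i)"] lagrange_coord_gen_fun(1) e_X D Z
            by (simp add: lagrange_Xc polys_coord)
        next
          case Zc
          then show ?thesis using Z by simp
        qed
      qed
      moreover have "lookup ?D 0 = 0"
      proof (rule ccontr)
        assume "lookup ?D 0 \<noteq> 0"
        then have "0 \<in> keys ?D" by (simp only: in_keys_iff) simp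
        with hD have "int (monom_weight 0) = w + v - 2" unfolding homog_def by blast
        with False show False by simp
      qed
      ultimately show ?thesis by simp
    qed
  qed
  from this[of w v "nat (w + v - 2) + 1", OF _ assms] show ?thesis by simp
qed

lemma gen_fun_1_e:
  assumes "j < l"
  shows "gen_fun 1 (e (Xc j)) = coord_poly (Xc j)" "gen_fun 1 (e (Yc j)) = coord_poly (Yc j)"
proof -
  have lam0: "lam 0 = 0" using lam_add[of 0 0] piece_closed(1) by simp
  have YX: "lam (bracket G (e (Yc i)) (e (Xc j))) = (if i = j then -1 else 0)" if "i < l" for i
    using bracket_anti[of "e (Yc i)" "e (Xc j)"] assms that lam_scale[OF e_Z, of "-1"]
    by (simp add: e_carrier XY lam0 lam_Z)
  have XYl: "lam (bracket G (e (Xc i)) (e (Yc j))) = (if i = j then 1 else 0)" if "i < l" for i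
    using assms that by (simp add: XY lam0 lam_Z)
  have 1: "(\<Sum>i<l. coord_poly (Xc i) * single 0 (- lam (bracket G (e (Yc i)) (e (Xc j)))))
     = (\<Sum>i<l. if i = j then coord_poly (Xc j) else 0)"
    by (rule sum.cong) (simp_all add: YX)
  have 2: "(\<Sum>i<l. coord_poly (Yc i) * single 0 (lam (bracket G (e (Xc i)) (e (Yc j)))))
     = (\<Sum>i<l. if i = j then coord_poly (Yc j) else 0)"
    by (rule sum.cong) (simp_all add: XYl)
  show "gen_fun 1 (e (Xc j)) = coord_poly (Xc j)" "gen_fun 1 (e (Yc j)) = coord_poly (Yc j)"
    using 1 2 assms
    by (simp_all add: gen_fun_euler sum_coords gen_fun_0 gen_fun_negative single_uminus XX YY lam0)
qed

end

section \<open>Two commuting Heisenberg algebras\<close>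

text \<open>
  The negative part of \<open>G\<close> is the sum of two Heisenberg algebras, indexed by \<open>bool\<close>. The assumptions only
  speak of brackets of elements of negative degree, so that they can be moved along isomorphisms of negative parts.
\<close>

locale double_heisenberg = graded_lie_algebra G for G :: "'a::ab_group_add graded_lie" (structure) +
  fixes l :: nat and e :: "bool \<Rightarrow> coord \<Rightarrow> 'a" and lam :: "bool \<Rightarrow> 'a \<Rightarrow> complex"
  assumes l_pos: "l > 0"
    and depth_two: "p < -2 \<Longrightarrow> piece G p = {0}"
    and gen_X: "i < l \<Longrightarrow> e b (Xc i) \<in> piece G (-1)"
    and gen_Y: "i < l \<Longrightarrow> e b (Yc i) \<in> piece G (-1)"
    and center: "e b Zc \<in> piece G (-2)"
    and bracket_XX: "i < l \<Longrightarrow> j < l \<Longrightarrow> bracket G (e b (Xc i)) (e b (Xc j)) = 0"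
    and bracket_YY: "i < l \<Longrightarrow> j < l \<Longrightarrow> bracket G (e b (Yc i)) (e b (Yc j)) = 0"
    and bracket_XY: "i < l \<Longrightarrow> j < l \<Longrightarrow> bracket G (e b (Xc i)) (e b (Yc j)) = (if i = j then e b Zc else 0)"
    and lam_additive: "x \<in> piece G (-2) \<Longrightarrow> y \<in> piece G (-2) \<Longrightarrow> lam b (x + y) = lam b x + lam b y"
    and lam_homogeneous: "x \<in> piece G (-2) \<Longrightarrow> lam b (scal G c x) = c * lam b x"
    and lam_center: "lam b (e b Zc) = 1"
    and lam_bracket_expansion: "s \<in> piece G (-1) \<Longrightarrow> t \<in> piece G (-1) \<Longrightarrow> lam b (bracket G s t) =
        (\<Sum>i<l. lam b (bracket G s (e b (Yc i))) * lam b (bracket G (e b (Xc i)) t)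
             - lam b (bracket G s (e b (Xc i))) * lam b (bracket G (e b (Yc i)) t))"
    and lam_cross: "s \<in> piece G (-1) \<Longrightarrow> i < l \<Longrightarrow> u \<in> {Xc i, Yc i} \<Longrightarrow>
        lam b (bracket G s (e (\<not> b) u)) = 0"
    and center_decomp: "x \<in> piece G (-2) \<Longrightarrow>
        x = scal G (lam True x) (e True Zc) + scal G (lam False x) (e False Zc)"
    and bracket_nondeg: "s \<in> piece G (-1) \<Longrightarrow> (\<And>t. t \<in> piece G (-1) \<Longrightarrow> bracket G s t = 0) \<Longrightarrow> s = 0"
begin

lemma gen_XY: "i < l \<Longrightarrow> u \<in> {Xc i, Yc i} \<Longrightarrow> e b u \<in> piece G (-1)"
  by (elim insertE emptyE) (simp_all only: gen_X gen_Y)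

text \<open>
  The center of the other summand is spanned by a bracket of two of its elements, hence an element
  of degree zero cannot move it out of that summand.
\<close>

lemma lam_degree_0_cross:
  assumes x: "x \<in> piece G 0"
  shows "lam b (bracket G x (e (\<not> b) Zc)) = 0"
proof -
  let ?X = "e (\<not> b) (Xc 0)" and ?Y = "e (\<not> b) (Yc 0)"
  have XY: "?X \<in> piece G (-1)" "?Y \<in> piece G (-1)" using l_pos gen_X gen_Y by auto
  have c: "?X \<in> carrier G" "?Y \<in> carrier G" "x \<in> carrier G" using XY x by (auto intro: piece_carrier)
  have p: "bracket G x ?X \<in> piece G (-1)" "bracket G x ?Y \<in> piece G (-1)"
    using bracket_piece[OF x XY(1)] bracket_piece[OF x XY(2)] by auto
  have "bracket G x (e (\<not> b) Zc) = bracket G x (bracket G ?X ?Y)"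
    using bracket_XY[of 0 0 "\<not> b"] l_pos by simp
  also have "\<dots> = bracket G (bracket G x ?X) ?Y + bracket G ?X (bracket G x ?Y)"
    by (rule bracket_derivation[OF c(3,1,2)])
  also have "bracket G ?X (bracket G x ?Y) = scal G (-1) (bracket G (bracket G x ?Y) ?X)"
    using bracket_anti[of ?X "bracket G x ?Y"] c by (simp add: carrier_closed)
  finally show ?thesis
    using lam_additive[of "bracket G (bracket G x ?X) ?Y" "scal G (-1) (bracket G (bracket G x ?Y) ?X)" b]
      bracket_piece[OF p(1) XY(2), of "-2"] bracket_piece[OF p(2) XY(1), of "-2"]
      lam_homogeneous[of "bracket G (bracket G x ?Y) ?X" b "-1"]
      lam_cross[OF p(1), of 0 "Yc 0" b] lam_cross[OF p(2), of 0 "Xc 0" b] l_pos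
    by (simp add: piece_closed)
qed

lemma lam_center_cross: "lam b (e (\<not> b) Zc) = 0"
  using lam_cross[of "e (\<not> b) (Xc 0)" 0 "Yc 0" b] bracket_XY[of 0 0 "\<not> b"] gen_X[of 0] l_pos by simp

lemma heisenberg_frame: "heisenberg_frame G l (e b) (lam b)"
proof (intro heisenberg_frame.intro heisenberg_frame_axioms.intro)
  fix x y assume x: "x \<in> piece G 0" and y: "y \<in> piece G (-2)"
  have c: "x \<in> carrier G" "e b' Zc \<in> carrier G" for b' using x center by (auto intro: piece_carrier)
  have p: "bracket G x (e b' Zc) \<in> piece G (-2)" for b'
    using bracket_piece[OF x center, of "-2"] by simp
  have "y = scal G (lam b y) (e b Zc) + scal G (lam (\<not> b) y) (e (\<not> b) Zc)"
    using center_decomp[OF y] by (cases b) (auto simp: add.commute)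
  then have "bracket G x y = bracket G x (scal G (lam b y) (e b Zc) + scal G (lam (\<not> b) y) (e (\<not> b) Zc))"
    by (rule arg_cong)
  also have "\<dots> = scal G (lam b y) (bracket G x (e b Zc)) + scal G (lam (\<not> b) y) (bracket G x (e (\<not> b) Zc))"
    using c by (simp add: bracket_add_right bracket_scale_right carrier_closed)
  finally show "lam b (bracket G x y) = lam b (bracket G x (e b Zc)) * lam b y"
    using p by (simp add: lam_additive lam_homogeneous piece_closed lam_degree_0_cross[OF x])
qed (fact graded_lie_algebra_axioms depth_two gen_X gen_Y center bracket_XX bracket_YY bracket_XY lam_additive lam_homogeneous lam_center lam_bracket_expansion)+

sublocale frame: heisenberg_frame G l "e b" "lam b" for b by (rule heisenberg_frame)

abbreviation gf :: "bool \<Rightarrow> int \<Rightarrow> 'a \<Rightarrow> cpoly" where "gf \<equiv> frame.gen_fun"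

text \<open>
  The maps \<open>gf b\<close> respect brackets. So if they vanish on \<open>x\<close>, they vanish on all brackets of \<open>x\<close> with
  degree \<open>-1\<close>, with elements of both summands. These brackets are zero by induction, and transitivity or
  nondegeneracy gives \<open>x = 0\<close>.
\<close>

lemma gf_injective:
  assumes trans: "\<And>p x. p \<ge> 0 \<Longrightarrow> x \<in> piece G p \<Longrightarrow> (\<And>s. s \<in> piece G (-1) \<Longrightarrow> bracket G x s = 0) \<Longrightarrow> x = 0"
    and "x \<in> piece G p" "\<And>b. gf b (p + 2) x = 0"
  shows "x = 0"
  using assms(2,3)
\<comment> \<open>the hypothesis is only used above degree \<open>-2\<close>, where this measure is positive\<close>
proof (induction p arbitrary: x rule: measure_induct_rule[of "\<lambda>p. nat (p + 3)"])
  case (less p)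
  note x = \<open>x \<in> piece G p\<close>
  consider "p < -2" | "p = -2" | "p > -2" by linarith
  then show ?case
  proof cases
    case 1
    then show ?thesis using depth_two x by simp
  next
    case 2
    then have "single 0 (lam b x) = (0 :: cpoly)" for b using less.prems(2)[of b] by (simp add: frame.gen_fun_0)
    then have "lam b x = 0" for b by (metis lookup_single_eq lookup_zero)
    then show ?thesis using center_decomp[of x] x 2 by simp
  next
    case 3
    have comm: "bracket G x s = 0" if s: "s \<in> piece G (-1)" for s
    proof -
      have sx: "bracket G s x \<in> piece G (p - 1)" by (rule bracket_piece[OF s x]) simp
      have "gf b (p - 1 + 2) (bracket G s x) = 0" for b
        using frame.lagrange_gen_fun[of s 1 x "p + 2" b] s x less.prems(2)[of b] by simp
      then have "bracket G s x = 0" using less.IH[of "p - 1" "bracket G s x"] 3 sx by simp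
      then show ?thesis using bracket_anti[of x s] s x by (simp add: piece_carrier)
    qed
    show ?thesis
    proof (cases "p = -1")
      case True
      then show ?thesis using bracket_nondeg[of x] x comm by simp
    next
      case False
      then show ?thesis using trans[of p x] 3 x comm by simp
    qed
  qed
qed

text \<open>
  A transitive graded Lie algebra with this negative part embeds into the sum of two contact algebras,
  by the generating functions with respect to the two frames.
\<close>

lemma double_contact_embedding:
  assumes trans: "\<And>p x. p \<ge> 0 \<Longrightarrow> x \<in> piece G p \<Longrightarrow> (\<And>s. s \<in> piece G (-1) \<Longrightarrow> bracket G x s = 0) \<Longrightarrow> x = 0"
  shows "\<exists>f. graded_hom G (lie_direct_sum (contact_algebra l) (contact_algebra l)) f \<and>
    inj_on f (carrier G) \<and>
    (\<forall>p. \<forall>x\<in>piece G p. f x = (ham l (gf True (p + 2) x), ham l (gf False (p + 2) x)))"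
proof -
  let ?S = "lie_direct_sum (contact_algebra l) (contact_algebra l)"
  let ?f = "\<lambda>p x. (ham l (gf True (p + 2) x), ham l (gf False (p + 2) x))"
  have piece: "?f p x \<in> piece ?S p" for p x
    by (simp add: lie_direct_sum_simps contact_piece frame.gen_fun_polys frame.gen_fun_homog)
  have add: "?f p (x + y) = ?f p x + ?f p y" if "x \<in> piece G p" "y \<in> piece G p" for p x y
    using that by (simp add: frame.gen_fun_add ham_add)
  have scale: "?f p (scal G c x) = scal ?S c (?f p x)" if "x \<in> piece G p" for p c x
    using that by (simp add: frame.gen_fun_scale ham_scale lie_direct_sum_simps contact_algebra_simps)
  have bracket: "?f (p + r) (bracket G x y) = bracket ?S (?f p x) (?f r y)"
    if x: "x \<in> piece G p" and y: "y \<in> piece G r" for p r x y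
  proof -
    have "vf_bracket (ham l (gf b (p + 2) x)) (ham l (gf b (r + 2) y)) = ham l (gf b (p + r + 2) (bracket G x y))" for b
      using frame.lagrange_gen_fun[of x "p + 2" y "r + 2" b] x y
      by (simp add: bracket_ham frame.gen_fun_polys add.commute add.left_commute)
    then show ?thesis by (simp only: lie_direct_sum_simps contact_algebra_simps fst_conv snd_conv)
  qed
  have inj: "x = 0" if x: "x \<in> piece G p" and 0: "?f p x = 0" for p x
  proof (rule gf_injective[OF trans x])
    show "gf b (p + 2) x = 0" for b using 0 by (cases b) (simp_all add: zero_prod_def)
  qed
  show ?thesis
    by (rule graded_hom_from_pieces[of G ?S ?f, OF graded_lie_algebra_axioms
      lie_direct_sum_graded_lie[OF contact_graded_lie contact_graded_lie] piece add scale bracket inj])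
qed

lemma gf_cross:
  assumes "i < l" "u \<in> {Xc i, Yc i}"
  shows "gf b 1 (e (\<not> b) u) = 0"
proof -
  have "lam b (bracket G (e b (Xc j)) (e (\<not> b) u)) = 0" "lam b (bracket G (e b (Yc j)) (e (\<not> b) u)) = 0"
    if "j < l" for j
    by (rule lam_cross[OF gen_X[OF that] assms], rule lam_cross[OF gen_Y[OF that] assms])
  then show ?thesis
    by (simp add: frame.gen_fun_euler sum_coords frame.gen_fun_0 frame.gen_fun_negative)
qed

text \<open>
  The coefficients are the derivatives, by the Euler formula for linear functions; each summand of degree
  \<open>-1\<close> only contributes to its own function.
\<close>

lemma gf_degree_minus_one_surjective:
  assumes F: "\<And>b. F b \<in> polys l" "\<And>b. homog 1 (F b)"
  obtains x where "x \<in> piece G (-1)" "\<And>b. gf b 1 x = F b"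
proof
  define a where "a b u = lookup (partial_deriv u (F b)) 0" for b u
  define y where "y b = (\<Sum>i<l. scal G (a b (Xc i)) (e b (Xc i))) + (\<Sum>i<l. scal G (a b (Yc i)) (e b (Yc i)))" for b
  have p: "scal G c (e b (Xc i)) \<in> piece G (-1)" "scal G c (e b (Yc i)) \<in> piece G (-1)" if "i < l" for c b i
    using that by (simp_all add: piece_closed(4) gen_X gen_Y)
  have sums: "(\<Sum>i<l. scal G (a b (Xc i)) (e b (Xc i))) \<in> piece G (-1)"
    "(\<Sum>i<l. scal G (a b (Yc i)) (e b (Yc i))) \<in> piece G (-1)" for b
    by (rule piece_closed(6), simp add: p)+
  have y: "y b \<in> piece G (-1)" for b
    unfolding y_def by (intro piece_closed(2) sums)
  show "y True + y False \<in> piece G (-1)" by (intro piece_closed(2) y)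
  have gfy: "gf c 1 (y b) = (\<Sum>i<l. single 0 (a b (Xc i)) * gf c 1 (e b (Xc i)))
      + (\<Sum>i<l. single 0 (a b (Yc i)) * gf c 1 (e b (Yc i)))" for b c
  proof -
    have "gf c 1 (y b) = gf c 1 (\<Sum>i<l. scal G (a b (Xc i)) (e b (Xc i)))
        + gf c 1 (\<Sum>i<l. scal G (a b (Yc i)) (e b (Yc i)))"
      unfolding y_def by (rule frame.gen_fun_add) (simp_all add: sums)
    also have "gf c 1 (\<Sum>i<l. scal G (a b (Xc i)) (e b (Xc i))) = (\<Sum>i<l. gf c 1 (scal G (a b (Xc i)) (e b (Xc i))))"
      by (rule frame.gen_fun_sum) (simp add: p)
    also have "gf c 1 (\<Sum>i<l. scal G (a b (Yc i)) (e b (Yc i))) = (\<Sum>i<l. gf c 1 (scal G (a b (Yc i)) (e b (Yc i))))"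
      by (rule frame.gen_fun_sum) (simp add: p)
    finally show ?thesis by (simp add: frame.gen_fun_scale gen_X gen_Y)
  qed
  have same: "gf b 1 (y b) = F b" for b
  proof -
    have const: "partial_deriv u (F b) = single 0 (a b u)" if "coord_weight u = 1" for u
      using homog_degree_0[of "partial_deriv u (F b)"] homog_partial_deriv[OF F(2), of u b] that
      by (simp add: a_def)
    have Z: "partial_deriv Zc (F b) = 0"
      using homog_negative[OF homog_partial_deriv[OF F(2), of Zc b]] by simp
    have "F b = (\<Sum>i<l. coord_poly (Xc i) * single 0 (a b (Xc i))) + (\<Sum>i<l. coord_poly (Yc i) * single 0 (a b (Yc i)))"
      using weighted_euler[OF F, of b] by (simp add: sum_coords const Z)
    then show ?thesis by (simp add: gfy frame.gen_fun_1_e mult.commute)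
  qed
  have cross: "gf b 1 (y (\<not> b)) = 0" for b
    by (simp add: gfy gf_cross[of _ "Xc _"] gf_cross[of _ "Yc _"])
  show "gf b 1 (y True + y False) = F b" for b
    using frame.gen_fun_add[of "y True" 1 "y False" b] y same[of b] cross[of b] by (cases b) simp_all
qed

text \<open>If there is nothing in nonnegative degree, the embedding fills the negative part.\<close>

lemma graded_iso_double_heisenberg:
  assumes nonneg: "\<And>p. p \<ge> 0 \<Longrightarrow> piece G p = {0}"
  shows "graded_iso G (lie_direct_sum (heisenberg_algebra l) (heisenberg_algebra l))"
proof -
  let ?C = "contact_algebra l" and ?H = "heisenberg_algebra l"
  let ?S = "lie_direct_sum ?C ?C" and ?T = "lie_direct_sum ?H ?H"
  note S = lie_direct_sum_graded_lie[OF contact_graded_lie contact_graded_lie, of l l]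
  interpret S: graded_lie_algebra ?S by (rule S)
  have T: "?T = negative_part ?S"
    by (simp add: negative_part_direct_sum contact_graded_lie heisenberg_algebra_def)
  have "\<exists>f. graded_hom G ?S f \<and> inj_on f (carrier G) \<and>
      (\<forall>p. \<forall>x\<in>piece G p. f x = (ham l (gf True (p + 2) x), ham l (gf False (p + 2) x)))"
    by (rule double_contact_embedding) (simp add: nonneg)
  then obtain f where hom: "graded_hom G ?S f" and inj: "inj_on f (carrier G)"
    and f: "\<And>p x. x \<in> piece G p \<Longrightarrow> f x = (ham l (gf True (p + 2) x), ham l (gf False (p + 2) x))"
    by blast
  have f0: "f 0 = 0" by (rule graded_hom_zero[OF graded_lie_algebra_axioms hom])
  have into: "f x \<in> carrier ?T" if x: "x \<in> carrier G" for x
  proof -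
    have "component ?S (f x) p = 0" if "p \<ge> 0" for p
      using graded_hom_component[OF graded_lie_algebra_axioms S hom x, of p] component_piece[OF x, of p]
        nonneg[OF that] f0 by simp
    then show ?thesis
      unfolding T S.negative_part_carrier using graded_homD(1)[OF hom x] by simp
  qed
  have onto_piece: "\<exists>x\<in>carrier G. f x = z" if z: "z \<in> piece ?S p" and p: "p < 0" for z p
  proof -
    obtain F1 F2 where F: "z = (ham l F1, ham l F2)" "F1 \<in> polys l" "F2 \<in> polys l"
      "homog (p + 2) F1" "homog (p + 2) F2"
      using z by (auto simp: lie_direct_sum_simps contact_piece)
    consider "p < -2" | "p = -2" | "p = -1" using p by linarith
    then show ?thesis
    proof cases
      case 1
      then have "F1 = 0" "F2 = 0" using F homog_negative[of "p + 2"] by auto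
      then have "f 0 = z" using F f0 by (simp add: zero_prod_def)
      then show ?thesis using carrier_closed(1) by blast
    next
      case 2
      let ?x = "scal G (lookup F1 0) (e True Zc) + scal G (lookup F2 0) (e False Zc)"
      have x: "?x \<in> piece G (-2)" by (intro piece_closed(2,4) center)
      have "lam True ?x = lookup F1 0" "lam False ?x = lookup F2 0"
        using lam_center_cross[of True] lam_center_cross[of False]
        by (simp_all add: lam_additive lam_homogeneous piece_closed center lam_center)
      moreover have "F1 = single 0 (lookup F1 0)" "F2 = single 0 (lookup F2 0)"
        using homog_degree_0[of F1] homog_degree_0[of F2] F 2 by auto
      ultimately have "f ?x = z" using f[OF x] F(1) by (simp add: frame.gen_fun_0)
      then show ?thesis using x piece_carrier by blast
    next
      case 3
      define F' where "F' b = (if b then F1 else F2)" for b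
      have "F' b \<in> polys l" "homog 1 (F' b)" for b using F 3 by (auto simp: F'_def)
      then obtain x where x: "x \<in> piece G (-1)" "\<And>b. gf b 1 x = F' b"
        using gf_degree_minus_one_surjective[of F'] by blast
      then have "f x = z" using f[OF x(1)] F(1) by (simp add: F'_def)
      then show ?thesis using x piece_carrier by blast
    qed
  qed
  have onto: "z \<in> f ` carrier G" if z: "z \<in> carrier ?T" for z
  proof -
    have zS: "z \<in> carrier ?S" using z unfolding T S.negative_part_carrier by blast
    have zneg: "component ?S z p = 0" if "p \<ge> 0" for p
      using z that unfolding T S.negative_part_carrier by blast
    let ?J = "{p. component ?S z p \<noteq> 0}"
    define x where "x p = (SOME x. x \<in> carrier G \<and> f x = component ?S z p)" for p
    have x: "x p \<in> carrier G \<and> f (x p) = component ?S z p" if "p \<in> ?J" for p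
    proof -
      have "p < 0"
      proof (rule ccontr)
        assume "\<not> p < 0"
        then have "component ?S z p = 0" by (intro zneg) simp
        with that show False by simp
      qed
      then have "\<exists>x. x \<in> carrier G \<and> f x = component ?S z p"
        using onto_piece[OF S.component_piece[OF zS]] by blast
      then show ?thesis unfolding x_def by (rule someI_ex)
    qed
    have "f (\<Sum>p\<in>?J. x p) = (\<Sum>p\<in>?J. f (x p))"
      by (rule graded_hom_sum[OF graded_lie_algebra_axioms hom]) (rule conjunct1[OF x])
    also have "\<dots> = (\<Sum>p\<in>?J. component ?S z p)"
      by (rule sum.cong[OF refl]) (rule conjunct2[OF x])
    also have "\<dots> = z" by (rule S.sum_component[OF zS S.finite_component[OF zS] subset_refl])
    finally have "z = f (\<Sum>p\<in>?J. x p)" by (rule sym)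
    moreover have "(\<Sum>p\<in>?J. x p) \<in> carrier G" by (rule carrier_closed(6)) (rule conjunct1[OF x])
    ultimately show ?thesis by (rule image_eqI)
  qed
  have fT: "f x \<in> piece ?T p" if x: "x \<in> piece G p" for x p
  proof (cases "p < 0")
    case True
    then show ?thesis using graded_homD(5)[OF hom x] by (simp add: T S.negative_part_simps)
  next
    case False
    then have "x = 0" using nonneg[of p] x by simp
    with False show ?thesis by (simp add: T S.negative_part_simps f0)
  qed
  have "scal ?T = scal ?S" "bracket ?T = bracket ?S" unfolding T by (rule S.negative_part_simps)+
  then have "graded_hom G ?T f"
    unfolding graded_hom_def
    by (intro conjI ballI allI) (simp_all only: into graded_homD(2-4)[OF hom] fT)
  moreover have "bij_betw f (carrier G) (carrier ?T)"
    unfolding bij_betw_def using inj into onto by blast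
  moreover have "graded_lie_algebra ?T" unfolding T by (rule S.negative_part_graded_lie)
  ultimately show ?thesis
    unfolding graded_iso_def using graded_lie_algebra_axioms by blast
qed

text \<open>
  Pull the frame back along the inverse of the isomorphism, and the coordinates along the isomorphism itself.
\<close>

lemma frame_transfer:
  fixes G' :: "'b::ab_group_add graded_lie"
  assumes G': "graded_lie_algebra G'" and iso: "graded_iso (negative_part G') G"
  shows "\<exists>e' lam'. double_heisenberg G' l e' lam'"
proof -
  interpret H: graded_lie_algebra G' by fact
  let ?N = "negative_part G'"
  interpret N: graded_lie_algebra ?N by (rule H.negative_part_graded_lie)
  obtain f where f: "graded_hom ?N G f" and bij: "bij_betw f (carrier ?N) (carrier G)"
    using iso by (auto simp: graded_iso_def)
  define g where "g = inv_into (carrier ?N) f"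
  have g: "graded_hom G ?N g"
    unfolding g_def by (rule graded_hom_inverse[OF N.graded_lie_algebra_axioms graded_lie_algebra_axioms f bij])
  have fg: "f (g x) = x" if "x \<in> carrier G" for x
    using that bij by (simp add: g_def bij_betw_def f_inv_into_f)
  have gf': "g (f x) = x" if "x \<in> carrier ?N" for x
    using that bij by (simp add: g_def bij_betw_def)
  have f0: "f 0 = 0" by (rule graded_hom_zero[OF N.graded_lie_algebra_axioms f])
  have g0: "g 0 = 0" by (rule graded_hom_zero[OF graded_lie_algebra_axioms g])
  note fD = graded_homD[OF f, unfolded H.negative_part_simps(1,2)]
  note gD = graded_homD[OF g, unfolded H.negative_part_simps(1,2)]
  have Np: "piece ?N p = piece G' p" if "p < 0" for p using that by (simp add: H.negative_part_simps)
  have Nc: "x \<in> carrier ?N" if "x \<in> piece G' p" "p < 0" for x p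
    using that Np N.piece_carrier by blast
  have fp: "f x \<in> piece G p" if "x \<in> piece G' p" "p < 0" for x p
    using that fD(5)[of x p] Np by simp
  have gp: "g x \<in> piece G' p" if "x \<in> piece G p" "p < 0" for x p
    using that gD(5)[of x p] Np by simp
  have br: "bracket G' (g x) (g y) = g (bracket G x y)" if "x \<in> piece G (-1)" "y \<in> piece G (-1)" for x y
    using gD(4)[of x y] that piece_carrier by auto
  have f_br: "f (bracket G' s t) = bracket G (f s) (f t)"
    if "s \<in> piece G' (-1)" "t \<in> piece G' (-1)" for s t
    using fD(4)[of s t] that Nc by auto
  have f_br_g: "f (bracket G' s (g t)) = bracket G (f s) t" "f (bracket G' (g t) s) = bracket G t (f s)"
    if "s \<in> piece G' (-1)" "t \<in> piece G (-1)" for s t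
    using f_br[OF that(1) gp[OF that(2)]] f_br[OF gp[OF that(2)] that(1)] fg[OF piece_carrier[OF that(2)]]
    by simp_all
  have "double_heisenberg G' l (\<lambda>b u. g (e b u)) (\<lambda>b x. lam b (f x))"
  proof (intro double_heisenberg.intro double_heisenberg_axioms.intro)
    show "graded_lie_algebra G'" by (rule G')
    show "l > 0" by (rule l_pos)
    show "piece G' p = {0}" if "p < -2" for p
    proof -
      have "x = 0" if x: "x \<in> piece G' p" for x
      proof -
        have "f x = 0" using fp[OF x] depth_two[of p] \<open>p < -2\<close> by simp
        then show "x = 0" using gf'[OF Nc[OF x]] \<open>p < -2\<close> g0 by simp
      qed
      then show ?thesis using H.piece_closed(1) by blast
    qed
    show "x = scal G' (lam True (f x)) (g (e True Zc)) + scal G' (lam False (f x)) (g (e False Zc))"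
      if x: "x \<in> piece G' (-2)" for x
    proof -
      have ec: "e b Zc \<in> carrier G" for b using center piece_carrier by blast
      have "x = g (f x)" using gf'[OF Nc[OF x]] by simp
      also have "f x = scal G (lam True (f x)) (e True Zc) + scal G (lam False (f x)) (e False Zc)"
        by (rule center_decomp) (use fp[OF x] in simp)
      finally show ?thesis using ec by (simp add: gD(2,3) carrier_closed)
    qed
    show "s = 0" if s: "s \<in> piece G' (-1)" and 0: "\<And>t. t \<in> piece G' (-1) \<Longrightarrow> bracket G' s t = 0" for s
    proof -
      have "f s = 0"
      proof (rule bracket_nondeg)
        show "f s \<in> piece G (-1)" using fp[OF s] by simp
        show "bracket G (f s) t = 0" if "t \<in> piece G (-1)" for t
          using f_br_g(1)[OF s that] 0[OF gp[OF that]] f0 by simp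
      qed
      then show ?thesis using gf'[OF Nc[OF s]] g0 by simp
    qed
    show "lam b (f (bracket G' s t)) = (\<Sum>i<l.
        lam b (f (bracket G' s (g (e b (Yc i))))) * lam b (f (bracket G' (g (e b (Xc i))) t)) -
        lam b (f (bracket G' s (g (e b (Xc i))))) * lam b (f (bracket G' (g (e b (Yc i))) t)))"
      if s: "s \<in> piece G' (-1)" and t: "t \<in> piece G' (-1)" for s t b
      using lam_bracket_expansion[of "f s" "f t" b] fp[OF s] fp[OF t]
      by (simp add: f_br[OF s t] f_br_g[OF s] f_br_g[OF t] gen_X gen_Y)
    show "lam b (f (bracket G' s (g (e (\<not> b) u)))) = 0"
      if s: "s \<in> piece G' (-1)" and u: "i < l" "u \<in> {Xc i, Yc i}" for s i u b
    proof -
      have "e (\<not> b) u \<in> piece G (-1)" by (rule gen_XY[OF u])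
      then show ?thesis using lam_cross[of "f s" i u b] fp[OF s] u by (simp add: f_br_g[OF s])
    qed
    show "lam b (f (g (e b Zc))) = 1" for b
      using fg[OF piece_carrier[OF center]] lam_center by simp
    show "lam b (f (x + y)) = lam b (f x) + lam b (f y)"
      if x: "x \<in> piece G' (-2)" and y: "y \<in> piece G' (-2)" for x y b
      using lam_additive[of "f x" "f y" b] fp[OF x] fp[OF y] fD(2)[OF Nc[OF x] Nc[OF y]] by simp
    show "lam b (f (scal G' c x)) = c * lam b (f x)" if x: "x \<in> piece G' (-2)" for x b c
      using lam_homogeneous[of "f x" b c] fp[OF x] fD(3)[OF Nc[OF x]] by simp
  qed (simp_all add: gp gen_X gen_Y center br bracket_XX bracket_YY bracket_XY g0)
  then show ?thesis by blast
qed

lemma embedding_of_prolongation: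
  fixes G' :: "'b::ab_group_add graded_lie"
  assumes "transitive_prolongation G G'"
  shows "\<exists>f. graded_hom G' (lie_direct_sum (contact_algebra l) (contact_algebra l)) f \<and> inj_on f (carrier G')"
proof -
  from assms have G': "graded_lie_algebra G'" "graded_iso (negative_part G') G"
    and trans: "\<And>p x. p \<ge> 0 \<Longrightarrow> x \<in> piece G' p \<Longrightarrow> (\<forall>s\<in>piece G' (-1). bracket G' x s = 0) \<Longrightarrow> x = 0"
    by (auto simp: transitive_prolongation_def)
  from frame_transfer[OF G'] obtain e' lam' where "double_heisenberg G' l e' lam'" by blast
  then interpret H: double_heisenberg G' l e' lam' .
  show ?thesis using H.double_contact_embedding trans by blast
qed

text \<open>
  The algebra \<open>G\<close> with nothing in nonnegative degree is trivially transitive. So the embedding lemma applies to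
  it as well as to its prolongations, and identifies it with the negative part of the sum of contact algebras.
\<close>

lemma maximal_prolongation:
  assumes nonneg: "\<And>p. p \<ge> 0 \<Longrightarrow> piece G p = {0}"
  shows "maximal_transitive_prolongation TYPE('t::ab_group_add) G
    (lie_direct_sum (contact_algebra l) (contact_algebra l))"
  unfolding maximal_transitive_prolongation_def
  using double_contact_transitive_prolongation[OF l_pos graded_iso_double_heisenberg[OF nonneg]]
    embedding_of_prolongation by blast

end

section \<open>The Clifford action of vectors\<close>

lemma free_alg_ring: "ring (free_alg :: ('v word \<Rightarrow>\<^sub>0 complex) ring)"
proof (rule ringI)
  show "abelian_group (free_alg :: ('v word \<Rightarrow>\<^sub>0 complex) ring)"
    by (rule abelian_groupI) (auto simp: free_alg_def add.assoc add.commute intro: exI[of _ "- _"])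
  show "monoid (free_alg :: ('v word \<Rightarrow>\<^sub>0 complex) ring)"
    by (rule monoidI) (auto simp: free_alg_def mult.assoc)
qed (auto simp: free_alg_def distrib_left distrib_right)

lemma ideal_clifford: "ideal (clifford_ideal sc q) free_alg"
  unfolding clifford_ideal_def by (rule ring.genideal_ideal[OF free_alg_ring]) (simp add: free_alg_def)

lemma clifford_relation_in_ideal: "r \<in> clifford_relations sc q \<Longrightarrow> r \<in> clifford_ideal sc q"
  unfolding clifford_ideal_def
  using ring.genideal_self[OF free_alg_ring, of "clifford_relations sc q"] by (auto simp: free_alg_def)

context clifford_module
begin

abbreviation Cl where "Cl \<equiv> clifford_algebra scV q"

definition cl_class :: "('v word \<Rightarrow>\<^sub>0 complex) \<Rightarrow> 'v cliff" where
  "cl_class p = clifford_ideal scV q +>\<^bsub>free_alg\<^esub> p"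

text \<open>
  The action pulled back to noncommutative polynomials, where identities can be checked by computation.
\<close>

definition poly_act :: "('v word \<Rightarrow>\<^sub>0 complex) \<Rightarrow> 'w \<Rightarrow> 'w" where
  "poly_act p = act (cl_class p)"

lemma cl_class_hom: "cl_class \<in> ring_hom free_alg Cl"
  using ideal.rcos_ring_hom[OF ideal_clifford, of scV q]
  by (simp add: clifford_algebra_def cl_class_def[abs_def])

lemma cl_class_carrier: "cl_class p \<in> carrier Cl"
  using ring_hom_closed[OF cl_class_hom, of p] by (simp add: free_alg_def)

lemma carrier_Cl: "carrier Cl = range cl_class"
  by (auto simp: clifford_algebra_def cl_class_def FactRing_def A_RCOSETS_def' free_alg_def)

lemma poly_act_add: "poly_act (p + r) s = poly_act p s + poly_act r s"
  using ring_hom_add[OF cl_class_hom, of p r] act_add[OF cl_class_carrier cl_class_carrier, of p r s]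
  by (simp add: poly_act_def free_alg_def)

lemma poly_act_mult: "poly_act (p * r) s = poly_act p (poly_act r s)"
  using ring_hom_mult[OF cl_class_hom, of p r] act_mult[OF cl_class_carrier cl_class_carrier, of p r s]
  by (simp add: poly_act_def free_alg_def)

lemma poly_act_one: "poly_act 1 s = s"
  using ring_hom_one[OF cl_class_hom] act_one[of s] by (simp add: poly_act_def free_alg_def)

lemma poly_act_scalar: "poly_act (scalar c) s = scW c s"
  using act_scalar[of c s] by (simp add: poly_act_def cl_class_def cl_scalar_def)

lemma poly_act_zero: "poly_act 0 s = 0"
  using poly_act_add[of 0 0 s] by simp

lemma poly_act_diff: "poly_act (p - r) s = poly_act p s - poly_act r s"
  using poly_act_add[of "p - r" r s] by (simp add: algebra_simps)

lemma poly_act_linear: "Vector_Spaces.linear scW scW (poly_act p)"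
  unfolding poly_act_def by (rule act_linear[OF cl_class_carrier])

lemma poly_act_ideal:
  assumes "r \<in> clifford_ideal scV q"
  shows "poly_act r s = 0"
proof -
  interpret I: ideal "clifford_ideal scV q" free_alg by (rule ideal_clifford)
  have "0 \<in> clifford_ideal scV q"
    using additive_subgroup.zero_closed[OF ideal.axioms(1)[OF ideal_clifford], of scV q]
    by (simp add: free_alg_def)
  then have "cl_class r = cl_class 0"
    unfolding cl_class_def by (simp only: I.a_rcos_const assms)
  then show ?thesis using poly_act_zero by (simp add: poly_act_def)
qed

definition \<gamma> :: "'v \<Rightarrow> 'w \<Rightarrow> 'w" where
  "\<gamma> v s = act (cl_vec scV q v) s"

lemma \<gamma>_poly_act: "\<gamma> v s = poly_act (letter v) s"
  by (simp add: \<gamma>_def poly_act_def cl_class_def cl_vec_def)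

lemma \<gamma>_add: "\<gamma> v (s + t) = \<gamma> v s + \<gamma> v t"
  and \<gamma>_scale: "\<gamma> v (scW c s) = scW c (\<gamma> v s)"
  using poly_act_linear[of "letter v"] by (simp_all add: \<gamma>_poly_act Vector_Spaces.linear_iff)

lemma \<gamma>_zero [simp]: "\<gamma> v 0 = 0"
  using \<gamma>_add[of v 0 0] by simp

lemma \<gamma>_sum: "\<gamma> v (sum f A) = (\<Sum>a\<in>A. \<gamma> v (f a))"
  by (induction A rule: infinite_finite_induct) (simp_all add: \<gamma>_add)

lemma \<gamma>_vec_add: "\<gamma> (v + u) s = \<gamma> v s + \<gamma> u s"
proof -
  have "letter (v + u) - letter v - letter u \<in> clifford_ideal scV q"
    by (rule clifford_relation_in_ideal) (auto simp: clifford_relations_def)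
  from poly_act_ideal[OF this, of s]
  have "\<gamma> (v + u) s - \<gamma> v s - \<gamma> u s = 0" by (simp only: poly_act_diff \<gamma>_poly_act)
  then show ?thesis by (simp add: diff_diff_eq)
qed

lemma \<gamma>_vec_scale: "\<gamma> (scV c v) s = scW c (\<gamma> v s)"
proof -
  have "letter (scV c v) - scalar c * letter v \<in> clifford_ideal scV q"
    by (rule clifford_relation_in_ideal) (auto simp: clifford_relations_def)
  from poly_act_ideal[OF this, of s]
  have "\<gamma> (scV c v) s - scW c (\<gamma> v s) = 0" by (simp only: poly_act_diff poly_act_mult poly_act_scalar \<gamma>_poly_act)
  then show ?thesis by simp
qed

lemma clifford_relation: "\<gamma> v (\<gamma> u s) + \<gamma> u (\<gamma> v s) = scW (- 2 * q v u) s"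
proof -
  have "letter v * letter u + letter u * letter v + scalar (2 * q v u) \<in> clifford_ideal scV q"
    by (rule clifford_relation_in_ideal) (auto simp: clifford_relations_def)
  from poly_act_ideal[OF this, of s]
  have "\<gamma> v (\<gamma> u s) + \<gamma> u (\<gamma> v s) + scW (2 * q v u) s = 0"
    by (simp only: poly_act_add poly_act_mult poly_act_scalar \<gamma>_poly_act)
  then show ?thesis by (simp add: W.scale_minus_left eq_neg_iff_add_eq_0)
qed

text \<open>
  The vectors generate the Clifford algebra: every element is the class of a combination of words in them.
\<close>

lemma cl_submodule_iff:
  "cl_submodule scV q scW act U \<longleftrightarrow> W.subspace U \<and> (\<forall>v. \<forall>s\<in>U. \<gamma> v s \<in> U)"
proof
  assume U: "cl_submodule scV q scW act U"
  have "cl_vec scV q v \<in> carrier Cl" for v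
    using cl_class_carrier[of "letter v"] by (simp add: cl_class_def cl_vec_def)
  with U show "W.subspace U \<and> (\<forall>v. \<forall>s\<in>U. \<gamma> v s \<in> U)"
    by (auto simp: cl_submodule_def \<gamma>_def)
next
  assume *: "W.subspace U \<and> (\<forall>v. \<forall>s\<in>U. \<gamma> v s \<in> U)"
  have word: "poly_act (single (Word vs) 1) s \<in> U" if "s \<in> U" for vs s
  proof (induction vs)
    case Nil
    then show ?case using poly_act_one[of s] that by (simp add: zero_word_def[symmetric])
  next
    case (Cons v vs)
    have "single (Word (v # vs)) (1::complex) = letter v * single (Word vs) 1"
      by (simp add: mult_single)
    then show ?case using Cons * by (simp add: poly_act_mult \<gamma>_poly_act)
  qed
  have "poly_act p s \<in> U" if s: "s \<in> U" for p s
  proof (induction p rule: poly_mapping_single_induct)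
    case (single w c)
    have "single w c = scalar c * single w 1" by (simp add: mult_single)
    then show ?case using word[OF s] * by (cases w) (simp add: poly_act_mult poly_act_scalar W.subspace_scale)
  qed (use * in \<open>simp_all add: poly_act_zero poly_act_add W.subspace_0 W.subspace_add\<close>)
  with * show "cl_submodule scV q scW act U"
    by (auto simp: cl_submodule_def carrier_Cl poly_act_def)
qed

end

section \<open>Null bases of two-dimensional quadratic spaces\<close>

context quadratic_space
begin

lemma q_linear:
  "q (x + y) z = q x z + q y z" "q (scV c x) z = c * q x z"
  "q x (y + z) = q x y + q x z" "q x (scV c z) = c * q x z"
  using q_bilinear by (auto simp: bilinear_form_def Vector_Spaces.linear_iff)

lemma q_zero [simp]: "q 0 x = 0" "q x 0 = 0"
  using q_linear(2)[of 0 0 x] q_linear(4)[of x 0 0] by simp_all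

lemma q_diff: "q (x - y) z = q x z - q y z" "q x (y - z) = q x y - q x z"
  using q_linear(1)[of "x - y" y z] q_linear(3)[of x "y - z" z] by (simp_all add: algebra_simps)

lemma q_uminus: "q (- x) z = - q x z" "q x (- z) = - q x z"
  using q_diff(1)[of 0 x z] q_diff(2)[of x 0 z] by simp_all

lemma nondeg: "(\<And>y. q x y = 0) \<Longrightarrow> x = 0"
  using q_nondeg by (simp add: nondegenerate_form_def)

lemma no_three_independent:
  assumes dim: "dim UNIV = 2"
    and ind: "\<And>\<alpha> \<beta> \<gamma>. scV \<alpha> a + scV \<beta> b + scV \<gamma> c = 0 \<Longrightarrow> \<alpha> = 0 \<and> \<beta> = 0 \<and> \<gamma> = 0"
  shows False
proof -
  obtain B where B: "independent B" "UNIV \<subseteq> span B" "card B = 2"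
    using basis_exists[of UNIV] dim by metis
  have fin: "finite B" using B(3) card.infinite by fastforce
  have d: "a \<noteq> b" "a \<noteq> c" "b \<noteq> c"
    using ind[of 1 "-1" 0] ind[of 1 0 "-1"] ind[of 0 1 "-1"] by auto
  have "independent {a, b, c}"
  proof (rule independent_if_scalars_zero)
    fix f x assume "(\<Sum>x\<in>{a, b, c}. scV (f x) x) = 0" and x: "x \<in> {a, b, c}"
    then have "scV (f a) a + scV (f b) b + scV (f c) c = 0" using d by (simp add: add.assoc)
    from ind[OF this] x show "f x = 0" by auto
  qed simp
  from independent_span_bound[OF fin this] B(2) have "card {a, b, c} \<le> 2"
    by (auto simp: B(3))
  with d show False by simp
qed

text \<open>
  Take an orthogonal basis with \<open>(v, v) = 1\<close> and \<open>(u, u) = -1\<close>; then \<open>v + u\<close> and \<open>u - v\<close> are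
  null. The scaling \<open>(e1, e2) = -1/2\<close> makes the Clifford relation read \<open>e1 e2 + e2 e1 = 1\<close>.
\<close>

lemma null_basis_exists:
  assumes dim: "dim UNIV = 2"
  obtains e1 e2 where "q e1 e1 = 0" "q e2 e2 = 0" "q e1 e2 = - 1 / 2"
    "\<And>v. v = scV (- 2 * q v e2) e1 + scV (- 2 * q v e1) e2"
proof -
  have "\<exists>v. q v v \<noteq> 0"
  proof (rule ccontr)
    assume "\<not> (\<exists>v. q v v \<noteq> 0)"
    then have z: "q v v = 0" for v by blast
    have qz: "q v u = 0" for v u
      using z[of "v + u"] z[of v] z[of u] q_sym[of u v] by (simp add: q_linear)
    have "v = 0" for v :: 'v using qz nondeg[of v] by simp
    with V_nonzero show False by blast
  qed
  then obtain v0 where v0: "q v0 v0 \<noteq> 0" by blast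
  define v where "v = scV (1 / csqrt (q v0 v0)) v0"
  have vv: "q v v = 1"
  proof -
    have "csqrt (q v0 v0) * csqrt (q v0 v0) = q v0 v0"
      by (simp add: power2_eq_square[symmetric])
    then show ?thesis using v0 by (simp add: v_def q_linear field_simps)
  qed
  obtain x where x: "x \<notin> span {v}"
  proof -
    have "\<not> UNIV \<subseteq> span {v}" using dim_le_card[of UNIV "{v}"] dim by auto
    then show thesis using that by blast
  qed
  define u0 where "u0 = x - scV (q x v) v"
  have u0v: "q u0 v = 0" "q v u0 = 0" using vv q_sym by (simp_all add: u0_def q_diff q_linear)
  have u0: "u0 \<noteq> 0"
  proof
    assume "u0 = 0"
    then have "x = scV (q x v) v" by (simp add: u0_def)
    then show False using x by (metis span_scale span_base singletonI)
  qed
  \<comment> \<open>otherwise \<open>u0\<close>, \<open>v\<close> and a vector pairing with \<open>u0\<close> would be independent\<close>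
  have "q u0 u0 \<noteq> 0"
  proof
    assume z: "q u0 u0 = 0"
    obtain y where y: "q u0 y \<noteq> 0" using nondeg[of u0] u0 by blast
    show False
    proof (rule no_three_independent[OF dim, of y v u0])
      fix \<alpha> \<beta> \<gamma> assume *: "scV \<alpha> y + scV \<beta> v + scV \<gamma> u0 = 0"
      have "q u0 (scV \<alpha> y + scV \<beta> v + scV \<gamma> u0) = \<alpha> * q u0 y"
        by (simp add: q_linear u0v z)
      with * y have a: "\<alpha> = 0" by simp
      have "q v (scV \<alpha> y + scV \<beta> v + scV \<gamma> u0) = \<beta>"
        by (simp add: q_linear u0v vv a)
      with * have b: "\<beta> = 0" by simp
      from * a b u0 show "\<alpha> = 0 \<and> \<beta> = 0 \<and> \<gamma> = 0" by simp
    qed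
  qed
  define u where "u = scV (1 / csqrt (- q u0 u0)) u0"
  have uu: "q u u = -1"
  proof -
    have "csqrt (- q u0 u0) * csqrt (- q u0 u0) = - q u0 u0"
      by (simp add: power2_eq_square[symmetric])
    then show ?thesis using \<open>q u0 u0 \<noteq> 0\<close> by (simp add: u_def q_linear field_simps)
  qed
  have uv: "q u v = 0" "q v u = 0" by (simp_all add: u_def q_linear u0v)
  define e1 e2 where "e1 = scV (1 / 2) (v + u)" and "e2 = scV (1 / 2) (u - v)"
  have e: "q e1 e1 = 0" "q e2 e2 = 0" "q e1 e2 = - 1 / 2" "q e2 e1 = - 1 / 2"
    by (simp_all add: e1_def e2_def q_linear q_diff uu vv uv)
  have "w = scV (- 2 * q w e2) e1 + scV (- 2 * q w e1) e2" for w
  proof (rule ccontr)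
    let ?w = "w - (scV (- 2 * q w e2) e1 + scV (- 2 * q w e1) e2)"
    assume "w \<noteq> scV (- 2 * q w e2) e1 + scV (- 2 * q w e1) e2"
    then have nz: "?w \<noteq> 0" by simp
    have o: "q ?w e1 = 0" "q ?w e2 = 0" by (simp_all add: q_diff q_linear q_uminus e)
    show False
    proof (rule no_three_independent[OF dim, of ?w e1 e2])
      fix \<alpha> \<beta> \<gamma> assume *: "scV \<alpha> ?w + scV \<beta> e1 + scV \<gamma> e2 = 0"
      have "q (scV \<alpha> ?w + scV \<beta> e1 + scV \<gamma> e2) e1 = - \<gamma> / 2"
        "q (scV \<alpha> ?w + scV \<beta> e1 + scV \<gamma> e2) e2 = - \<beta> / 2"
        using o by (simp_all add: q_linear e)
      with * have "\<gamma> = 0" "\<beta> = 0" by simp_all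
      with * nz show "\<alpha> = 0 \<and> \<beta> = 0 \<and> \<gamma> = 0" by simp
    qed
  qed
  with e that show thesis by blast
qed

end

section \<open>Bases of symplectic spaces\<close>

lemma (in vector_space) indep_family_card_le:
  fixes w :: "nat \<Rightarrow> 'b"
  assumes ind: "\<And>c. (\<Sum>k<n. scale (c k) (w k)) = 0 \<Longrightarrow> \<forall>k<n. c k = 0"
    and T: "finite T" and span: "\<And>k. k < n \<Longrightarrow> w k \<in> span T"
  shows "n \<le> card T"
proof -
  have inj: "inj_on w {..<n}"
  proof (rule inj_onI, rule ccontr)
    fix i j assume "i \<in> {..<n}" "j \<in> {..<n}" and w: "w i = w j" and ne: "i \<noteq> j"
    then have i: "i < n" and j: "j < n" by simp_all
    define c where "c k = (if k = i then 1 else if k = j then - 1 else (0 :: 'a))" for k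
    have "(\<Sum>k<n. scale (c k) (w k)) = (\<Sum>k<n. (if k = i then w i else 0) + (if k = j then - w j else 0))"
      by (rule sum.cong) (simp_all add: c_def ne)
    also have "\<dots> = w i - w j" by (simp add: sum.distrib i j)
    finally have "(\<Sum>k<n. scale (c k) (w k)) = 0" by (simp add: w)
    from ind[OF this] i have "c i = 0" by blast
    then show False by (simp add: c_def)
  qed
  have "independent (w ` {..<n})"
  proof (rule independent_if_scalars_zero)
    fix f x assume "(\<Sum>x\<in>w ` {..<n}. scale (f x) x) = 0" and x: "x \<in> w ` {..<n}"
    then have "(\<Sum>k<n. scale (f (w k)) (w k)) = 0" by (simp only: sum.reindex[OF inj] o_def)
    from ind[OF this] have "\<forall>k<n. f (w k) = 0" .
    with x show "f x = 0" by (elim imageE) simp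
  qed simp
  moreover have "w ` {..<n} \<subseteq> span T" by (rule image_subsetI) (simp add: span)
  ultimately have "card (w ` {..<n}) \<le> card T"
    using independent_span_bound[OF T, of "w ` {..<n}"] by simp
  then show ?thesis by (simp add: card_image[OF inj])
qed

locale symplectic_form = vector_space sc for sc :: "complex \<Rightarrow> 'a::ab_group_add \<Rightarrow> 'a" +
  fixes U :: "'a set" and \<omega> :: "'a \<Rightarrow> 'a \<Rightarrow> complex"
  assumes fin: "fin_dim sc UNIV"
    and U: "subspace U"
    and add_left: "\<omega> (x + y) z = \<omega> x z + \<omega> y z"
    and scale_left: "\<omega> (sc c x) z = c * \<omega> x z"
    and skew: "\<omega> x y = - \<omega> y x"
    and nondeg: "x \<in> U \<Longrightarrow> (\<And>y. y \<in> U \<Longrightarrow> \<omega> x y = 0) \<Longrightarrow> x = 0"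
begin

lemma scale_right: "\<omega> z (sc c x) = c * \<omega> z x"
  using scale_left[of c x z] skew[of z x] skew[of z "sc c x"] by simp

lemma zero [simp]: "\<omega> 0 z = 0" "\<omega> z 0 = 0"
  using scale_left[of 0 0 z] skew[of z 0] by simp_all

lemma sum_left: "\<omega> (sum f A) z = (\<Sum>a\<in>A. \<omega> (f a) z)"
  by (induction A rule: infinite_finite_induct) (simp_all add: add_left)

lemma diff_left: "\<omega> (x - y) z = \<omega> x z - \<omega> y z"
  using add_left[of "x - y" y z] by simp

lemma self: "\<omega> x x = 0"
  using skew[of x x] by simp

definition symplectic_family :: "nat \<Rightarrow> (nat \<Rightarrow> 'a) \<Rightarrow> (nat \<Rightarrow> 'a) \<Rightarrow> bool" where
  "symplectic_family l x y \<longleftrightarrow> (\<forall>i<l. x i \<in> U \<and> y i \<in> U) \<and>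
     (\<forall>i<l. \<forall>j<l. \<omega> (x i) (x j) = 0 \<and> \<omega> (y i) (y j) = 0 \<and> \<omega> (x i) (y j) = (if i = j then 1 else 0))"

text \<open>The component in the span of the family of the orthogonal decomposition that it defines.\<close>

definition expand :: "nat \<Rightarrow> (nat \<Rightarrow> 'a) \<Rightarrow> (nat \<Rightarrow> 'a) \<Rightarrow> 'a \<Rightarrow> 'a" where
  "expand l x y u = (\<Sum>i<l. sc (\<omega> u (y i)) (x i)) + (\<Sum>i<l. sc (- \<omega> u (x i)) (y i))"

lemma symplectic_combination:
  assumes xy: "symplectic_family l x y" and j: "j < l"
  shows "\<omega> ((\<Sum>i<l. sc (a i) (x i)) + (\<Sum>i<l. sc (b i) (y i))) (y j) = a j"
    "\<omega> ((\<Sum>i<l. sc (a i) (x i)) + (\<Sum>i<l. sc (b i) (y i))) (x j) = - b j"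
proof -
  have yx: "\<omega> (y i) (x j) = (if i = j then -1 else 0)" if "i < l" for i
    using xy j that skew[of "y i" "x j"] by (auto simp: symplectic_family_def)
  have 1: "(\<Sum>i<l. a i * \<omega> (x i) (y j)) = (\<Sum>i<l. if i = j then a j else 0)"
    by (rule sum.cong) (use xy j in \<open>auto simp: symplectic_family_def\<close>)
  have 2: "(\<Sum>i<l. b i * \<omega> (y i) (x j)) = (\<Sum>i<l. if i = j then - b j else 0)"
    by (rule sum.cong) (use yx in auto)
  have 3: "(\<Sum>i<l. b i * \<omega> (y i) (y j)) = 0" "(\<Sum>i<l. a i * \<omega> (x i) (x j)) = 0"
    using xy j by (auto simp: symplectic_family_def intro!: sum.neutral)
  show "\<omega> ((\<Sum>i<l. sc (a i) (x i)) + (\<Sum>i<l. sc (b i) (y i))) (y j) = a j"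
    "\<omega> ((\<Sum>i<l. sc (a i) (x i)) + (\<Sum>i<l. sc (b i) (y i))) (x j) = - b j"
    using 1 2 3 j by (simp_all add: add_left sum_left scale_left)
qed

lemma expand_in: "symplectic_family l x y \<Longrightarrow> expand l x y u \<in> U"
  unfolding expand_def symplectic_family_def
  by (intro subspace_add[OF U] subspace_sum[OF U] subspace_scale[OF U]) auto

text \<open>
  A family of maximal length spans. Otherwise some element of \<open>U\<close> has a nonzero part orthogonal to the family; by
  nondegeneracy this part pairs with an element that can be made orthogonal to the family too, and the two extend the
  family. The length is bounded because the first halves are independent.
\<close>

lemma symplectic_basis_exists:
  obtains l x y where "symplectic_family l x y" "\<And>u. u \<in> U \<Longrightarrow> u = expand l x y u"
proof -
  obtain B where B: "finite B" "UNIV \<subseteq> span B" using fin by (auto simp: fin_dim_def)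
  let ?P = "\<lambda>l. \<exists>x y. symplectic_family l x y"
  have bound: "l \<le> card B" if P: "?P l" for l
  proof -
    obtain x y where xy: "symplectic_family l x y" using P by blast
    show ?thesis
    proof (rule indep_family_card_le[OF _ B(1), where w = x])
      fix c assume *: "(\<Sum>k<l. sc (c k) (x k)) = 0"
      have "c j = 0" if "j < l" for j
        using symplectic_combination(1)[OF xy that, of c "\<lambda>_. 0"] * by simp
      then show "\<forall>k<l. c k = 0" by blast
    qed (use B(2) in auto)
  qed
  have P0: "?P 0" by (simp add: symplectic_family_def)
  define l where "l = (GREATEST l. ?P l)"
  have "?P l" unfolding l_def by (rule GreatestI_nat[of ?P 0 "card B"]) (use P0 bound in auto)
  then obtain x y where xy: "symplectic_family l x y" by blast
  have max: "k \<le> l" if "?P k" for k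
    unfolding l_def by (rule Greatest_le_nat[of ?P k "card B"]) (use that bound in auto)
  have "u = expand l x y u" if u: "u \<in> U" for u
  proof (rule ccontr)
    assume ne: "u \<noteq> expand l x y u"
    have orth: "\<omega> (v - expand l x y v) (x j) = 0" "\<omega> (v - expand l x y v) (y j) = 0" if "j < l" for v j
      using symplectic_combination[OF xy that, of "\<lambda>i. \<omega> v (y i)" "\<lambda>i. - \<omega> v (x i)"]
      by (simp_all add: diff_left expand_def)
    have orthC: "\<omega> (v - expand l x y v) (expand l x y t) = 0" for v t
    proof -
      have "\<omega> (expand l x y t) (v - expand l x y v) = 0"
        unfolding expand_def[of l x y t] add_left sum_left scale_left
        using orth[of _ v] skew[of "x _" "v - expand l x y v"] skew[of "y _" "v - expand l x y v"]
        by simp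
      then show ?thesis using skew[of "v - expand l x y v" "expand l x y t"] by simp
    qed
    define p where "p = u - expand l x y u"
    have p: "p \<in> U" "p \<noteq> 0" using u ne expand_in[OF xy] subspace_diff[OF U] by (auto simp: p_def)
    then obtain t where t: "t \<in> U" "\<omega> p t \<noteq> 0" using nondeg[of p] by blast
    define r where "r = sc (1 / \<omega> p t) (t - expand l x y t)"
    have r: "r \<in> U" using t expand_in[OF xy] U by (simp add: r_def subspace_diff subspace_scale)
    have "\<omega> (t - expand l x y t) p = - \<omega> p t"
      using orthC[of u t] skew[of "expand l x y t" p] skew[of t p] by (simp add: diff_left p_def)
    then have pr: "\<omega> p r = 1"
      using t skew[of p "t - expand l x y t"] by (simp add: r_def scale_right)
    have po: "\<omega> p (x j) = 0" "\<omega> p (y j) = 0" "\<omega> (x j) p = 0" "\<omega> (y j) p = 0" if "j < l" for j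
      using orth[OF that, of u] skew[of "x j" p] skew[of "y j" p] by (simp_all add: p_def)
    have ro: "\<omega> r (x j) = 0" "\<omega> r (y j) = 0" "\<omega> (x j) r = 0" "\<omega> (y j) r = 0" if "j < l" for j
      using orth[OF that, of t] skew[of "x j" r] skew[of "y j" r] by (simp_all add: r_def scale_left)
    have "symplectic_family (Suc l) (x(l := p)) (y(l := r))"
      using xy p r pr po ro self by (auto simp: symplectic_family_def less_Suc_eq)
    with max[of "Suc l"] show False by auto
  qed
  with xy that show thesis by blast
qed

end

section \<open>The two eigenspaces of the spin representation\<close>

lemma sum_lessThan_add:
  fixes f :: "nat \<Rightarrow> 'a::comm_monoid_add"
  shows "(\<Sum>k<l + m. f k) = (\<Sum>k<l. f k) + (\<Sum>k<m. f (l + k))"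
  by (induction m) (simp_all add: add.assoc)

text \<open>
  The generator of \<open>so(V)\<close> acts as a multiple of \<open>e1 e2 - e2 e1\<close>, so its eigenspaces are the
  kernels of \<open>e1\<close> and \<open>e2\<close>.
\<close>

locale null_basis_translation = extended_translation_data scV q scW act spin \<beta> \<epsilon>
  for scV :: "complex \<Rightarrow> 'v::ab_group_add \<Rightarrow> 'v"
    and q :: "'v \<Rightarrow> 'v \<Rightarrow> complex"
    and scW :: "complex \<Rightarrow> 'w::ab_group_add \<Rightarrow> 'w"
    and act :: "'v cliff \<Rightarrow> 'w \<Rightarrow> 'w"
    and spin :: "('v \<Rightarrow> 'v) \<Rightarrow> 'w \<Rightarrow> 'w"
    and \<beta> :: "'w \<Rightarrow> 'w \<Rightarrow> complex"
    and \<epsilon> :: complex +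
  fixes e1 e2 :: 'v
  assumes null1: "q e1 e1 = 0" and null2: "q e2 e2 = 0" and pair: "q e1 e2 = - 1 / 2"
    and decomp: "v = scV (- 2 * q v e2) e1 + scV (- 2 * q v e1) e2"
begin

abbreviation g1 :: "'w \<Rightarrow> 'w" where "g1 \<equiv> \<gamma> e1"
abbreviation g2 :: "'w \<Rightarrow> 'w" where "g2 \<equiv> \<gamma> e2"

lemma pair': "q e2 e1 = - 1 / 2"
  using pair q_sym[of e2 e1] by simp

lemma double_eq_zero: "x + x = 0 \<Longrightarrow> x = 0" for x :: 'w
  using W.scale_left_distrib[of 1 1 x] W.scale_eq_0_iff[of 2 x] by simp

lemma g11 [simp]: "g1 (g1 s) = 0" and g22 [simp]: "g2 (g2 s) = 0"
  using clifford_relation[of e1 e1 s] clifford_relation[of e2 e2 s]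
  by (auto simp: null1 null2 intro: double_eq_zero)

lemma g12: "g1 (g2 s) + g2 (g1 s) = s"
  using clifford_relation[of e1 e2 s] by (simp add: pair)

lemma g21_ker [simp]: "g2 s = 0 \<Longrightarrow> g2 (g1 s) = s"
  using g12[of s] by simp

lemma g121 [simp]: "g1 (g2 (g1 s)) = g1 s"
  using g12[of "g1 s"] by simp

lemma \<gamma>_expand: "\<gamma> v s = scW (- 2 * q v e2) (g1 s) + scW (- 2 * q v e1) (g2 s)"
proof -
  have "\<gamma> v s = \<gamma> (scV (- 2 * q v e2) e1 + scV (- 2 * q v e1) e2) s"
    by (rule arg_cong[OF decomp])
  then show ?thesis by (simp only: \<gamma>_vec_add \<gamma>_vec_scale)
qed

section \<open>Counting the irreducible components\<close>

text \<open>
  For \<open>w\<close> in the kernel of \<open>e2\<close>, this is the submodule generated by \<open>w\<close>.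
\<close>

definition line :: "'w \<Rightarrow> 'w set" where
  "line w = {scW a w + scW b (g1 w) | a b. True}"

lemma lineI: "scW a w + scW b (g1 w) \<in> line w"
  by (auto simp: line_def)

lemma base_in_line: "w \<in> line w"
  using lineI[of 1 w 0] by simp

lemma line_submodule:
  assumes w: "g2 w = 0"
  shows "cl_submodule scV q scW act (line w)"
  unfolding cl_submodule_iff
proof (intro conjI allI ballI)
  show "W.subspace (line w)"
  proof (rule W.subspaceI)
    show "0 \<in> line w" using lineI[of 0 w 0] by simp
    fix x y assume "x \<in> line w" "y \<in> line w"
    then obtain a b c d where "x = scW a w + scW b (g1 w)" "y = scW c w + scW d (g1 w)"
      by (auto simp: line_def)
    then have "x + y = scW (a + c) w + scW (b + d) (g1 w)"
      by (simp add: W.scale_left_distrib)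
    then show "x + y \<in> line w" by (simp only: lineI)
  next
    fix c x assume "x \<in> line w"
    then obtain a b where "x = scW a w + scW b (g1 w)" by (auto simp: line_def)
    then have "scW c x = scW (c * a) w + scW (c * b) (g1 w)"
      by (simp add: W.scale_right_distrib)
    then show "scW c x \<in> line w" by (simp only: lineI)
  qed
  fix v s assume "s \<in> line w"
  then obtain a b where s: "s = scW a w + scW b (g1 w)" by (auto simp: line_def)
  have "g1 s = scW a (g1 w)" "g2 s = scW b w"
    by (simp_all add: s \<gamma>_add \<gamma>_scale w)
  then have "\<gamma> v s = scW (- 2 * q v e1 * b) w + scW (- 2 * q v e2 * a) (g1 w)"
    by (simp add: \<gamma>_expand[of v s])
  then show "\<gamma> v s \<in> line w" by (simp only: lineI)
qed

lemma line_subset: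
  assumes T: "cl_submodule scV q scW act T" and w: "w \<in> T"
  shows "line w \<subseteq> T"
  using assms by (auto simp: line_def cl_submodule_iff W.subspace_add W.subspace_scale)

text \<open>
  For \<open>s\<close> in the submodule, \<open>e2 s\<close> is in the kernel of \<open>e2\<close>; if it is zero, \<open>s\<close> is itself in
  the kernel.
\<close>

lemma submodule_contains_ker:
  assumes T: "cl_submodule scV q scW act T" and "T \<noteq> {0}"
  obtains w where "w \<in> T" "w \<noteq> 0" "g2 w = 0"
proof -
  have "0 \<in> T" using T by (simp add: cl_submodule_iff W.subspace_0)
  with \<open>T \<noteq> {0}\<close> obtain s where s: "s \<in> T" "s \<noteq> 0" by blast
  show thesis
  proof (cases "g2 s = 0")
    case True
    with s that show thesis by blast
  next
    case False
    moreover have "g2 s \<in> T" using T s by (simp add: cl_submodule_iff)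
    ultimately show thesis using that[of "g2 s"] by simp
  qed
qed

lemma line_ker:
  assumes w: "g2 w = 0" and t: "t \<in> line w"
  obtains a where "g2 (g1 t) = scW a w"
proof -
  obtain a b where "t = scW a w + scW b (g1 w)" using t by (auto simp: line_def)
  then have "g2 (g1 t) = scW a w" using w by (simp add: \<gamma>_add \<gamma>_scale)
  with that show thesis .
qed

lemma line_irreducible:
  assumes w: "g2 w = 0" "w \<noteq> 0"
  shows "irreducible_submodule scV q scW act (line w)"
  unfolding irreducible_submodule_def
proof (intro conjI allI impI)
  show "cl_submodule scV q scW act (line w)" by (rule line_submodule[OF w(1)])
  show "line w \<noteq> {0}" using base_in_line[of w] w(2) by blast
  fix T assume T: "cl_submodule scV q scW act T \<and> T \<subseteq> line w"
  show "T = {0} \<or> T = line w"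
  proof (rule disjCI)
    assume "T \<noteq> line w"
    show "T = {0}"
    proof (rule ccontr)
      assume "T \<noteq> {0}"
      then obtain t where t: "t \<in> T" "t \<noteq> 0" "g2 t = 0"
        using submodule_contains_ker[of T] T by blast
      obtain a where "g2 (g1 t) = scW a w" using line_ker[OF w(1), of t] T t by blast
      then have tw: "t = scW a w" using t by simp
      with t have "a \<noteq> 0" by auto
      with tw have "w = scW (1 / a) t" by simp
      then have "w \<in> T" using T t by (simp add: cl_submodule_iff W.subspace_scale)
      with line_subset[of T w] T \<open>T \<noteq> line w\<close> show False by blast
    qed
  qed
qed

lemma irreducible_is_line:
  assumes "irreducible_submodule scV q scW act T"
  obtains w where "w \<noteq> 0" "g2 w = 0" "T = line w"
proof -
  from assms have T: "cl_submodule scV q scW act T" "T \<noteq> {0}"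
    and irr: "\<And>S. cl_submodule scV q scW act S \<Longrightarrow> S \<subseteq> T \<Longrightarrow> S = {0} \<or> S = T"
    by (auto simp: irreducible_submodule_def)
  obtain w where w: "w \<in> T" "w \<noteq> 0" "g2 w = 0" using submodule_contains_ker[OF T] .
  have "line w = {0} \<or> line w = T"
    by (rule irr[OF line_submodule[OF w(3)] line_subset[OF T(1) w(1)]])
  then have "T = line w" using base_in_line[of w] w(2) by blast
  with that w show thesis by blast
qed

text \<open>
  An irreducible submodule meets the kernel of \<open>e2\<close> in a line and is generated by it. A basis of this
  kernel therefore gives a decomposition into irreducible submodules, and the generators of the summands of any
  decomposition form a basis of the kernel; here \<open>e2 e1\<close> serves as the projection to the kernel.
\<close>

lemma num_components_eq:
  assumes w: "\<And>k. k < n \<Longrightarrow> g2 (w k) = 0"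
    and ind: "\<And>c. (\<Sum>k<n. scW (c k) (w k)) = 0 \<Longrightarrow> \<forall>k<n. c k = 0"
    and span: "\<And>u. g2 u = 0 \<Longrightarrow> \<exists>c. u = (\<Sum>k<n. scW (c k) (w k))"
  shows "num_components scV q scW act = n"
  unfolding num_components_def
proof (rule the_equality)
  have nz: "w k \<noteq> 0" if "k < n" for k
  proof
    assume z: "w k = 0"
    have "(\<Sum>i<n. scW (if i = k then 1 else 0) (w i)) = 0"
      by (rule sum.neutral) (simp add: z)
    from ind[OF this] that show False by auto
  qed
  show "\<exists>S. (\<forall>i<n. irreducible_submodule scV q scW act (S i)) \<and> direct_sum_of {..<n} S UNIV"
  proof (intro exI conjI allI impI)
    show "irreducible_submodule scV q scW act (line (w i))" if "i < n" for i
      by (rule line_irreducible[OF w[OF that] nz[OF that]])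
    show "direct_sum_of {..<n} (\<lambda>i. line (w i)) UNIV"
      unfolding direct_sum_of_def
    proof (intro conjI allI impI subset_antisym subset_UNIV subsetI)
      fix s
      have gs: "g2 (g2 (g1 s)) = 0" "g2 (g2 s) = 0" by simp_all
      obtain a where a: "g2 (g1 s) = (\<Sum>k<n. scW (a k) (w k))" using span[OF gs(1)] by blast
      obtain b where b: "g2 s = (\<Sum>k<n. scW (b k) (w k))" using span[OF gs(2)] by blast
      have "s = g2 (g1 s) + g1 (g2 s)" using g12[of s] by (simp add: add.commute)
      also have "g1 (g2 s) = (\<Sum>k<n. scW (b k) (g1 (w k)))" unfolding b by (simp add: \<gamma>_sum \<gamma>_scale)
      finally have "s = (\<Sum>k<n. scW (a k) (w k) + scW (b k) (g1 (w k)))" by (simp add: a sum.distrib)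
      then have "s = (\<Sum>k\<in>{..<n}. scW (a k) (w k) + scW (b k) (g1 (w k))) \<and> finite {..<n} \<and> {..<n} \<subseteq> {..<n} \<and>
          (\<forall>k\<in>{..<n}. scW (a k) (w k) + scW (b k) (g1 (w k)) \<in> line (w k))"
        by (simp add: lineI)
      then show "s \<in> {\<Sum>i\<in>J. x i |J x. finite J \<and> J \<subseteq> {..<n} \<and> (\<forall>i\<in>J. x i \<in> line (w i))}"
        by (intro CollectI exI)
    next
      fix J x
      assume "finite J \<and> J \<subseteq> {..<n} \<and> (\<forall>i\<in>J. x i \<in> line (w i)) \<and> (\<Sum>i\<in>J. x i) = 0"
      then have J: "J \<subseteq> {..<n}" and xl: "\<forall>i\<in>J. x i \<in> line (w i)" and x0: "(\<Sum>i\<in>J. x i) = 0" by blast+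
      have wJ: "g2 (w i) = 0" if "i \<in> J" for i using w that J by blast
      have "\<forall>i\<in>J. \<exists>a. \<exists>b. x i = scW a (w i) + scW b (g1 (w i))" using xl unfolding line_def by blast
      from bchoice[OF this] obtain a where "\<forall>i\<in>J. \<exists>b. x i = scW (a i) (w i) + scW b (g1 (w i))" ..
      from bchoice[OF this] obtain b where x: "\<forall>i\<in>J. x i = scW (a i) (w i) + scW (b i) (g1 (w i))" ..
      have vanish: "\<forall>i\<in>J. c i = 0" if "(\<Sum>i\<in>J. scW (c i) (w i)) = 0" for c
      proof -
        have "(\<Sum>i<n. scW (if i \<in> J then c i else 0) (w i)) = (\<Sum>i\<in>J. scW (c i) (w i))"
          by (rule sum.mono_neutral_cong_right) (use J in simp_all)
        then have "(\<Sum>i<n. scW (if i \<in> J then c i else 0) (w i)) = 0" by (simp only: that)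
        from ind[OF this] have "\<forall>i<n. (if i \<in> J then c i else 0) = 0" .
        then have "c i = 0" if "i \<in> J" for i using J that by (metis lessThan_iff subsetD)
        then show ?thesis by blast
      qed
      have sum: "(\<Sum>i\<in>J. x i) = (\<Sum>i\<in>J. scW (a i) (w i) + scW (b i) (g1 (w i)))"
        by (rule sum.cong) (use x in simp_all)
      have g2x: "g2 (scW (a i) (w i) + scW (b i) (g1 (w i))) = scW (b i) (w i)" if "i \<in> J" for i
        by (simp add: \<gamma>_add \<gamma>_scale wJ[OF that])
      have g21x: "g2 (g1 (scW (a i) (w i) + scW (b i) (g1 (w i)))) = scW (a i) (w i)" if "i \<in> J" for i
        by (simp add: \<gamma>_add \<gamma>_scale wJ[OF that])
      have "(\<Sum>i\<in>J. scW (b i) (w i)) = g2 (\<Sum>i\<in>J. x i)"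
        unfolding sum \<gamma>_sum by (rule sum.cong) (simp_all add: g2x)
      moreover have "(\<Sum>i\<in>J. scW (a i) (w i)) = g2 (g1 (\<Sum>i\<in>J. x i))"
        unfolding sum \<gamma>_sum by (rule sum.cong) (simp_all add: g21x)
      ultimately have "(\<Sum>i\<in>J. scW (b i) (w i)) = 0" "(\<Sum>i\<in>J. scW (a i) (w i)) = 0"
        by (simp_all only: x0 \<gamma>_zero)
      from vanish[OF this(1)] vanish[OF this(2)] have "\<forall>i\<in>J. a i = 0" "\<forall>i\<in>J. b i = 0" by simp_all
      with x show "\<forall>i\<in>J. x i = 0" by simp
    qed
  qed
next
  fix m :: nat assume "\<exists>S. (\<forall>i<m. irreducible_submodule scV q scW act (S i)) \<and> direct_sum_of {..<m} S UNIV"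
  then obtain S where irr: "\<And>i. i < m \<Longrightarrow> irreducible_submodule scV q scW act (S i)"
    and ds: "direct_sum_of {..<m} S UNIV" by blast
  define v where "v i = (SOME v. v \<noteq> 0 \<and> g2 v = 0 \<and> S i = line v)" for i
  have v: "v i \<noteq> 0 \<and> g2 (v i) = 0 \<and> S i = line (v i)" if "i < m" for i
  proof -
    from irreducible_is_line[OF irr[OF that]]
    have "\<exists>v. v \<noteq> 0 \<and> g2 v = 0 \<and> S i = line v" by blast
    then show ?thesis unfolding v_def by (rule someI_ex)
  qed
  have ind_v: "\<forall>k<m. c k = 0" if c: "(\<Sum>k<m. scW (c k) (v k)) = 0" for c
  proof -
    have "scW (c k) (v k) \<in> S k" if "k < m" for k
      using v[OF that] lineI[of "c k" "v k" 0] by simp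
    then have "finite {..<m} \<and> {..<m} \<subseteq> {..<m} \<and> (\<forall>k\<in>{..<m}. scW (c k) (v k) \<in> S k) \<and>
        (\<Sum>k\<in>{..<m}. scW (c k) (v k)) = 0" using c by simp
    moreover have "\<forall>J x. finite J \<and> J \<subseteq> {..<m} \<and> (\<forall>i\<in>J. x i \<in> S i) \<and> (\<Sum>i\<in>J. x i) = 0 \<longrightarrow> (\<forall>i\<in>J. x i = 0)"
      using ds unfolding direct_sum_of_def by (rule conjunct2)
    note this[THEN spec[of _ "{..<m}"], THEN spec[of _ "\<lambda>k. scW (c k) (v k)"]]
    ultimately have "\<forall>k\<in>{..<m}. scW (c k) (v k) = 0" by (rule rev_mp)
    with v show ?thesis by simp
  qed
  have span_v: "u \<in> W.span (v ` {..<m})" if u: "g2 u = 0" for u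
  proof -
    have "u \<in> {\<Sum>i\<in>J. x i |J x. finite J \<and> J \<subseteq> {..<m} \<and> (\<forall>i\<in>J. x i \<in> S i)}"
      using ds unfolding direct_sum_of_def by blast
    then obtain J x where J: "u = (\<Sum>i\<in>J. x i)" "J \<subseteq> {..<m}" "\<forall>i\<in>J. x i \<in> S i" by blast
    have "u = g2 (g1 u)" using u by simp
    also have "\<dots> = (\<Sum>i\<in>J. g2 (g1 (x i)))" unfolding J(1) \<gamma>_sum ..
    also have "\<dots> \<in> W.span (v ` {..<m})"
    proof (rule W.span_sum)
      fix i assume i: "i \<in> J"
      then obtain a where "g2 (g1 (x i)) = scW a (v i)"
        using line_ker[of "v i" "x i"] v[of i] J by blast
      then show "g2 (g1 (x i)) \<in> W.span (v ` {..<m})"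
        using i J(2) by (auto intro: W.span_scale W.span_base)
    qed
    finally show ?thesis .
  qed
  have span_w: "u \<in> W.span (w ` {..<n})" if u0: "g2 u = 0" for u
  proof -
    obtain c where u: "u = (\<Sum>k<n. scW (c k) (w k))" using span[OF u0] by blast
    show ?thesis unfolding u by (intro W.span_sum W.span_scale W.span_base imageI)
  qed
  have "n \<le> card (v ` {..<m})"
    by (rule W.indep_family_card_le[where n = n and w = w]) (simp_all add: ind span_v w)
  moreover have "m \<le> card (w ` {..<n})"
    by (rule W.indep_family_card_le[where n = m and w = v]) (simp_all add: ind_v span_w v)
  ultimately show "m = n"
    using card_image_le[of "{..<m}" v] card_image_le[of "{..<n}" w] by simp
qed

section \<open>The extended translation algebra as a sum of Heisenberg algebras\<close>

lemma \<beta>_linear: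
  "\<beta> (x + y) z = \<beta> x z + \<beta> y z" "\<beta> (scW c x) z = c * \<beta> x z"
  "\<beta> x (y + z) = \<beta> x y + \<beta> x z" "\<beta> x (scW c z) = c * \<beta> x z"
  using \<beta>_bilinear by (auto simp: bilinear_form_def Vector_Spaces.linear_iff)

lemma \<beta>_zero [simp]: "\<beta> 0 x = 0" "\<beta> x 0 = 0"
  using \<beta>_linear(2)[of 0 0 x] \<beta>_linear(4)[of x 0 0] by simp_all

lemma \<beta>_diff_left: "\<beta> (x - y) z = \<beta> x z - \<beta> y z"
  using \<beta>_linear(1)[of "x - y" y z] by simp

lemma \<beta>_uminus_left: "\<beta> (- x) z = - \<beta> x z"
  using \<beta>_diff_left[of 0 x z] by simp

lemma \<beta>_sum_left: "\<beta> (sum f A) z = (\<Sum>a\<in>A. \<beta> (f a) z)"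
  by (induction A rule: infinite_finite_induct) (simp_all add: \<beta>_linear)

lemma \<epsilon>_square [simp]: "\<epsilon> * \<epsilon> = 1"
proof -
  have "\<epsilon> = -1 \<or> \<epsilon> = 1" using B2 by blast
  then show ?thesis by auto
qed

lemma \<beta>_swap: "\<beta> s t = - \<epsilon> * \<beta> t s"
proof -
  have "\<epsilon> = -1 \<and> \<beta> s t = \<beta> t s \<or> \<epsilon> = 1 \<and> \<beta> s t = - \<beta> t s" using B2 by blast
  then show ?thesis by (elim disjE conjE) simp_all
qed

lemma \<beta>_\<gamma>: "\<beta> (\<gamma> v s) t = \<epsilon> * \<beta> s (\<gamma> v t)"
  using B3 by (simp add: \<gamma>_def)

text \<open>
  The signs of the symmetry of \<open>\<beta>\<close> and of its behaviour under vectors are opposite, so that their product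
  is always skew.
\<close>

lemma \<beta>_\<gamma>_skew: "\<beta> (\<gamma> v s) t = - \<beta> (\<gamma> v t) s"
proof -
  have "\<beta> (\<gamma> v s) t = \<epsilon> * (- \<epsilon> * \<beta> (\<gamma> v t) s)"
    unfolding \<beta>_\<gamma>[of v s t] \<beta>_swap[of s "\<gamma> v t"] ..
  also have "\<dots> = - (\<epsilon> * \<epsilon>) * \<beta> (\<gamma> v t) s" by (simp only: mult_minus_left mult_minus_right mult.assoc)
  finally show ?thesis by simp
qed

lemma \<beta>_nondegD: "(\<And>t. \<beta> s t = 0) \<Longrightarrow> s = 0"
  using \<beta>_nondeg by (simp add: nondegenerate_form_def)

text \<open>
  The coordinates of a vector in the null basis are its products with the opposite basis vectors.
\<close>

lemma translation_bracket_eq: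
  "translation_bracket scV q act \<beta> s t = scV (- 2 * \<beta> (g2 s) t) e1 + scV (- 2 * \<beta> (g1 s) t) e2"
  (is "_ = ?x")
  unfolding translation_bracket_def
proof (rule the_equality)
  show x: "\<forall>v. q ?x v = \<beta> (act (cl_vec scV q v) s) t"
  proof
    fix v
    have "\<beta> (\<gamma> v s) t = - 2 * q v e2 * \<beta> (g1 s) t + - 2 * q v e1 * \<beta> (g2 s) t"
      by (simp add: \<gamma>_expand[of v s] \<beta>_linear \<beta>_diff_left \<beta>_uminus_left)
    then show "q ?x v = \<beta> (act (cl_vec scV q v) s) t"
      using q_sym[of v e1] q_sym[of v e2] by (simp add: \<gamma>_def q_linear q_diff q_uminus)
  qed
  fix x assume "\<forall>v. q x v = \<beta> (act (cl_vec scV q v) s) t"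
  with x have "q (x - ?x) v = 0" for v by (simp only: q_diff) simp
  then have "x - ?x = 0" by (rule nondeg)
  then show "x = ?x" by simp
qed

lemma q_translation_bracket:
  "q (translation_bracket scV q act \<beta> s t) e1 = \<beta> (g1 s) t"
  "q (translation_bracket scV q act \<beta> s t) e2 = \<beta> (g2 s) t"
  unfolding translation_bracket_eq by (simp_all add: q_linear q_diff q_uminus null1 null2 pair pair')

abbreviation M :: "('w \<times> 'v) graded_lie" where
  "M \<equiv> extended_translation_algebra scV q scW act \<beta>"

lemma M_simps:
  "carrier M = UNIV"
  "scal M c x = (scW c (fst x), scV c (snd x))"
  "bracket M x y = (0, translation_bracket scV q act \<beta> (fst x) (fst y))"
  "piece M p = (if p = -1 then UNIV \<times> {0} else if p = -2 then {0} \<times> UNIV else {0})"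
  by (simp_all add: extended_translation_algebra_def case_prod_unfold)

lemma translation_bracket_self: "translation_bracket scV q act \<beta> s s = 0"
proof -
  have "\<beta> (\<gamma> v s) s = 0" for v using \<beta>_\<gamma>_skew[of v s s] by simp
  then show ?thesis by (simp add: translation_bracket_eq)
qed

lemma M_graded_lie: "graded_lie_algebra M"
proof -
  let ?b = "translation_bracket scV q act \<beta>"
  interpret M: vector_space "scal M"
    by unfold_locales (simp_all add: M_simps W.scale_right_distrib W.scale_left_distrib
        scale_right_distrib scale_left_distrib)
  have b: "?b (x + y) z = ?b x z + ?b y z" "?b x (y + z) = ?b x y + ?b x z"
    "?b (scW c x) y = scV c (?b x y)" "?b x (scW c y) = scV c (?b x y)" for x y z c
    by (simp_all add: translation_bracket_eq \<gamma>_add \<gamma>_scale \<beta>_linear scale_left_distrib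
        scale_right_distrib algebra_simps)
  have b0: "?b 0 x = 0" "?b x 0 = 0" for x by (simp_all add: translation_bracket_eq)
  show ?thesis
  proof (intro graded_lie_algebra.intro graded_lie_algebra_axioms.intro)
    show "vector_space (scal M)" by (rule M.vector_space_axioms)
    show "M.subspace (carrier M)" by (simp add: M_simps M.subspace_UNIV)
    show "M.subspace (piece M i)" for i
      by (rule M.subspaceI) (auto simp: M_simps zero_prod_def split: if_splits)
    show "direct_sum_of UNIV (piece M) (carrier M)"
      unfolding direct_sum_of_def
    proof (intro conjI allI impI subset_antisym subsetI)
      fix x assume "x \<in> carrier M"
      let ?y = "\<lambda>p::int. if p = -1 then (fst x, 0) else (0, snd x)"
      have "x = (\<Sum>p\<in>{-1, -2}. ?y p)" by (simp add: prod_eq_iff)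
      then have "x = (\<Sum>p\<in>{-1, -2}. ?y p) \<and> finite {-1, -2 :: int} \<and> {-1, -2 :: int} \<subseteq> UNIV \<and>
          (\<forall>p\<in>{-1, -2}. ?y p \<in> piece M p)" by (simp add: M_simps)
      then show "x \<in> {\<Sum>i\<in>J. y i |J y. finite J \<and> J \<subseteq> UNIV \<and> (\<forall>i\<in>J. y i \<in> piece M i)}"
        by (intro CollectI exI)
    next
      fix J x assume J: "finite J \<and> J \<subseteq> UNIV \<and> (\<forall>i\<in>J. x i \<in> piece M i) \<and> (\<Sum>i\<in>J. x i) = 0"
      show "\<forall>i\<in>J. x i = 0"
      proof
        fix i assume i: "i \<in> J"
        have xJ: "x j \<in> piece M j" if "j \<in> J" for j using J that by blast
        have f: "j \<noteq> -1 \<Longrightarrow> fst (x j) = 0" and s: "j \<noteq> -2 \<Longrightarrow> snd (x j) = 0" if "j \<in> J" for j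
          using xJ[OF that] by (auto simp: M_simps split: if_splits)
        have "0 = (\<Sum>j\<in>J. fst (x j))" using J by (metis fst_sum fst_zero)
        also have "\<dots> = (\<Sum>j\<in>J. if j = -1 then fst (x (-1)) else 0)"
          by (rule sum.cong) (simp_all add: f)
        finally have f1: "-1 \<in> J \<Longrightarrow> fst (x (-1)) = 0" using J by simp
        have "0 = (\<Sum>j\<in>J. snd (x j))" using J by (metis snd_sum snd_zero)
        also have "\<dots> = (\<Sum>j\<in>J. if j = -2 then snd (x (-2)) else 0)"
          by (rule sum.cong) (simp_all add: s)
        finally have s2: "-2 \<in> J \<Longrightarrow> snd (x (-2)) = 0" using J by simp
        have "fst (x i) = 0" using f[OF i] f1 i by (cases "i = -1") simp_all
        moreover have "snd (x i) = 0" using s[OF i] s2 i by (cases "i = -2") simp_all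
        ultimately show "x i = 0" by (simp add: prod_eq_iff)
      qed
    qed (simp add: M_simps)
    show "bracket M x y \<in> piece M (i + j)" if "x \<in> piece M i" "y \<in> piece M j" for x y i j
    proof (cases "i = -1 \<and> j = -1")
      case True
      then show ?thesis by (simp add: M_simps)
    next
      case False
      with that have "fst x = 0 \<or> fst y = 0" by (auto simp: M_simps split: if_splits)
      then have "bracket M x y = 0" by (auto simp: M_simps b0 zero_prod_def)
      then show ?thesis by (simp add: M_simps zero_prod_def)
    qed
  qed (simp_all add: M_simps b b0 translation_bracket_self zero_prod_def)
qed

text \<open>
  Nondegeneracy: \<open>e1\<close> is injective on the kernel of \<open>e2\<close>, and \<open>\<beta>(e1 x, t)\<close> only depends on the
  component \<open>e2 e1 t\<close> of \<open>t\<close> in this kernel.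
\<close>

lemma kernel_symplectic: "symplectic_form scW {s. g2 s = 0} (\<lambda>s t. \<beta> (g1 s) t)"
proof
  show "fin_dim scW UNIV" by (rule fin_dim_W)
  show "W.subspace {s. g2 s = 0}"
    by (rule W.subspaceI) (simp_all add: \<gamma>_add \<gamma>_scale)
  show "\<beta> (g1 x) y = - \<beta> (g1 y) x" for x y by (rule \<beta>_\<gamma>_skew)
  fix x assume x: "x \<in> {s. g2 s = 0}" and 0: "\<And>y. y \<in> {s. g2 s = 0} \<Longrightarrow> \<beta> (g1 x) y = 0"
  have "\<beta> (g1 x) t = 0" for t
  proof -
    have "\<beta> (g1 x) t = \<beta> (g1 x) (g1 (g2 t)) + \<beta> (g1 x) (g2 (g1 t))"
      using g12[of t] \<beta>_linear(3) by metis
    also have "\<beta> (g1 x) (g1 (g2 t)) = 0" by (simp add: \<beta>_\<gamma>[of e1 x])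
    also have "\<beta> (g1 x) (g2 (g1 t)) = 0" by (rule 0) simp
    finally show ?thesis by simp
  qed
  then have "g1 x = 0" by (rule \<beta>_nondegD)
  then have "g2 (g1 x) = 0" by simp
  with x show "x = 0" by simp
qed (simp_all add: \<gamma>_add \<gamma>_scale \<beta>_linear)

sublocale ker: symplectic_form scW "{s. g2 s = 0}" "\<lambda>s t. \<beta> (g1 s) t"
  by (rule kernel_symplectic)

lemma num_components_symplectic:
  assumes xy: "ker.symplectic_family l x y" and span: "\<And>u. g2 u = 0 \<Longrightarrow> u = ker.expand l x y u"
  shows "num_components scV q scW act = l + l"
proof (rule num_components_eq)
  let ?w = "\<lambda>k. if k < l then x k else y (k - l)"
  have split: "(\<Sum>k<l + l. scW (c k) (?w k)) = (\<Sum>k<l. scW (c k) (x k)) + (\<Sum>k<l. scW (c (l + k)) (y k))" for c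
    by (simp add: sum_lessThan_add)
  show "g2 (?w k) = 0" if "k < l + l" for k
    using xy that by (auto simp: ker.symplectic_family_def)
  show "\<forall>k<l + l. c k = 0" if c: "(\<Sum>k<l + l. scW (c k) (?w k)) = 0" for c
  proof -
    have "c j = 0 \<and> c (l + j) = 0" if "j < l" for j
      using ker.symplectic_combination[OF xy that, of c "\<lambda>k. c (l + k)"] c
      unfolding split by simp
    then show ?thesis
      by (metis add_diff_inverse_nat nat_add_left_cancel_less)
  qed
  show "\<exists>c. u = (\<Sum>k<l + l. scW (c k) (?w k))" if u: "g2 u = 0" for u
  proof
    let ?c = "\<lambda>k. if k < l then \<beta> (g1 u) (y k) else - \<beta> (g1 u) (x (k - l))"
    have "u = ker.expand l x y u" by (rule span[OF u])
    also have "\<dots> = (\<Sum>k<l + l. scW (?c k) (?w k))"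
      unfolding split ker.expand_def by simp
    finally show "u = (\<Sum>k<l + l. scW (?c k) (?w k))" .
  qed
qed

text \<open>
  The image under \<open>e1\<close> of a symplectic basis of the kernel of \<open>e2\<close>, up to the sign \<open>\<epsilon>\<close>, is one of
  the kernel of \<open>e1\<close> for \<open>\<beta>(e2 s, t)\<close>. The factor \<open>-2\<close> is the inverse of \<open>(e1, e2)\<close>, as
  in the bracket.
\<close>

definition frame_e :: "(nat \<Rightarrow> 'w) \<Rightarrow> (nat \<Rightarrow> 'w) \<Rightarrow> bool \<Rightarrow> coord \<Rightarrow> 'w \<times> 'v" where
  "frame_e x y b u = (case u of
      Xc i \<Rightarrow> (if b then x i else g1 (x i), 0)
    | Yc i \<Rightarrow> (if b then y i else scW \<epsilon> (g1 (y i)), 0)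
    | Zc \<Rightarrow> (0, scV (- 2) (if b then e2 else e1)))"

definition frame_lam :: "bool \<Rightarrow> 'w \<times> 'v \<Rightarrow> complex" where
  "frame_lam b z = q (snd z) (if b then e1 else e2)"

lemma lam_M_bracket: "frame_lam b (bracket M x y) = \<beta> (\<gamma> (if b then e1 else e2) (fst x)) (fst y)"
  by (simp add: frame_lam_def M_simps q_translation_bracket)

text \<open>
  Everything reduces to the values of \<open>\<beta>(e1 s, t)\<close> and \<open>\<beta>(e2 s, t)\<close>, the products of
  \<open>[s, t]\<close> with \<open>e1\<close> and \<open>e2\<close>. The first vanishes if \<open>s\<close> or \<open>t\<close> is in the kernel of \<open>e1\<close>, the second if one of
  them is in the kernel of \<open>e2\<close>, so that the summands commute. Since \<open>W\<close> is nonzero, so is the kernel of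
  \<open>e2\<close>, hence \<open>l > 0\<close>.
\<close>

lemma M_double_heisenberg:
  assumes xy: "ker.symplectic_family l x y" and span: "\<And>u. g2 u = 0 \<Longrightarrow> u = ker.expand l x y u"
  shows "double_heisenberg M l (frame_e x y) frame_lam"
proof (intro double_heisenberg.intro double_heisenberg_axioms.intro)
  note e = frame_e_def and lam = lam_M_bracket
  have k: "g2 (x i) = 0" "g2 (y i) = 0" if "i < l" for i
    using xy that by (auto simp: ker.symplectic_family_def)
  have om: "\<beta> (g1 (x i)) (x j) = 0" "\<beta> (g1 (y i)) (y j) = 0"
    "\<beta> (g1 (x i)) (y j) = (if i = j then 1 else 0)" if "i < l" "j < l" for i j
    using xy that by (auto simp: ker.symplectic_family_def)
  have om': "\<beta> (x i) (g1 (x j)) = 0" "\<beta> (y i) (g1 (y j)) = 0"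
    "\<beta> (x i) (g1 (y j)) = (if i = j then \<epsilon> else 0)" if "i < l" "j < l" for i j
  proof -
    have *: "\<beta> s (g1 t) = \<epsilon> * \<beta> (g1 s) t" for s t
      by (simp add: \<beta>_\<gamma>[of e1 s t] mult.assoc[symmetric])
    show "\<beta> (x i) (g1 (x j)) = 0" "\<beta> (y i) (g1 (y j)) = 0"
      "\<beta> (x i) (g1 (y j)) = (if i = j then \<epsilon> else 0)"
      by (simp_all add: * om that)
  qed
  have brT: "bracket M (s, 0) (t, 0) = (0, scV (- 2 * \<beta> (g2 s) t) e1 + scV (- 2 * \<beta> (g1 s) t) e2)" for s t
    by (simp add: M_simps translation_bracket_eq)
  have expand_\<beta>: "\<beta> u t = (\<Sum>i<l. \<beta> (g1 u) (y i) * \<beta> (x i) t - \<beta> (g1 u) (x i) * \<beta> (y i) t)"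
    if u: "g2 u = 0" for u t
  proof -
    have "\<beta> u t = \<beta> (ker.expand l x y u) t" using span[OF u] by simp
    also have "\<dots> = (\<Sum>i<l. \<beta> (g1 u) (y i) * \<beta> (x i) t) + (\<Sum>i<l. - \<beta> (g1 u) (x i) * \<beta> (y i) t)"
      unfolding ker.expand_def by (simp only: \<beta>_linear(1,2) \<beta>_sum_left)
    finally show ?thesis by (simp add: sum_subtractf sum_negf)
  qed
  show "graded_lie_algebra M" by (rule M_graded_lie)
  show "0 < l"
  proof (rule ccontr)
    assume "\<not> 0 < l"
    then have z: "u = 0" if "g2 u = 0" for u using span[OF that] by (simp add: ker.expand_def)
    have "s = 0" for s :: 'w using z[of "g2 s"] z[of s] by simp
    then show False using W_nonzero by blast
  qed
  show "piece M p = {0}" if "p < -2" for p using that by (simp add: M_simps)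
  show "frame_e x y b (Xc i) \<in> piece M (-1)" "frame_e x y b (Yc i) \<in> piece M (-1)" for i b
    by (simp_all add: e M_simps)
  show "frame_e x y b Zc \<in> piece M (-2)" for b by (simp add: e M_simps)
  show "bracket M (frame_e x y b (Xc i)) (frame_e x y b (Xc j)) = 0" if "i < l" "j < l" for i j b
    using that by (cases b) (simp_all add: e brT k om om' zero_prod_def)
  show "bracket M (frame_e x y b (Yc i)) (frame_e x y b (Yc j)) = 0" if "i < l" "j < l" for i j b
    using that by (cases b) (simp_all add: e brT k om om' zero_prod_def \<gamma>_scale \<beta>_linear)
  show "bracket M (frame_e x y b (Xc i)) (frame_e x y b (Yc j)) = (if i = j then frame_e x y b Zc else 0)"
    if "i < l" "j < l" for i j b
    using that by (cases b) (simp_all add: e brT k om om' zero_prod_def \<beta>_linear)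
  show "frame_lam b (z + z') = frame_lam b z + frame_lam b z'" for b z z'
    by (simp add: frame_lam_def q_linear)
  show "frame_lam b (scal M c z) = c * frame_lam b z" for b c z
    by (simp add: frame_lam_def M_simps q_linear)
  show "frame_lam b (frame_e x y b Zc) = 1" for b
    by (simp add: frame_lam_def e q_linear q_uminus pair pair')
  show "frame_lam b (bracket M s t) =
     (\<Sum>i<l. frame_lam b (bracket M s (frame_e x y b (Yc i))) * frame_lam b (bracket M (frame_e x y b (Xc i)) t)
       - frame_lam b (bracket M s (frame_e x y b (Xc i))) * frame_lam b (bracket M (frame_e x y b (Yc i)) t))"
    for b s t
  proof (cases b)
    case True
    let ?u = "g2 (g1 (fst s))"
    have u: "g2 ?u = 0" by simp
    have g: "\<beta> (g1 u) t = \<epsilon> * \<beta> u (g1 t)" for u t by (rule \<beta>_\<gamma>)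
    have "\<beta> (g1 (fst s)) (fst t) = \<epsilon> * \<beta> ?u (g1 (fst t))"
      using g[of ?u "fst t"] by simp
    also have "\<dots> = (\<Sum>i<l. \<beta> (g1 (fst s)) (y i) * (\<epsilon> * \<beta> (x i) (g1 (fst t)))
        - \<beta> (g1 (fst s)) (x i) * (\<epsilon> * \<beta> (y i) (g1 (fst t))))"
      unfolding expand_\<beta>[OF u] by (simp add: sum_distrib_left algebra_simps)
    also have "\<dots> = (\<Sum>i<l. \<beta> (g1 (fst s)) (y i) * \<beta> (g1 (x i)) (fst t)
        - \<beta> (g1 (fst s)) (x i) * \<beta> (g1 (y i)) (fst t))"
      by (simp only: g[symmetric])
    finally show ?thesis using True by (simp add: lam e)
  next
    case False
    let ?u = "g2 (fst s)"
    have u: "g2 ?u = 0" by simp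
    have g: "\<beta> ?u (g1 t) = \<epsilon> * \<beta> (g1 ?u) t" for t
      by (simp add: \<beta>_\<gamma>[of e1 ?u t] mult.assoc[symmetric])
    have "\<beta> ?u (fst t) = (\<Sum>i<l. \<beta> (g1 ?u) (y i) * \<beta> (x i) (fst t) - \<beta> (g1 ?u) (x i) * \<beta> (y i) (fst t))"
      by (rule expand_\<beta>[OF u])
    also have "\<dots> = (\<Sum>i<l. \<beta> ?u (scW \<epsilon> (g1 (y i))) * \<beta> (g2 (g1 (x i))) (fst t)
        - \<beta> ?u (g1 (x i)) * \<beta> (g2 (scW \<epsilon> (g1 (y i)))) (fst t))"
    proof (rule sum.cong)
      fix i assume "i \<in> {..<l}"
      then have gk: "g2 (g1 (x i)) = x i" "g2 (g1 (y i)) = y i" using k by auto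
      have \<epsilon>: "\<epsilon> * (\<epsilon> * c) = c" "\<epsilon> * a * (\<epsilon> * c) = a * c" for a c
        by (simp add: mult.assoc[symmetric], metis \<epsilon>_square mult.assoc mult.left_commute mult_1)
      show "\<beta> (g1 ?u) (y i) * \<beta> (x i) (fst t) - \<beta> (g1 ?u) (x i) * \<beta> (y i) (fst t)
        = \<beta> ?u (scW \<epsilon> (g1 (y i))) * \<beta> (g2 (g1 (x i))) (fst t)
        - \<beta> ?u (g1 (x i)) * \<beta> (g2 (scW \<epsilon> (g1 (y i)))) (fst t)"
        by (simp only: gk \<gamma>_scale \<beta>_linear g \<epsilon>)
    qed simp
    finally show ?thesis using False by (simp add: lam e)
  qed
  show "frame_lam b (bracket M s (frame_e x y (\<not> b) u)) = 0"
    if s: "s \<in> piece M (-1)" and i: "i < l" and u: "u \<in> {Xc i, Yc i}" for b s i u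
    using u i k[OF i] unfolding lam
    by (cases b) (auto simp: e \<beta>_\<gamma>[of _ "fst s"] \<gamma>_scale)
  show "z = scal M (frame_lam True z) (frame_e x y True Zc) + scal M (frame_lam False z) (frame_e x y False Zc)"
    if z: "z \<in> piece M (-2)" for z
  proof -
    have "snd z = scV (- 2 * q (snd z) e2) e1 + scV (- 2 * q (snd z) e1) e2" by (rule decomp)
    also have "\<dots> = scV (q (snd z) e1) (scV (- 2) e2) + scV (q (snd z) e2) (scV (- 2) e1)"
      by (simp only: scale_scale mult.commute add.commute)
    finally show ?thesis using z by (auto simp: M_simps e frame_lam_def prod_eq_iff)
  qed
  show "s = 0" if s: "s \<in> piece M (-1)" and 0: "\<And>t. t \<in> piece M (-1) \<Longrightarrow> bracket M s t = 0" for s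
  proof -
    have "frame_lam b (bracket M s (t, 0)) = 0" for b t
      using 0[of "(t, 0)"] by (simp add: M_simps frame_lam_def zero_prod_def)
    then have z: "\<beta> (\<gamma> (if b then e1 else e2) (fst s)) t = 0" for b t by (simp add: lam)
    have "g1 (fst s) = 0" by (rule \<beta>_nondegD) (use z[of True] in simp)
    moreover have "g2 (fst s) = 0" by (rule \<beta>_nondegD) (use z[of False] in simp)
    ultimately have "fst s = 0" using g12[of "fst s"] by simp
    with s show "s = 0" by (auto simp: M_simps zero_prod_def)
  qed
qed

lemma prolongation_of_M:
  "even (num_components scV q scW act)
    \<and> graded_iso M (lie_direct_sum (heisenberg_algebra (num_components scV q scW act div 2))
        (heisenberg_algebra (num_components scV q scW act div 2)))
    \<and> maximal_transitive_prolongation TYPE('t::ab_group_add) M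
        (lie_direct_sum (contact_algebra (num_components scV q scW act div 2))
          (contact_algebra (num_components scV q scW act div 2)))"
proof -
  obtain l x y where xy: "ker.symplectic_family l x y"
    and span: "\<And>u. g2 u = 0 \<Longrightarrow> u = ker.expand l x y u"
    using ker.symplectic_basis_exists by auto
  have N: "num_components scV q scW act = l + l" by (rule num_components_symplectic[OF xy span])
  interpret D: double_heisenberg M l "frame_e x y" frame_lam
    by (rule M_double_heisenberg[OF xy span])
  have nonneg: "piece M p = {0}" if "p \<ge> 0" for p using that by (simp add: M_simps)
  have "(l + l) div 2 = l" by simp
  then show ?thesis
    unfolding N using D.graded_iso_double_heisenberg[OF nonneg] D.maximal_prolongation[OF nonneg] by simp
qed

end

section \<open>The prolongation\<close>

theorem proposition4p1:
  fixes scV :: "complex \<Rightarrow> 'v::ab_group_add \<Rightarrow> 'v"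
    and q :: "'v \<Rightarrow> 'v \<Rightarrow> complex"
    and scW :: "complex \<Rightarrow> 'w::ab_group_add \<Rightarrow> 'w"
    and act :: "'v cliff \<Rightarrow> 'w \<Rightarrow> 'w"
    and spin :: "('v \<Rightarrow> 'v) \<Rightarrow> 'w \<Rightarrow> 'w"
    and \<beta> :: "'w \<Rightarrow> 'w \<Rightarrow> complex"
    and \<epsilon> :: complex
    and N :: nat
    and M :: "('w \<times> 'v) graded_lie"
  assumes "extended_translation_data scV q scW act spin \<beta> \<epsilon>"
    and "vector_space.dim scV (UNIV :: 'v set) = 2"
    and "N = num_components scV q scW act"
    and "M = extended_translation_algebra scV q scW act \<beta>"
  shows "even N
    \<and> graded_iso M (lie_direct_sum (heisenberg_algebra (N div 2)) (heisenberg_algebra (N div 2)))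
    \<and> maximal_transitive_prolongation TYPE('t::ab_group_add) M
        (lie_direct_sum (contact_algebra (N div 2)) (contact_algebra (N div 2)))"
proof -
  interpret E: extended_translation_data scV q scW act spin \<beta> \<epsilon> by fact
  obtain e1 e2 where e: "q e1 e1 = 0" "q e2 e2 = 0" "q e1 e2 = - 1 / 2"
    "\<And>v. v = scV (- 2 * q v e2) e1 + scV (- 2 * q v e1) e2"
    using E.null_basis_exists[OF assms(2)] by blast
  interpret null_basis_translation scV q scW act spin \<beta> \<epsilon> e1 e2
    by unfold_locales (fact e)+
  show ?thesis unfolding assms(3,4) by (rule prolongation_of_M)
qed

end
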